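(* Let $S$ be a commutative semiring with $1_S\neq 0_S$. 1. There is an isomorphism of categories $\mathbf{SBialg}_S\simeq \mathbf{Bimonoid}(\mathbb{S}_S)$ between the category of $S$-bisemialgebras and the category of bimonoids in the symmetric monoidal category $(\mathbb{S}_S,\otimes_S,S;\tau)$. 2. Let $B$ be an $S$-semimodule. There is a bijective correspondence between the structures of $S$-bisemialgebras on $B$, the bimonad structures on $B\otimes_S-:\mathbb{S}_S\to\mathbb{S}_S$ and the bimonad structures on $-\otimes_S B:\mathbb{S}_S\to\mathbb{S}_S$. 3. For every $S$-bisemialgebra $B$ there are isomorphisms of categories $$\mathbb{S}_B^B\simeq(\mathbb{S}_B)^{-\otimes_S B}\simeq((\mathbb{S}_S)_{-\otimes_S B})^{-\otimes_S B}\quad\text{and}\quad \mathbb{S}_B^B\simeq(\mathbb{S}^B)_{-\otimes_S B}\simeq((\mathbb{S}_S)^{-\otimes_S B})_{-\otimes_S B}.$$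
   Context: A semiring is a unital ring not necessarily with subtraction (with $0$ absorbing); semimodules are modules not necessarily with subtraction. $\mathbb{S}_S$ is the category of $S$-semimodules and $S$-linear maps; with the natural tensor product $\otimes_S$ (representing bilinear maps) and $\tau_{(M,N)}(m\otimes n)=n\otimes m$ it is a symmetric monoidal category. An $S$-semialgebra $(B,\mu,\eta)$ is a monoid in $\mathbb{S}_S$; an $S$-semicoalgebra $(B,\Delta,\varepsilon)$ is a comonoid in $\mathbb{S}_S$ (write $\Delta(b)=\sum b_1\otimes b_2$). An $S$-bisemialgebra is $(B,\mu,\eta,\Delta,\varepsilon)$ where $(B,\mu,\eta)$ is an $S$-semialgebra, $(B,\Delta,\varepsilon)$ is an $S$-semicoalgebra, and $\Delta:B\to B\otimes_S B$ and $\varepsilon:B\to S$ are morphisms of $S$-semialgebras; morphisms are the $S$-linear maps that are both semialgebra and semicoalgebra morphisms. Bimonads. Let $F=B\otimes_S-$ (resp. $F=-\otimes_S B$) and let $\tau:FF\to FF$ be the natural transformation induced by the twist $\tau_{(B,B)}:B\otimes_S B\to B\otimes_S B$. A bimonad structure on $F$ consists of a monad structure $(m:FF\to F,\ e:\mathrm{id}\to F)$ and a comonad structure $(\delta:F\to FF,\ \epsilon:F\to\mathrm{id})$ such that $\epsilon$ is a morphism of monads to the identity monad, $e$ is a morphism of comonads from the identity comonad, and $\delta\circ m=(mm)\circ(F\tau F)\circ(\delta\delta)$, where $mm:FFFF\to FF$ and $\delta\delta:FF\to FFFF$ are horizontal composites. For a monad (resp. comonad) $T$ on a category $\mathfrak{A}$,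 $\mathfrak{A}_T$ (resp. $\mathfrak{A}^T$) is its Eilenberg–Moore category of $T$-modules (resp. $T$-comodules). $\mathbb{S}_B$ is the category of right $B$-semimodules, and $\mathbb{S}^B$ is the category of right $B$-semicomodules $(M,\rho^M:M\to M\otimes_S B)$, $\rho^M(m)=\sum m_{<0>}\otimes m_{<1>}$ (coassociative and counital), with colinear maps. $\mathbb{S}_B^B$ is the category of right-right Hopf semimodules: $S$-semimodules $M$ that are right $B$-semimodules and right $B$-semicomodules with $\sum(mb)_{<0>}\otimes_S(mb)_{<1>}=\sum m_{<0>}b_1\otimes_S m_{<1>}b_2$ for all $m\in M$, $b\in B$; morphisms are the $B$-linear and $B$-colinear maps. In part 3, $-\otimes_S B$ on $\mathbb{S}_S$ is the monad (resp. comonad) induced by the semialgebra (resp. semicoalgebra) structure of $B$. The comonad $-\otimes_S B$ on $\mathbb{S}_B$ sends $N$ to $N\otimes_S B$ with right action $(n\otimes b)b'=\sum nb'_1\otimes bb'_2$, and its structure comes from $\Delta,\varepsilon$. The monad $-\otimes_S B$ on $\mathbb{S}^B$ sends $L$ to $L\otimes_S B$ with coaction $l\otimes b\mapsto\sum l_{<0>}\otimes b_1\otimes l_{<1>}b_2$, and its structure comes from $\mu,\eta$. *)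

theory Defs
  imports "HOL-Algebra.Module" "HOL-Library.Multiset" "HOL-Library.Infinite_Typeclass"
begin

section \<open>Categories, functors, natural transformations\<close>

record ('o, 'a) cat =
  Ob :: "'o set"
  Ar :: "'a set"
  Dom :: "'a \<Rightarrow> 'o"
  Cod :: "'a \<Rightarrow> 'o"
  Id :: "'o \<Rightarrow> 'a"
  Comp :: "'a \<Rightarrow> 'a \<Rightarrow> 'a"  (infixr \<open>\<cdot>\<index>\<close> 55)

definition Hom :: "('o, 'a, 'x) cat_scheme \<Rightarrow> 'o \<Rightarrow> 'o \<Rightarrow> 'a set" where
  "Hom C X Y = {f \<in> Ar C. Dom C f = X \<and> Cod C f = Y}"

locale category =
  fixes C :: "('o, 'a, 'x) cat_scheme" (structure)
  assumes Dom_Ob: "f \<in> Ar C \<Longrightarrow> Dom C f \<in> Ob C"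
    and Cod_Ob: "f \<in> Ar C \<Longrightarrow> Cod C f \<in> Ob C"
    and Id_Hom: "X \<in> Ob C \<Longrightarrow> Id C X \<in> Hom C X X"
    and Comp_Hom: "f \<in> Hom C X Y \<Longrightarrow> g \<in> Hom C Y Z \<Longrightarrow> g \<cdot> f \<in> Hom C X Z"
    and Id_left: "f \<in> Hom C X Y \<Longrightarrow> Id C Y \<cdot> f = f"
    and Id_right: "f \<in> Hom C X Y \<Longrightarrow> f \<cdot> Id C X = f"
    and Comp_assoc: "f \<in> Hom C X Y \<Longrightarrow> g \<in> Hom C Y Z \<Longrightarrow> h \<in> Hom C Z W \<Longrightarrow>
      (h \<cdot> g) \<cdot> f = h \<cdot> (g \<cdot> f)"

definition inv_arr :: "('o, 'a, 'x) cat_scheme \<Rightarrow> 'a \<Rightarrow> 'a" where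
  "inv_arr C f = (THE g. g \<in> Hom C (Cod C f) (Dom C f) \<and>
     g \<cdot>\<^bsub>C\<^esub> f = Id C (Dom C f) \<and> f \<cdot>\<^bsub>C\<^esub> g = Id C (Cod C f))"

record ('o, 'a, 'p, 'b) fctr =
  FOb :: "'o \<Rightarrow> 'p"
  FAr :: "'a \<Rightarrow> 'b"

definition is_functor ::
  "('o, 'a, 'x) cat_scheme \<Rightarrow> ('p, 'b, 'y) cat_scheme \<Rightarrow> ('o, 'a, 'p, 'b) fctr \<Rightarrow> bool" where
  "is_functor C D F \<longleftrightarrow>
     (\<forall>X \<in> Ob C. FOb F X \<in> Ob D) \<and>
     (\<forall>f \<in> Ar C. FAr F f \<in> Hom D (FOb F (Dom C f)) (FOb F (Cod C f))) \<and>
     (\<forall>X \<in> Ob C. FAr F (Id C X) = Id D (FOb F X)) \<and>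
     (\<forall>f \<in> Ar C. \<forall>g \<in> Ar C. Cod C f = Dom C g \<longrightarrow>
        FAr F (g \<cdot>\<^bsub>C\<^esub> f) = FAr F g \<cdot>\<^bsub>D\<^esub> FAr F f)"

definition id_fctr :: "('o, 'a, 'o, 'a) fctr" where
  "id_fctr = \<lparr>FOb = (\<lambda>X. X), FAr = (\<lambda>f. f)\<rparr>"

definition comp_fctr ::
  "('p, 'b, 'q, 'c) fctr \<Rightarrow> ('o, 'a, 'p, 'b) fctr \<Rightarrow> ('o, 'a, 'q, 'c) fctr" where
  "comp_fctr G F = \<lparr>FOb = (\<lambda>X. FOb G (FOb F X)), FAr = (\<lambda>f. FAr G (FAr F f))\<rparr>"

definition isomorphic_categories ::
  "('o, 'a, 'x) cat_scheme \<Rightarrow> ('p, 'b, 'y) cat_scheme \<Rightarrow> bool" where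
  "isomorphic_categories C D \<longleftrightarrow> category C \<and> category D \<and>
     (\<exists>F G. is_functor C D F \<and> is_functor D C G \<and>
       (\<forall>X \<in> Ob C. FOb G (FOb F X) = X) \<and> (\<forall>f \<in> Ar C. FAr G (FAr F f) = f) \<and>
       (\<forall>Y \<in> Ob D. FOb F (FOb G Y) = Y) \<and> (\<forall>g \<in> Ar D. FAr F (FAr G g) = g))"

text \<open>Families of components are extensional on the objects, so that equality of natural
  transformations is equality of their components.\<close>

definition nat_trans ::
  "('o, 'a, 'x) cat_scheme \<Rightarrow> ('p, 'b, 'y) cat_scheme \<Rightarrow>
   ('o, 'a, 'p, 'b) fctr \<Rightarrow> ('o, 'a, 'p, 'b) fctr \<Rightarrow> ('o \<Rightarrow> 'b) set" where
  "nat_trans C D F G = {t \<in> extensional (Ob C).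
     is_functor C D F \<and> is_functor C D G \<and>
     (\<forall>X \<in> Ob C. t X \<in> Hom D (FOb F X) (FOb G X)) \<and>
     (\<forall>f \<in> Ar C. t (Cod C f) \<cdot>\<^bsub>D\<^esub> FAr F f = FAr G f \<cdot>\<^bsub>D\<^esub> t (Dom C f))}"

definition id_trans :: "('o, 'a, 'x) cat_scheme \<Rightarrow> 'o \<Rightarrow> 'a" where
  "id_trans C = (\<lambda>X \<in> Ob C. Id C X)"

text \<open>The horizontal composite of \<open>\<alpha>: F \<rightarrow> G\<close> followed by \<open>\<beta>: H \<rightarrow> K\<close>, with components
  \<open>\<beta>\<^sub>G\<^sub>X \<cdot> H \<alpha>\<^sub>X: HFX \<rightarrow> KGX\<close>.\<close>

definition hcomp ::
  "('o, 'a, 'x) cat_scheme \<Rightarrow> ('o, 'a, 'o, 'a) fctr \<Rightarrow> ('o, 'a, 'o, 'a) fctr \<Rightarrow>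
   ('o \<Rightarrow> 'a) \<Rightarrow> ('o \<Rightarrow> 'a) \<Rightarrow> 'o \<Rightarrow> 'a" where
  "hcomp C H G \<beta> \<alpha> = (\<lambda>X \<in> Ob C. \<beta> (FOb G X) \<cdot>\<^bsub>C\<^esub> FAr H (\<alpha> X))"

text \<open>The category of structured objects over a category \<open>C\<close>: objects are the elements of \<open>A\<close>, with
  underlying objects given by \<open>U\<close>; the morphisms \<open>X \<rightarrow> Y\<close> are the \<open>f: U X \<rightarrow> U Y\<close> in \<open>C\<close> satisfying
  \<open>P X Y f\<close>, labelled by their domain and codomain.\<close>

definition structured_cat ::
  "('o, 'a, 'x) cat_scheme \<Rightarrow> 's set \<Rightarrow> ('s \<Rightarrow> 'o) \<Rightarrow> ('s \<Rightarrow> 's \<Rightarrow> 'a \<Rightarrow> bool) \<Rightarrow>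
   ('s, 's \<times> 'a \<times> 's) cat" where
  "structured_cat C A U P =
    \<lparr>Ob = A,
     Ar = {(X, f, Y). X \<in> A \<and> Y \<in> A \<and> f \<in> Hom C (U X) (U Y) \<and> P X Y f},
     Dom = (\<lambda>(X, f, Y). X),
     Cod = (\<lambda>(X, f, Y). Y),
     Id = (\<lambda>X. (X, Id C (U X), X)),
     Comp = (\<lambda>(Y, g, Z) (X, f, Y'). (X, g \<cdot>\<^bsub>C\<^esub> f, Z))\<rparr>"


section \<open>Monads, comonads and bimonads\<close>

context
  fixes C :: "('o, 'a, 'x) cat_scheme" (structure)
begin

definition monad :: "('o, 'a, 'o, 'a) fctr \<Rightarrow> ('o \<Rightarrow> 'a) \<Rightarrow> ('o \<Rightarrow> 'a) \<Rightarrow> bool" where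
  "monad F m e \<longleftrightarrow>
     m \<in> nat_trans C C (comp_fctr F F) F \<and> e \<in> nat_trans C C id_fctr F \<and>
     (\<forall>X \<in> Ob C. m X \<cdot> FAr F (m X) = m X \<cdot> m (FOb F X)) \<and>
     (\<forall>X \<in> Ob C. m X \<cdot> FAr F (e X) = Id C (FOb F X)) \<and>
     (\<forall>X \<in> Ob C. m X \<cdot> e (FOb F X) = Id C (FOb F X))"

definition comonad :: "('o, 'a, 'o, 'a) fctr \<Rightarrow> ('o \<Rightarrow> 'a) \<Rightarrow> ('o \<Rightarrow> 'a) \<Rightarrow> bool" where
  "comonad F d c \<longleftrightarrow>
     d \<in> nat_trans C C F (comp_fctr F F) \<and> c \<in> nat_trans C C F id_fctr \<and>
     (\<forall>X \<in> Ob C. FAr F (d X) \<cdot> d X = d (FOb F X) \<cdot> d X) \<and>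
     (\<forall>X \<in> Ob C. FAr F (c X) \<cdot> d X = Id C (FOb F X)) \<and>
     (\<forall>X \<in> Ob C. c (FOb F X) \<cdot> d X = Id C (FOb F X))"

definition monad_morphism ::
  "('o, 'a, 'o, 'a) fctr \<Rightarrow> ('o \<Rightarrow> 'a) \<Rightarrow> ('o \<Rightarrow> 'a) \<Rightarrow>
   ('o, 'a, 'o, 'a) fctr \<Rightarrow> ('o \<Rightarrow> 'a) \<Rightarrow> ('o \<Rightarrow> 'a) \<Rightarrow> ('o \<Rightarrow> 'a) \<Rightarrow> bool" where
  "monad_morphism F m e F' m' e' t \<longleftrightarrow>
     t \<in> nat_trans C C F F' \<and>
     (\<forall>X \<in> Ob C. t X \<cdot> m X = m' X \<cdot> hcomp C F F' t t X) \<and>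
     (\<forall>X \<in> Ob C. t X \<cdot> e X = e' X)"

definition comonad_morphism ::
  "('o, 'a, 'o, 'a) fctr \<Rightarrow> ('o \<Rightarrow> 'a) \<Rightarrow> ('o \<Rightarrow> 'a) \<Rightarrow>
   ('o, 'a, 'o, 'a) fctr \<Rightarrow> ('o \<Rightarrow> 'a) \<Rightarrow> ('o \<Rightarrow> 'a) \<Rightarrow> ('o \<Rightarrow> 'a) \<Rightarrow> bool" where
  "comonad_morphism F d c F' d' c' t \<longleftrightarrow>
     t \<in> nat_trans C C F F' \<and>
     (\<forall>X \<in> Ob C. d' X \<cdot> t X = hcomp C F F' t t X \<cdot> d X) \<and>
     (\<forall>X \<in> Ob C. c' X \<cdot> t X = c X)"

definition bimonad_structures ::
  "('o, 'a, 'o, 'a) fctr \<Rightarrow> ('o \<Rightarrow> 'a) \<Rightarrow>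
   (('o \<Rightarrow> 'a) \<times> ('o \<Rightarrow> 'a) \<times> ('o \<Rightarrow> 'a) \<times> ('o \<Rightarrow> 'a)) set" where
  "bimonad_structures F \<tau> = {(m, e, d, c).
     monad F m e \<and> comonad F d c \<and>
     monad_morphism F m e id_fctr (id_trans C) (id_trans C) c \<and>
     comonad_morphism id_fctr (id_trans C) (id_trans C) F d c e \<and>
     (\<forall>X \<in> Ob C. d X \<cdot> m X =
        hcomp C (comp_fctr F F) F m m X \<cdot> FAr F (\<tau> (FOb F X)) \<cdot>
        hcomp C F (comp_fctr F F) d d X)}"

definition EM_modules ::
  "('o, 'a, 'o, 'a) fctr \<Rightarrow> ('o \<Rightarrow> 'a) \<Rightarrow> ('o \<Rightarrow> 'a) \<Rightarrow>
   ('o \<times> 'a, ('o \<times> 'a) \<times> 'a \<times> ('o \<times> 'a)) cat" where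
  "EM_modules F m e = structured_cat C
     {(X, h). X \<in> Ob C \<and> h \<in> Hom C (FOb F X) X \<and>
        h \<cdot> FAr F h = h \<cdot> m X \<and> h \<cdot> e X = Id C X}
     fst
     (\<lambda>(X, h) (Y, k) f. f \<cdot> h = k \<cdot> FAr F f)"

definition EM_comodules ::
  "('o, 'a, 'o, 'a) fctr \<Rightarrow> ('o \<Rightarrow> 'a) \<Rightarrow> ('o \<Rightarrow> 'a) \<Rightarrow>
   ('o \<times> 'a, ('o \<times> 'a) \<times> 'a \<times> ('o \<times> 'a)) cat" where
  "EM_comodules F d c = structured_cat C
     {(X, h). X \<in> Ob C \<and> h \<in> Hom C X (FOb F X) \<and>
        FAr F h \<cdot> h = d X \<cdot> h \<and> c X \<cdot> h = Id C X}
     fst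
     (\<lambda>(X, h) (Y, k) f. k \<cdot> f = FAr F f \<cdot> h)"

end


section \<open>Bimonoids in symmetric monoidal categories\<close>

text \<open>The data of a symmetric monoidal category;
  \<open>Assoc X Y Z: (X \<otimes> Y) \<otimes> Z \<rightarrow> X \<otimes> (Y \<otimes> Z)\<close>, \<open>LUnit X: I \<otimes> X \<rightarrow> X\<close>, \<open>RUnit X: X \<otimes> I \<rightarrow> X\<close>
  and \<open>Twist X Y: X \<otimes> Y \<rightarrow> Y \<otimes> X\<close>.\<close>

record ('o, 'a) smcat = "('o, 'a) cat" +
  TOb :: "'o \<Rightarrow> 'o \<Rightarrow> 'o"  (infixl \<open>\<otimes>\<^sub>o\<index>\<close> 65)
  TAr :: "'a \<Rightarrow> 'a \<Rightarrow> 'a"  (infixl \<open>\<otimes>\<^sub>a\<index>\<close> 65)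
  TUnit :: "'o"
  Assoc :: "'o \<Rightarrow> 'o \<Rightarrow> 'o \<Rightarrow> 'a"
  LUnit :: "'o \<Rightarrow> 'a"
  RUnit :: "'o \<Rightarrow> 'a"
  Twist :: "'o \<Rightarrow> 'o \<Rightarrow> 'a"

type_synonym ('o, 'a) bimon = "'o \<times> 'a \<times> 'a \<times> 'a \<times> 'a"

context
  fixes V :: "('o, 'a, 'x) smcat_scheme" (structure)
begin

definition middle :: "'o \<Rightarrow> 'o \<Rightarrow> 'o \<Rightarrow> 'o \<Rightarrow> 'a"
  \<comment> \<open>\<open>(X \<otimes> Y) \<otimes> (Z \<otimes> W) \<rightarrow> (X \<otimes> Z) \<otimes> (Y \<otimes> W)\<close>\<close> where
  "middle X Y Z W =
     inv_arr V (Assoc V X Z (Y \<otimes>\<^sub>o W)) \<cdot>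
     (Id V X \<otimes>\<^sub>a Assoc V Z Y W) \<cdot>
     (Id V X \<otimes>\<^sub>a (Twist V Y Z \<otimes>\<^sub>a Id V W)) \<cdot>
     (Id V X \<otimes>\<^sub>a inv_arr V (Assoc V Y Z W)) \<cdot>
     Assoc V X Y (Z \<otimes>\<^sub>o W)"

definition is_monoid :: "'o \<Rightarrow> 'a \<Rightarrow> 'a \<Rightarrow> bool" where
  "is_monoid B \<mu> \<eta> \<longleftrightarrow>
     B \<in> Ob V \<and> \<mu> \<in> Hom V (B \<otimes>\<^sub>o B) B \<and> \<eta> \<in> Hom V (TUnit V) B \<and>
     \<mu> \<cdot> (\<mu> \<otimes>\<^sub>a Id V B) = \<mu> \<cdot> (Id V B \<otimes>\<^sub>a \<mu>) \<cdot> Assoc V B B B \<and>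
     \<mu> \<cdot> (\<eta> \<otimes>\<^sub>a Id V B) = LUnit V B \<and>
     \<mu> \<cdot> (Id V B \<otimes>\<^sub>a \<eta>) = RUnit V B"

definition is_comonoid :: "'o \<Rightarrow> 'a \<Rightarrow> 'a \<Rightarrow> bool" where
  "is_comonoid B \<Delta> \<epsilon> \<longleftrightarrow>
     B \<in> Ob V \<and> \<Delta> \<in> Hom V B (B \<otimes>\<^sub>o B) \<and> \<epsilon> \<in> Hom V B (TUnit V) \<and>
     Assoc V B B B \<cdot> (\<Delta> \<otimes>\<^sub>a Id V B) \<cdot> \<Delta> = (Id V B \<otimes>\<^sub>a \<Delta>) \<cdot> \<Delta> \<and>
     LUnit V B \<cdot> (\<epsilon> \<otimes>\<^sub>a Id V B) \<cdot> \<Delta> = Id V B \<and>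
     RUnit V B \<cdot> (Id V B \<otimes>\<^sub>a \<epsilon>) \<cdot> \<Delta> = Id V B"

fun is_bimonoid :: "('o, 'a) bimon \<Rightarrow> bool" where
  "is_bimonoid (B, \<mu>, \<eta>, \<Delta>, \<epsilon>) \<longleftrightarrow>
     is_monoid B \<mu> \<eta> \<and> is_comonoid B \<Delta> \<epsilon> \<and>
     \<Delta> \<cdot> \<mu> = (\<mu> \<otimes>\<^sub>a \<mu>) \<cdot> middle B B B B \<cdot> (\<Delta> \<otimes>\<^sub>a \<Delta>) \<and>
     \<Delta> \<cdot> \<eta> = (\<eta> \<otimes>\<^sub>a \<eta>) \<cdot> inv_arr V (LUnit V (TUnit V)) \<and>
     \<epsilon> \<cdot> \<mu> = LUnit V (TUnit V) \<cdot> (\<epsilon> \<otimes>\<^sub>a \<epsilon>) \<and>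
     \<epsilon> \<cdot> \<eta> = Id V (TUnit V)"

definition monoid_morphism :: "'a \<Rightarrow> 'a \<Rightarrow> 'a \<Rightarrow> 'a \<Rightarrow> 'a \<Rightarrow> bool" where
  "monoid_morphism \<mu> \<eta> \<mu>' \<eta>' f \<longleftrightarrow> f \<cdot> \<mu> = \<mu>' \<cdot> (f \<otimes>\<^sub>a f) \<and> f \<cdot> \<eta> = \<eta>'"

definition comonoid_morphism :: "'a \<Rightarrow> 'a \<Rightarrow> 'a \<Rightarrow> 'a \<Rightarrow> 'a \<Rightarrow> bool" where
  "comonoid_morphism \<Delta> \<epsilon> \<Delta>' \<epsilon>' f \<longleftrightarrow> \<Delta>' \<cdot> f = (f \<otimes>\<^sub>a f) \<cdot> \<Delta> \<and> \<epsilon>' \<cdot> f = \<epsilon>"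

definition Bimonoid_cat ::
  "(('o, 'a) bimon, ('o, 'a) bimon \<times> 'a \<times> ('o, 'a) bimon) cat" where
  "Bimonoid_cat = structured_cat V {B. is_bimonoid B} fst
     (\<lambda>(B, \<mu>, \<eta>, \<Delta>, \<epsilon>) (B', \<mu>', \<eta>', \<Delta>', \<epsilon>') f.
        monoid_morphism \<mu> \<eta> \<mu>' \<eta>' f \<and> comonoid_morphism \<Delta> \<epsilon> \<Delta>' \<epsilon>' f)"

text \<open>The endofunctors \<open>B \<otimes> -\<close> and \<open>- \<otimes> B\<close>, the transformations of their squares induced by the
  twist of \<open>B \<otimes> B\<close>, and the transformations induced by arrows \<open>\<mu>, \<eta>, \<Delta>, \<epsilon>\<close>.\<close>

definition left_tensor :: "'o \<Rightarrow> ('o, 'a, 'o, 'a) fctr" where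
  "left_tensor B = \<lparr>FOb = (\<lambda>X. B \<otimes>\<^sub>o X), FAr = (\<lambda>f. Id V B \<otimes>\<^sub>a f)\<rparr>"

definition right_tensor :: "'o \<Rightarrow> ('o, 'a, 'o, 'a) fctr" where
  "right_tensor B = \<lparr>FOb = (\<lambda>X. X \<otimes>\<^sub>o B), FAr = (\<lambda>f. f \<otimes>\<^sub>a Id V B)\<rparr>"

definition left_twist :: "'o \<Rightarrow> 'o \<Rightarrow> 'a" where
  "left_twist B = (\<lambda>X \<in> Ob V.
     Assoc V B B X \<cdot> (Twist V B B \<otimes>\<^sub>a Id V X) \<cdot> inv_arr V (Assoc V B B X))"

definition right_twist :: "'o \<Rightarrow> 'o \<Rightarrow> 'a" where
  "right_twist B = (\<lambda>X \<in> Ob V.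
     inv_arr V (Assoc V X B B) \<cdot> (Id V X \<otimes>\<^sub>a Twist V B B) \<cdot> Assoc V X B B)"

definition left_mult :: "'o \<Rightarrow> 'a \<Rightarrow> 'o \<Rightarrow> 'a" where
  "left_mult B \<mu> = (\<lambda>X \<in> Ob V. (\<mu> \<otimes>\<^sub>a Id V X) \<cdot> inv_arr V (Assoc V B B X))"

definition left_unit :: "'a \<Rightarrow> 'o \<Rightarrow> 'a" where
  "left_unit \<eta> = (\<lambda>X \<in> Ob V. (\<eta> \<otimes>\<^sub>a Id V X) \<cdot> inv_arr V (LUnit V X))"

definition left_comult :: "'o \<Rightarrow> 'a \<Rightarrow> 'o \<Rightarrow> 'a" where
  "left_comult B \<Delta> = (\<lambda>X \<in> Ob V. Assoc V B B X \<cdot> (\<Delta> \<otimes>\<^sub>a Id V X))"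

definition left_counit :: "'a \<Rightarrow> 'o \<Rightarrow> 'a" where
  "left_counit \<epsilon> = (\<lambda>X \<in> Ob V. LUnit V X \<cdot> (\<epsilon> \<otimes>\<^sub>a Id V X))"

definition right_mult :: "'o \<Rightarrow> 'a \<Rightarrow> 'o \<Rightarrow> 'a" where
  "right_mult B \<mu> = (\<lambda>X \<in> Ob V. (Id V X \<otimes>\<^sub>a \<mu>) \<cdot> Assoc V X B B)"

definition right_unit :: "'a \<Rightarrow> 'o \<Rightarrow> 'a" where
  "right_unit \<eta> = (\<lambda>X \<in> Ob V. (Id V X \<otimes>\<^sub>a \<eta>) \<cdot> inv_arr V (RUnit V X))"

definition right_comult :: "'o \<Rightarrow> 'a \<Rightarrow> 'o \<Rightarrow> 'a" where
  "right_comult B \<Delta> = (\<lambda>X \<in> Ob V. inv_arr V (Assoc V X B B) \<cdot> (Id V X \<otimes>\<^sub>a \<Delta>))"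

definition right_counit :: "'a \<Rightarrow> 'o \<Rightarrow> 'a" where
  "right_counit \<epsilon> = (\<lambda>X \<in> Ob V. RUnit V X \<cdot> (Id V X \<otimes>\<^sub>a \<epsilon>))"

end


section \<open>Semimodules and their tensor product\<close>

locale comm_semiring = semiring S + comm_monoid S for S (structure)

locale semimodule = S?: comm_semiring S + M?: abelian_monoid M
  for S (structure) and M (structure) +
  assumes smult_closed: "s \<in> carrier S \<Longrightarrow> x \<in> carrier M \<Longrightarrow> s \<odot>\<^bsub>M\<^esub> x \<in> carrier M"
    and smult_l_distr: "s \<in> carrier S \<Longrightarrow> t \<in> carrier S \<Longrightarrow> x \<in> carrier M \<Longrightarrow>
      (s \<oplus>\<^bsub>S\<^esub> t) \<odot>\<^bsub>M\<^esub> x = s \<odot>\<^bsub>M\<^esub> x \<oplus>\<^bsub>M\<^esub> t \<odot>\<^bsub>M\<^esub> x"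
    and smult_r_distr: "s \<in> carrier S \<Longrightarrow> x \<in> carrier M \<Longrightarrow> y \<in> carrier M \<Longrightarrow>
      s \<odot>\<^bsub>M\<^esub> (x \<oplus>\<^bsub>M\<^esub> y) = s \<odot>\<^bsub>M\<^esub> x \<oplus>\<^bsub>M\<^esub> s \<odot>\<^bsub>M\<^esub> y"
    and smult_assoc: "s \<in> carrier S \<Longrightarrow> t \<in> carrier S \<Longrightarrow> x \<in> carrier M \<Longrightarrow>
      (s \<otimes>\<^bsub>S\<^esub> t) \<odot>\<^bsub>M\<^esub> x = s \<odot>\<^bsub>M\<^esub> (t \<odot>\<^bsub>M\<^esub> x)"
    and smult_one: "x \<in> carrier M \<Longrightarrow> \<one>\<^bsub>S\<^esub> \<odot>\<^bsub>M\<^esub> x = x"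
    and smult_l_null: "x \<in> carrier M \<Longrightarrow> \<zero>\<^bsub>S\<^esub> \<odot>\<^bsub>M\<^esub> x = \<zero>\<^bsub>M\<^esub>"
    and smult_r_null: "s \<in> carrier S \<Longrightarrow> s \<odot>\<^bsub>M\<^esub> \<zero>\<^bsub>M\<^esub> = \<zero>\<^bsub>M\<^esub>"

text \<open>Semimodules are taken in a universe: the carriers of \<open>S\<close> and of all semimodules are sets of
  elements of one type \<open>'u\<close>. If \<open>'u\<close> is infinite this universe is closed under tensor products.
  As in the library's modules, the fields \<open>mult\<close> and \<open>one\<close> of a semimodule are irrelevant.\<close>

type_synonym 'u smod = "('u, 'u) module"
type_synonym 'u slin = "'u smod \<times> ('u \<Rightarrow> 'u) \<times> 'u smod"

definition app :: "'u slin \<Rightarrow> 'u \<Rightarrow> 'u" where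
  "app f = fst (snd f)"

definition SMod :: "'u ring \<Rightarrow> ('u smod, 'u slin) cat" where
  "SMod S =
    \<lparr>Ob = {M. semimodule S M},
     Ar = {(M, f, N). semimodule S M \<and> semimodule S N \<and>
        f \<in> carrier M \<rightarrow>\<^sub>E carrier N \<and>
        (\<forall>x \<in> carrier M. \<forall>y \<in> carrier M. f (x \<oplus>\<^bsub>M\<^esub> y) = f x \<oplus>\<^bsub>N\<^esub> f y) \<and>
        (\<forall>s \<in> carrier S. \<forall>x \<in> carrier M. f (s \<odot>\<^bsub>M\<^esub> x) = s \<odot>\<^bsub>N\<^esub> f x)},
     Dom = (\<lambda>(M, f, N). M),
     Cod = (\<lambda>(M, f, N). N),
     Id = (\<lambda>M. (M, (\<lambda>x \<in> carrier M. x), M)),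
     Comp = (\<lambda>(N, g, P) (M, f, N'). (M, compose (carrier M) g f, P))\<rparr>"

text \<open>Formal sums of pairs, modulo the congruence generated by the relations of the tensor product
  that represents bilinear maps (no cancellation is imposed).\<close>

inductive tensor_cong ::
  "'u ring \<Rightarrow> 'u smod \<Rightarrow> 'u smod \<Rightarrow> ('u \<times> 'u) multiset \<Rightarrow> ('u \<times> 'u) multiset \<Rightarrow> bool"
  for S M N where
  refl: "set_mset x \<subseteq> carrier M \<times> carrier N \<Longrightarrow> tensor_cong S M N x x"
| sym: "tensor_cong S M N x y \<Longrightarrow> tensor_cong S M N y x"
| trans: "tensor_cong S M N x y \<Longrightarrow> tensor_cong S M N y z \<Longrightarrow> tensor_cong S M N x z"
| plus: "tensor_cong S M N x y \<Longrightarrow> tensor_cong S M N x' y' \<Longrightarrow>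
    tensor_cong S M N (x + x') (y + y')"
| add_left: "m \<in> carrier M \<Longrightarrow> m' \<in> carrier M \<Longrightarrow> n \<in> carrier N \<Longrightarrow>
    tensor_cong S M N {#(m \<oplus>\<^bsub>M\<^esub> m', n)#} {#(m, n), (m', n)#}"
| add_right: "m \<in> carrier M \<Longrightarrow> n \<in> carrier N \<Longrightarrow> n' \<in> carrier N \<Longrightarrow>
    tensor_cong S M N {#(m, n \<oplus>\<^bsub>N\<^esub> n')#} {#(m, n), (m, n')#}"
| zero_left: "n \<in> carrier N \<Longrightarrow> tensor_cong S M N {#(\<zero>\<^bsub>M\<^esub>, n)#} {#}"
| zero_right: "m \<in> carrier M \<Longrightarrow> tensor_cong S M N {#(m, \<zero>\<^bsub>N\<^esub>)#} {#}"
| smult: "s \<in> carrier S \<Longrightarrow> m \<in> carrier M \<Longrightarrow> n \<in> carrier N \<Longrightarrow>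
    tensor_cong S M N {#(s \<odot>\<^bsub>M\<^esub> m, n)#} {#(m, s \<odot>\<^bsub>N\<^esub> n)#}"

text \<open>The class of a formal sum is represented inside \<open>'u\<close>, by the code of a chosen element of it.\<close>

definition mset_code :: "('u \<times> 'u) multiset \<Rightarrow> 'u" where
  "mset_code = (SOME j. inj j)"

definition tensor_class :: "'u ring \<Rightarrow> 'u smod \<Rightarrow> 'u smod \<Rightarrow> ('u \<times> 'u) multiset \<Rightarrow> 'u" where
  "tensor_class S M N x = mset_code (SOME y. tensor_cong S M N x y)"

definition tensor_rep :: "'u ring \<Rightarrow> 'u smod \<Rightarrow> 'u smod \<Rightarrow> 'u \<Rightarrow> ('u \<times> 'u) multiset" where
  "tensor_rep S M N u =
     (SOME x. set_mset x \<subseteq> carrier M \<times> carrier N \<and> tensor_class S M N x = u)"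

definition pure :: "'u ring \<Rightarrow> 'u smod \<Rightarrow> 'u smod \<Rightarrow> 'u \<Rightarrow> 'u \<Rightarrow> 'u" where
  "pure S M N m n = tensor_class S M N {#(m, n)#}"

definition tensor :: "'u ring \<Rightarrow> 'u smod \<Rightarrow> 'u smod \<Rightarrow> 'u smod" where
  "tensor S M N =
    \<lparr>carrier = tensor_class S M N ` {x. set_mset x \<subseteq> carrier M \<times> carrier N},
     monoid.mult = undefined, one = undefined,
     zero = tensor_class S M N {#},
     add = (\<lambda>u v. tensor_class S M N (tensor_rep S M N u + tensor_rep S M N v)),
     smult = (\<lambda>s u. tensor_class S M N
        (image_mset (\<lambda>(m, n). (s \<odot>\<^bsub>M\<^esub> m, n)) (tensor_rep S M N u)))\<rparr>"

text \<open>Over an infinite \<open>'u\<close>, \<open>tensor S M N\<close> is a semimodule and represents the bilinear maps on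
  \<open>M \<times> N\<close>; see \<open>tensor_universal\<close>.\<close>

primrec list_code :: "('u \<times> 'u \<Rightarrow> 'u) \<Rightarrow> 'u \<Rightarrow> ('u \<times> 'u) list \<Rightarrow> 'u" where
  "list_code p z [] = z"
| "list_code p z (x # xs) = p (p x, list_code p z xs)"

lemma inj_mset_code:
  includes cardinal_syntax
  shows "inj (mset_code :: ('u::infinite \<times> 'u) multiset \<Rightarrow> 'u)"
proof -
  have "|UNIV :: ('u \<times> 'u) set| \<le>o |UNIV :: 'u set|"
    using card_of_Times_same_infinite[OF infinite_UNIV[where 'a='u]]
    by (simp add: ordIso_imp_ordLeq)
  then have "\<exists>p :: 'u \<times> 'u \<Rightarrow> 'u. inj_on p UNIV \<and> p ` UNIV \<subseteq> UNIV" by (subst card_of_ordLeq)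
  then obtain p :: "'u \<times> 'u \<Rightarrow> 'u" where p: "inj p" by (elim exE conjE)
  obtain c :: "nat \<Rightarrow> 'u" where c: "inj c"
    using infinite_countable_subset[OF infinite_UNIV[where 'a='u]] by (elim exE conjE)
  have eq: "xs = ys" if "length xs = length ys" "list_code p (c 0) xs = list_code p (c 0) ys" for xs ys
    using that
  proof (induction xs ys rule: list_induct2)
    case (Cons x xs y ys)
    then have "(p x, list_code p (c 0) xs) = (p y, list_code p (c 0) ys)"
      using injD[OF p] by (metis list_code.simps(2))
    then show ?case using Cons.IH injD[OF p] by (metis prod.inject)
  qed simp
  define j where "j xs = p (c (length xs), list_code p (c 0) xs)" for xs
  have j: "inj j"
  proof (rule injI)
    fix xs ys assume "j xs = j ys"
    then have "(c (length xs), list_code p (c 0) xs) = (c (length ys), list_code p (c 0) ys)"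
      unfolding j_def by (rule injD[OF p])
    then show "xs = ys" using eq injD[OF c] by (metis prod.inject)
  qed
  have "inj (\<lambda>x :: ('u \<times> 'u) multiset. j (SOME l. mset l = x))"
  proof (rule injI)
    fix x y :: "('u \<times> 'u) multiset" assume "j (SOME l. mset l = x) = j (SOME l. mset l = y)"
    then have "(SOME l. mset l = x) = (SOME l. mset l = y)" using j by (simp add: inj_eq)
    moreover have "mset (SOME l. mset l = x) = x" "mset (SOME l. mset l = y) = y"
      by (metis (mono_tags) ex_mset someI_ex)+
    ultimately show "x = y" by metis
  qed
  then have "\<exists>j :: ('u \<times> 'u) multiset \<Rightarrow> 'u. inj j" by blast
  then show ?thesis unfolding mset_code_def by (rule someI_ex)
qed

abbreviation (input) formal :: "'u smod \<Rightarrow> 'u smod \<Rightarrow> ('u \<times> 'u) multiset set" where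
  "formal M N \<equiv> {x. set_mset x \<subseteq> carrier M \<times> carrier N}"

context
  fixes S :: "'u::infinite ring" and M N :: "'u smod"
  assumes M: "semimodule S M" and N: "semimodule S N"
begin

interpretation M: semimodule S M by (rule M)
interpretation N: semimodule S N by (rule N)

lemma tensor_cong_formal: "tensor_cong S M N x y \<Longrightarrow> x \<in> formal M N \<and> y \<in> formal M N"
  by (induction rule: tensor_cong.induct) (auto simp: M.smult_closed N.smult_closed)

lemma tensor_class_eq_iff:
  assumes "x \<in> formal M N" "y \<in> formal M N"
  shows "tensor_class S M N x = tensor_class S M N y \<longleftrightarrow> tensor_cong S M N x y"
proof
  assume "tensor_class S M N x = tensor_class S M N y"
  then have e: "(SOME z. tensor_cong S M N x z) = (SOME z. tensor_cong S M N y z)"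
    unfolding tensor_class_def by (rule injD[OF inj_mset_code])
  have "tensor_cong S M N x (SOME z. tensor_cong S M N x z)"
    "tensor_cong S M N y (SOME z. tensor_cong S M N y z)"
    using assms by (auto intro!: someI[of "tensor_cong S M N _"] tensor_cong.refl)
  then show "tensor_cong S M N x y" using e by (metis tensor_cong.sym tensor_cong.trans)
next
  assume "tensor_cong S M N x y"
  then have "tensor_cong S M N x = tensor_cong S M N y"
    by (intro ext) (metis tensor_cong.sym tensor_cong.trans)
  then show "tensor_class S M N x = tensor_class S M N y" by (simp add: tensor_class_def)
qed

lemma tensor_rep:
  assumes "u \<in> carrier (tensor S M N)"
  shows "tensor_rep S M N u \<in> formal M N" "tensor_class S M N (tensor_rep S M N u) = u"
proof -
  obtain x where "set_mset x \<subseteq> carrier M \<times> carrier N \<and> tensor_class S M N x = u"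
    using assms by (auto simp: tensor_def)
  then have "set_mset (tensor_rep S M N u) \<subseteq> carrier M \<times> carrier N \<and>
     tensor_class S M N (tensor_rep S M N u) = u"
    unfolding tensor_rep_def by (rule someI)
  then show "tensor_rep S M N u \<in> formal M N" "tensor_class S M N (tensor_rep S M N u) = u" by auto
qed

lemma tensor_class_closed: "x \<in> formal M N \<Longrightarrow> tensor_class S M N x \<in> carrier (tensor S M N)"
  by (auto simp: tensor_def)

lemma tensor_class_eqI:
  assumes "tensor_cong S M N x y"
  shows "tensor_class S M N x = tensor_class S M N y"
  by (rule iffD2[OF tensor_class_eq_iff[OF conjunct1 conjunct2] assms])
    (rule tensor_cong_formal[OF assms])+

lemma rep_class:
  assumes "x \<in> formal M N"
  shows "tensor_cong S M N (tensor_rep S M N (tensor_class S M N x)) x"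
  by (rule iffD1[OF tensor_class_eq_iff])
    (rule tensor_rep tensor_class_closed assms)+

lemma tensor_add: assumes "x \<in> formal M N" "y \<in> formal M N"
  shows "tensor_class S M N x \<oplus>\<^bsub>tensor S M N\<^esub> tensor_class S M N y = tensor_class S M N (x + y)"
proof -
  have "tensor_cong S M N (tensor_rep S M N (tensor_class S M N x) + tensor_rep S M N (tensor_class S M N y)) (x + y)"
    using assms by (intro tensor_cong.plus rep_class)
  then show ?thesis unfolding tensor_def by simp (rule tensor_class_eqI)
qed

abbreviation (input) "sm s \<equiv> image_mset (\<lambda>(m, n). (s \<odot>\<^bsub>M\<^esub> m, n))"

lemma sm_formal: "s \<in> carrier S \<Longrightarrow> x \<in> formal M N \<Longrightarrow> sm s x \<in> formal M N"
  by (auto simp: M.smult_closed)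

lemma sm_cong: assumes s: "s \<in> carrier S" and xy: "tensor_cong S M N x y"
  shows "tensor_cong S M N (sm s x) (sm s y)"
  using xy
proof (induction rule: tensor_cong.induct)
  case (refl x)
  then have "sm s x \<in> formal M N" by (intro sm_formal s CollectI)
  then show ?case by (intro tensor_cong.refl) simp
next
  case (sym x y) show ?case by (rule tensor_cong.sym) (rule sym.IH)
next
  case (trans x y z) show ?case by (rule tensor_cong.trans) (rule trans.IH)+
next
  case (plus x y x' y') then show ?case by (simp add: tensor_cong.plus)
next
  case (add_left m m' n)
  then show ?case using s by (simp add: M.smult_r_distr tensor_cong.add_left M.smult_closed)
next
  case (add_right m n n')
  then show ?case using s by (simp add: tensor_cong.add_right M.smult_closed)
next
  case (zero_left n)
  then show ?case using s by (simp add: M.smult_r_null tensor_cong.zero_left)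
next
  case (zero_right m)
  then show ?case using s by (simp add: M.smult_closed tensor_cong.zero_right)
next
  case (smult t m n)
  have "s \<odot>\<^bsub>M\<^esub> (t \<odot>\<^bsub>M\<^esub> m) = t \<odot>\<^bsub>M\<^esub> (s \<odot>\<^bsub>M\<^esub> m)"
    using s smult by (simp add: M.smult_assoc[symmetric] M.S.m_comm)
  then show ?case using s smult by (simp add: M.smult_closed tensor_cong.smult)
qed

lemma tensor_smult: assumes "s \<in> carrier S" "x \<in> formal M N"
  shows "s \<odot>\<^bsub>tensor S M N\<^esub> tensor_class S M N x = tensor_class S M N (sm s x)"
proof -
  have "tensor_cong S M N (sm s (tensor_rep S M N (tensor_class S M N x))) (sm s x)"
    using assms by (intro sm_cong rep_class)
  then have "tensor_class S M N (sm s (tensor_rep S M N (tensor_class S M N x))) = tensor_class S M N (sm s x)"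
    by (rule tensor_class_eqI)
  then show ?thesis by (simp add: tensor_def)
qed

lemma tensor_carrierE: assumes "u \<in> carrier (tensor S M N)"
  obtains x where "x \<in> formal M N" "u = tensor_class S M N x"
  using tensor_rep[OF assms] by metis

lemma tensor_zero: "\<zero>\<^bsub>tensor S M N\<^esub> = tensor_class S M N {#}" by (simp add: tensor_def)

lemma sm_add: assumes "s \<in> carrier S" "t \<in> carrier S"
  shows "x \<in> formal M N \<Longrightarrow> tensor_cong S M N (sm (s \<oplus>\<^bsub>S\<^esub> t) x) (sm s x + sm t x)"
proof (induction x)
  case empty show ?case by (simp add: tensor_cong.refl)
next
  case (add p x)
  obtain m n where p: "p = (m, n)" by fastforce
  have "tensor_cong S M N {#((s \<oplus>\<^bsub>S\<^esub> t) \<odot>\<^bsub>M\<^esub> m, n)#} {#(s \<odot>\<^bsub>M\<^esub> m, n), (t \<odot>\<^bsub>M\<^esub> m, n)#}"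
    using add assms p by (auto simp: M.smult_l_distr M.smult_closed intro!: tensor_cong.add_left)
  from tensor_cong.plus[OF this add.IH] show ?case using p add.prems by (simp add: add_mset_commute)
qed

lemma sm_zero: "x \<in> formal M N \<Longrightarrow> tensor_cong S M N (sm \<zero>\<^bsub>S\<^esub> x) {#}"
proof (induction x)
  case empty show ?case by (simp add: tensor_cong.refl)
next
  case (add p x)
  obtain m n where p: "p = (m, n)" by fastforce
  have "tensor_cong S M N {#(\<zero>\<^bsub>S\<^esub> \<odot>\<^bsub>M\<^esub> m, n)#} {#}"
    using add p by (auto simp: M.smult_l_null intro!: tensor_cong.zero_left)
  from tensor_cong.plus[OF this add.IH] show ?case using p add.prems by simp
qed

lemma semimodule_tensor: "semimodule S (tensor S M N)"
proof -
  let ?T = "tensor S M N"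
  note [elim!] = tensor_carrierE
  have am: "abelian_monoid ?T"
  proof (rule abelian_monoidI)
    show "\<zero>\<^bsub>?T\<^esub> \<in> carrier ?T" by (simp add: tensor_zero tensor_class_closed)
  next
    fix x y assume "x \<in> carrier ?T" "y \<in> carrier ?T"
    then obtain v w where y: "v \<in> formal M N" "x = tensor_class S M N v"
      "w \<in> formal M N" "y = tensor_class S M N w" by auto
    then have "v + w \<in> formal M N" by auto
    then show "x \<oplus>\<^bsub>?T\<^esub> y \<in> carrier ?T"
      using y by (simp only: tensor_add tensor_class_closed)
  next
    fix x y z assume "x \<in> carrier ?T" "y \<in> carrier ?T" "z \<in> carrier ?T"
    then show "x \<oplus>\<^bsub>?T\<^esub> y \<oplus>\<^bsub>?T\<^esub> z = x \<oplus>\<^bsub>?T\<^esub> (y \<oplus>\<^bsub>?T\<^esub> z)"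
      by (auto simp: tensor_add ac_simps)
  next
    fix x assume "x \<in> carrier ?T"
    then show "\<zero>\<^bsub>?T\<^esub> \<oplus>\<^bsub>?T\<^esub> x = x" by (auto simp: tensor_add tensor_zero)
  next
    fix x y assume "x \<in> carrier ?T" "y \<in> carrier ?T"
    then show "x \<oplus>\<^bsub>?T\<^esub> y = y \<oplus>\<^bsub>?T\<^esub> x" by (auto simp: tensor_add ac_simps)
  qed
  have eq: "tensor_class S M N x = tensor_class S M N y" if "tensor_cong S M N x y" for x y
    using that by (rule tensor_class_eqI)
  show ?thesis
  proof (intro semimodule.intro am semimodule_axioms.intro)
    show "comm_semiring S" ..
  next
    fix s x assume "s \<in> carrier S" "x \<in> carrier ?T"
    then obtain y where y: "s \<in> carrier S" "y \<in> formal M N" "x = tensor_class S M N y" by auto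
    then show "s \<odot>\<^bsub>?T\<^esub> x \<in> carrier ?T"
      using sm_formal by (simp only: tensor_smult tensor_class_closed)
  next
    fix s t x assume a: "s \<in> carrier S" "t \<in> carrier S" "x \<in> carrier ?T"
    then obtain y where y: "y \<in> formal M N" "x = tensor_class S M N y" by auto
    have "(s \<oplus>\<^bsub>S\<^esub> t) \<odot>\<^bsub>?T\<^esub> x = tensor_class S M N (sm (s \<oplus>\<^bsub>S\<^esub> t) y)"
      using a y by (simp only: tensor_smult M.S.a_closed)
    also have "\<dots> = tensor_class S M N (sm s y + sm t y)" using a y by (intro eq sm_add)
    also have "\<dots> = s \<odot>\<^bsub>?T\<^esub> x \<oplus>\<^bsub>?T\<^esub> t \<odot>\<^bsub>?T\<^esub> x"
      using a y sm_formal by (simp only: tensor_smult tensor_add)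
    finally show "(s \<oplus>\<^bsub>S\<^esub> t) \<odot>\<^bsub>?T\<^esub> x = s \<odot>\<^bsub>?T\<^esub> x \<oplus>\<^bsub>?T\<^esub> t \<odot>\<^bsub>?T\<^esub> x" .
    have "sm (s \<otimes>\<^bsub>S\<^esub> t) y = sm s (sm t y)" using a y
      by (auto simp: multiset.map_comp M.smult_assoc intro!: image_mset_cong)
    then show "(s \<otimes>\<^bsub>S\<^esub> t) \<odot>\<^bsub>?T\<^esub> x = s \<odot>\<^bsub>?T\<^esub> (t \<odot>\<^bsub>?T\<^esub> x)"
      using a y sm_formal by (simp only: tensor_smult M.S.m_closed)
  next
    fix s x y assume a: "s \<in> carrier S" "x \<in> carrier ?T" "y \<in> carrier ?T"
    then obtain v w where y: "v \<in> formal M N" "x = tensor_class S M N v" "w \<in> formal M N" "y = tensor_class S M N w" by auto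
    have "v + w \<in> formal M N" using y by auto
    then show "s \<odot>\<^bsub>?T\<^esub> (x \<oplus>\<^bsub>?T\<^esub> y) = s \<odot>\<^bsub>?T\<^esub> x \<oplus>\<^bsub>?T\<^esub> s \<odot>\<^bsub>?T\<^esub> y"
      using a y sm_formal by (simp only: tensor_smult tensor_add) simp
  next
    fix x assume "x \<in> carrier ?T" then obtain y where y: "y \<in> formal M N" "x = tensor_class S M N y" by auto
    have "sm \<one>\<^bsub>S\<^esub> y = image_mset (\<lambda>x. x) y" using y by (intro image_mset_cong) (auto simp: M.smult_one)
    then show "\<one>\<^bsub>S\<^esub> \<odot>\<^bsub>?T\<^esub> x = x" using y by (simp only: tensor_smult M.S.one_closed) simp
    show "\<zero>\<^bsub>S\<^esub> \<odot>\<^bsub>?T\<^esub> x = \<zero>\<^bsub>?T\<^esub>" using y by (simp only: tensor_smult M.S.zero_closed tensor_zero) (intro eq sm_zero)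
  next
    fix s assume "s \<in> carrier S" then show "s \<odot>\<^bsub>?T\<^esub> \<zero>\<^bsub>?T\<^esub> = \<zero>\<^bsub>?T\<^esub>" by (simp add: tensor_smult tensor_zero)
  qed
qed

definition "bilinear_ext P \<phi> x = finsum P (\<lambda>p. add_pow P (count x p) (\<phi> (fst p) (snd p))) (set_mset x)"
  for P :: "'u smod"

theorem tensor_universal:
  assumes P: "semimodule S P" and cl: "\<And>m n. m \<in> carrier M \<Longrightarrow> n \<in> carrier N \<Longrightarrow> \<phi> m n \<in> carrier P"
    and al: "\<And>m m' n. m \<in> carrier M \<Longrightarrow> m' \<in> carrier M \<Longrightarrow> n \<in> carrier N \<Longrightarrow> \<phi> (m \<oplus>\<^bsub>M\<^esub> m') n = \<phi> m n \<oplus>\<^bsub>P\<^esub> \<phi> m' n"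
    and ar: "\<And>m n n'. m \<in> carrier M \<Longrightarrow> n \<in> carrier N \<Longrightarrow> n' \<in> carrier N \<Longrightarrow> \<phi> m (n \<oplus>\<^bsub>N\<^esub> n') = \<phi> m n \<oplus>\<^bsub>P\<^esub> \<phi> m n'"
    and sl: "\<And>s m n. s \<in> carrier S \<Longrightarrow> m \<in> carrier M \<Longrightarrow> n \<in> carrier N \<Longrightarrow> \<phi> (s \<odot>\<^bsub>M\<^esub> m) n = s \<odot>\<^bsub>P\<^esub> \<phi> m n"
    and sr: "\<And>s m n. s \<in> carrier S \<Longrightarrow> m \<in> carrier M \<Longrightarrow> n \<in> carrier N \<Longrightarrow> \<phi> m (s \<odot>\<^bsub>N\<^esub> n) = s \<odot>\<^bsub>P\<^esub> \<phi> m n"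
  shows "\<exists>!f. f \<in> Hom (SMod S) (tensor S M N) P \<and>
     (\<forall>m \<in> carrier M. \<forall>n \<in> carrier N. app f (pure S M N m n) = \<phi> m n)"
proof -
  interpret P: semimodule S P by (rule P)
  interpret T: semimodule S "tensor S M N" by (rule semimodule_tensor)
  let ?T = "tensor S M N"
  let ?e = "bilinear_ext P \<phi>"
  have cl': "(\<lambda>p. add_pow P (k p) (\<phi> (fst p) (snd p))) \<in> A \<rightarrow> carrier P" if "A \<subseteq> carrier M \<times> carrier N" for A and k :: "_ \<Rightarrow> nat"
    using that cl by (auto intro!: P.add.nat_pow_closed)
  have ext_on: "?e x = finsum P (\<lambda>p. add_pow P (count x p) (\<phi> (fst p) (snd p))) A"
    if "finite A" "set_mset x \<subseteq> A" "A \<subseteq> carrier M \<times> carrier N" for x A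
    unfolding bilinear_ext_def using that
    by (intro P.add.finprod_mono_neutral_cong_left cl') (auto simp: not_in_iff)
  have e_cl: "?e x \<in> carrier P" if "x \<in> formal M N" for x
    unfolding bilinear_ext_def using that by (intro P.finsum_closed cl') auto
  have e_plus: "?e (x + y) = ?e x \<oplus>\<^bsub>P\<^esub> ?e y" if "x \<in> formal M N" "y \<in> formal M N" for x y
  proof -
    let ?A = "set_mset x \<union> set_mset y"
    have A: "?A \<subseteq> carrier M \<times> carrier N" using that by auto
    have "?e (x + y) = finsum P (\<lambda>p. add_pow P (count x p) (\<phi> (fst p) (snd p)) \<oplus>\<^bsub>P\<^esub> add_pow P (count y p) (\<phi> (fst p) (snd p))) ?A"
      using A cl by (subst ext_on[of ?A]) (auto intro!: P.finsum_cong' P.add.nat_pow_closed simp: P.add.nat_pow_mult)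
    also have "\<dots> = ?e x \<oplus>\<^bsub>P\<^esub> ?e y"
      using A by (subst (1 2) ext_on[of ?A]) (auto intro!: P.finsum_addf cl')
    finally show ?thesis .
  qed
  have e_empty: "?e {#} = \<zero>\<^bsub>P\<^esub>" by (simp add: bilinear_ext_def)
  have e_sing: "?e {#(m, n)#} = \<phi> m n" if "m \<in> carrier M" "n \<in> carrier N" for m n
    using cl[OF that] by (simp add: bilinear_ext_def)
  have e_two: "?e {#(m, n), (m', n')#} = \<phi> m n \<oplus>\<^bsub>P\<^esub> \<phi> m' n'" if "m \<in> carrier M" "n \<in> carrier N" "m' \<in> carrier M" "n' \<in> carrier N" for m n m' n'
  proof -
    have "{#(m, n), (m', n')#} = {#(m, n)#} + {#(m', n')#}" by simp
    then have "?e {#(m, n), (m', n')#} = ?e {#(m, n)#} \<oplus>\<^bsub>P\<^esub> ?e {#(m', n')#}"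
      using that by (simp only:) (intro e_plus; simp)
    then show ?thesis using that by (simp only: e_sing)
  qed
  have z: "\<phi> \<zero>\<^bsub>M\<^esub> n = \<zero>\<^bsub>P\<^esub>" if "n \<in> carrier N" for n
    using sl[of "\<zero>\<^bsub>S\<^esub>" "\<zero>\<^bsub>M\<^esub>" n] that cl by (simp add: M.smult_r_null P.smult_l_null)
  have z': "\<phi> m \<zero>\<^bsub>N\<^esub> = \<zero>\<^bsub>P\<^esub>" if "m \<in> carrier M" for m
    using sr[of "\<zero>\<^bsub>S\<^esub>" m "\<zero>\<^bsub>N\<^esub>"] that cl by (simp add: N.smult_r_null P.smult_l_null)
  have e_cong: "?e x = ?e y" if "tensor_cong S M N x y" for x y
    using that
  proof (induction rule: tensor_cong.induct)
    case (plus x y x' y') then show ?case using tensor_cong_formal by (metis e_plus)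
  qed (auto simp: e_sing e_two e_empty al ar sl sr z z' M.smult_closed N.smult_closed)
  have e_smult: "?e (sm s x) = s \<odot>\<^bsub>P\<^esub> ?e x" if s: "s \<in> carrier S" and x: "x \<in> formal M N" for s x
    using x
  proof (induction x)
    case empty then show ?case using s by (simp add: e_empty P.smult_r_null)
  next
    case (add p x)
    obtain m n where p: "p = (m, n)" by fastforce
    have mn: "m \<in> carrier M" "n \<in> carrier N" "x \<in> formal M N" using add.prems p by auto
    have "?e (sm s (add_mset p x)) = ?e ({#(s \<odot>\<^bsub>M\<^esub> m, n)#} + sm s x)" by (simp add: p)
    also have "\<dots> = ?e {#(s \<odot>\<^bsub>M\<^esub> m, n)#} \<oplus>\<^bsub>P\<^esub> ?e (sm s x)" using mn s sm_formal by (intro e_plus) (auto simp: M.smult_closed)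
    also have "\<dots> = s \<odot>\<^bsub>P\<^esub> (\<phi> m n \<oplus>\<^bsub>P\<^esub> ?e x)" using add.IH mn s by (simp add: e_sing M.smult_closed sl P.smult_r_distr cl e_cl)
    also have "\<phi> m n \<oplus>\<^bsub>P\<^esub> ?e x = ?e (add_mset p x)" using e_plus[of "{#(m,n)#}" x] mn by (simp add: e_sing p)
    finally show ?case .
  qed
  define g where "g = (\<lambda>u \<in> carrier ?T. ?e (tensor_rep S M N u))"
  have g: "g (tensor_class S M N x) = ?e x" if "x \<in> formal M N" for x
    using that e_cong[OF rep_class] by (simp add: g_def tensor_class_closed)
  let ?f = "(?T, g, P)"
  have f: "?f \<in> Hom (SMod S) ?T P"
  proof -
    have "g \<in> carrier ?T \<rightarrow>\<^sub>E carrier P" using tensor_rep e_cl by (auto simp: g_def)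
    moreover have "g (x \<oplus>\<^bsub>?T\<^esub> y) = g x \<oplus>\<^bsub>P\<^esub> g y" if x: "x \<in> carrier ?T" and y': "y \<in> carrier ?T" for x y
    proof -
      obtain v w where y: "v \<in> formal M N" "x = tensor_class S M N v" "w \<in> formal M N" "y = tensor_class S M N w"
        by (rule tensor_carrierE[OF x], rule tensor_carrierE[OF y'], rule that)
      then have "v + w \<in> formal M N" by auto
      then show ?thesis using y by (simp only: tensor_add g e_plus)
    qed
    moreover have "g (s \<odot>\<^bsub>?T\<^esub> x) = s \<odot>\<^bsub>P\<^esub> g x" if s: "s \<in> carrier S" and x: "x \<in> carrier ?T" for s x
    proof -
      obtain v where y: "v \<in> formal M N" "x = tensor_class S M N v"
        by (rule tensor_carrierE[OF x])
      then show ?thesis using s sm_formal[OF s y(1)] by (simp only: tensor_smult g e_smult)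
    qed
    ultimately show ?thesis by (simp add: Hom_def SMod_def semimodule_tensor P)
  qed
  show ?thesis
  proof (rule ex1I[of _ ?f], intro conjI f ballI)
    fix m n assume "m \<in> carrier M" "n \<in> carrier N"
    then show "app ?f (pure S M N m n) = \<phi> m n" by (simp add: app_def pure_def g e_sing)
  next
    fix h assume h: "h \<in> Hom (SMod S) ?T P \<and> (\<forall>m\<in>carrier M. \<forall>n\<in>carrier N. app h (pure S M N m n) = \<phi> m n)"
    obtain k where k: "h = (?T, k, P)" using h by (auto simp: Hom_def SMod_def)
    have kx: "k \<in> carrier ?T \<rightarrow>\<^sub>E carrier P" and
      ka: "\<And>x y. x \<in> carrier ?T \<Longrightarrow> y \<in> carrier ?T \<Longrightarrow> k (x \<oplus>\<^bsub>?T\<^esub> y) = k x \<oplus>\<^bsub>P\<^esub> k y" and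
      ks: "\<And>s x. s \<in> carrier S \<Longrightarrow> x \<in> carrier ?T \<Longrightarrow> k (s \<odot>\<^bsub>?T\<^esub> x) = s \<odot>\<^bsub>P\<^esub> k x"
      using h k by (auto simp: Hom_def SMod_def)
    have kp: "k (pure S M N m n) = \<phi> m n" if "m \<in> carrier M" "n \<in> carrier N" for m n
      using h k that by (simp add: app_def)
    have k_class: "k (tensor_class S M N x) = ?e x" if "x \<in> formal M N" for x
      using that
    proof (induction x)
      case empty
      have z0: "\<zero>\<^bsub>S\<^esub> \<odot>\<^bsub>?T\<^esub> \<zero>\<^bsub>?T\<^esub> = \<zero>\<^bsub>?T\<^esub>" by (rule T.smult_l_null) simp
      have "k \<zero>\<^bsub>?T\<^esub> \<in> carrier P" by (rule PiE_mem[OF kx T.M.zero_closed])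
      then have "k \<zero>\<^bsub>?T\<^esub> = \<zero>\<^bsub>P\<^esub>"
        using ks[of "\<zero>\<^bsub>S\<^esub>" "\<zero>\<^bsub>?T\<^esub>"] z0 by (simp add: P.smult_l_null)
      then show ?case by (simp add: tensor_zero e_empty)
    next
      case (add p x)
      obtain m n where p: "p = (m, n)" by fastforce
      have mn: "m \<in> carrier M" "n \<in> carrier N" "x \<in> formal M N" using add.prems p by auto
      have 1: "{#(m,n)#} \<in> formal M N" using mn by auto
      have "tensor_class S M N (add_mset p x) = pure S M N m n \<oplus>\<^bsub>?T\<^esub> tensor_class S M N x"
        unfolding pure_def using tensor_add[OF 1 mn(3)] by (simp add: p)
      then have "k (tensor_class S M N (add_mset p x)) = \<phi> m n \<oplus>\<^bsub>P\<^esub> ?e x"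
        using ka tensor_class_closed[OF 1] tensor_class_closed[OF mn(3)] kp mn add.IH by (simp add: pure_def)
      then show ?case using e_plus[OF 1 mn(3)] mn by (simp add: e_sing p)
    qed
    have "k u = g u" if "u \<in> carrier ?T" for u
      by (rule tensor_carrierE[OF that]) (simp only: g k_class)
    then have "k = g" using kx by (intro extensionalityI[of _ "carrier ?T"]) (auto simp: PiE_def g_def)
    then show "h = ?f" by (simp add: k)
  qed
qed

end

definition scalars :: "'u ring \<Rightarrow> 'u smod" where
  "scalars S = \<lparr>carrier = carrier S, monoid.mult = monoid.mult S, one = one S, zero = zero S, add = add S,
     smult = monoid.mult S\<rparr>"

definition the_lin :: "'u ring \<Rightarrow> 'u smod \<Rightarrow> 'u smod \<Rightarrow> (('u \<Rightarrow> 'u) \<Rightarrow> bool) \<Rightarrow> 'u slin" where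
  "the_lin S M N P = (THE f. f \<in> Hom (SMod S) M N \<and> P (app f))"

definition tensor_lin :: "'u ring \<Rightarrow> 'u slin \<Rightarrow> 'u slin \<Rightarrow> 'u slin" where
  "tensor_lin S f g =
    (let M = Dom (SMod S) f; M' = Cod (SMod S) f; N = Dom (SMod S) g; N' = Cod (SMod S) g
     in the_lin S (tensor S M N) (tensor S M' N') (\<lambda>h.
          \<forall>m \<in> carrier M. \<forall>n \<in> carrier N. h (pure S M N m n) = pure S M' N' (app f m) (app g n)))"

definition SModT :: "'u ring \<Rightarrow> ('u smod, 'u slin) smcat" where
  "SModT S = cat.extend (SMod S)
    \<lparr>TOb = tensor S,
     TAr = tensor_lin S,
     TUnit = scalars S,
     Assoc = (\<lambda>M N P.
       the_lin S (tensor S (tensor S M N) P) (tensor S M (tensor S N P)) (\<lambda>h.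
         \<forall>m \<in> carrier M. \<forall>n \<in> carrier N. \<forall>p \<in> carrier P.
           h (pure S (tensor S M N) P (pure S M N m n) p) =
           pure S M (tensor S N P) m (pure S N P n p))),
     LUnit = (\<lambda>M. the_lin S (tensor S (scalars S) M) M (\<lambda>h.
       \<forall>s \<in> carrier S. \<forall>m \<in> carrier M. h (pure S (scalars S) M s m) = s \<odot>\<^bsub>M\<^esub> m)),
     RUnit = (\<lambda>M. the_lin S (tensor S M (scalars S)) M (\<lambda>h.
       \<forall>m \<in> carrier M. \<forall>s \<in> carrier S. h (pure S M (scalars S) m s) = s \<odot>\<^bsub>M\<^esub> m)),
     Twist = (\<lambda>M N. the_lin S (tensor S M N) (tensor S N M) (\<lambda>h.
       \<forall>m \<in> carrier M. \<forall>n \<in> carrier N. h (pure S M N m n) = pure S N M n m))\<rparr>"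


section \<open>Bisemialgebras\<close>

abbreviation semialgebra :: "'u ring \<Rightarrow> 'u smod \<Rightarrow> 'u slin \<Rightarrow> 'u slin \<Rightarrow> bool" where
  "semialgebra S \<equiv> is_monoid (SModT S)"

abbreviation semicoalgebra :: "'u ring \<Rightarrow> 'u smod \<Rightarrow> 'u slin \<Rightarrow> 'u slin \<Rightarrow> bool" where
  "semicoalgebra S \<equiv> is_comonoid (SModT S)"

definition semialgebra_morphism ::
  "'u ring \<Rightarrow> 'u smod \<Rightarrow> 'u slin \<Rightarrow> 'u slin \<Rightarrow> 'u smod \<Rightarrow> 'u slin \<Rightarrow> 'u slin \<Rightarrow> 'u slin \<Rightarrow> bool" where
  "semialgebra_morphism S A \<mu> \<eta> A' \<mu>' \<eta>' f \<longleftrightarrow>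
     f \<in> Hom (SMod S) A A' \<and>
     (\<forall>a \<in> carrier A. \<forall>b \<in> carrier A.
        app f (app \<mu> (pure S A A a b)) = app \<mu>' (pure S A' A' (app f a) (app f b))) \<and>
     app f (app \<eta> \<one>\<^bsub>S\<^esub>) = app \<eta>' \<one>\<^bsub>S\<^esub>"

definition semicoalgebra_morphism ::
  "'u ring \<Rightarrow> 'u smod \<Rightarrow> 'u slin \<Rightarrow> 'u slin \<Rightarrow> 'u smod \<Rightarrow> 'u slin \<Rightarrow> 'u slin \<Rightarrow> 'u slin \<Rightarrow> bool" where
  "semicoalgebra_morphism S A \<Delta> \<epsilon> A' \<Delta>' \<epsilon>' f \<longleftrightarrow>
     f \<in> Hom (SMod S) A A' \<and>
     (\<forall>a \<in> carrier A. app \<Delta>' (app f a) = app (tensor_lin S f f) (app \<Delta> a)) \<and>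
     (\<forall>a \<in> carrier A. app \<epsilon>' (app f a) = app \<epsilon> a)"

text \<open>The semialgebra structure \<open>(a \<otimes> b)(c \<otimes> d) = ac \<otimes> bd\<close>, \<open>1 = 1 \<otimes> 1\<close> on \<open>B \<otimes> B\<close>, and the
  canonical one on \<open>S\<close>.\<close>

definition square_mult :: "'u ring \<Rightarrow> 'u smod \<Rightarrow> 'u slin \<Rightarrow> 'u slin" where
  "square_mult S B \<mu> =
     the_lin S (tensor S (tensor S B B) (tensor S B B)) (tensor S B B) (\<lambda>h.
       \<forall>a \<in> carrier B. \<forall>b \<in> carrier B. \<forall>c \<in> carrier B. \<forall>d \<in> carrier B.
         h (pure S (tensor S B B) (tensor S B B) (pure S B B a b) (pure S B B c d)) =
         pure S B B (app \<mu> (pure S B B a c)) (app \<mu> (pure S B B b d)))"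

definition square_unit :: "'u ring \<Rightarrow> 'u smod \<Rightarrow> 'u slin \<Rightarrow> 'u slin" where
  "square_unit S B \<eta> = the_lin S (scalars S) (tensor S B B) (\<lambda>h.
     h \<one>\<^bsub>S\<^esub> = pure S B B (app \<eta> \<one>\<^bsub>S\<^esub>) (app \<eta> \<one>\<^bsub>S\<^esub>))"

definition scalars_mult :: "'u ring \<Rightarrow> 'u slin" where
  "scalars_mult S = the_lin S (tensor S (scalars S) (scalars S)) (scalars S) (\<lambda>h.
     \<forall>s \<in> carrier S. \<forall>t \<in> carrier S. h (pure S (scalars S) (scalars S) s t) = s \<otimes>\<^bsub>S\<^esub> t)"

fun bisemialgebra :: "'u ring \<Rightarrow> ('u smod, 'u slin) bimon \<Rightarrow> bool" where
  "bisemialgebra S (B, \<mu>, \<eta>, \<Delta>, \<epsilon>) \<longleftrightarrow>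
     semialgebra S B \<mu> \<eta> \<and> semicoalgebra S B \<Delta> \<epsilon> \<and>
     semialgebra_morphism S B \<mu> \<eta> (tensor S B B) (square_mult S B \<mu>) (square_unit S B \<eta>) \<Delta> \<and>
     semialgebra_morphism S B \<mu> \<eta> (scalars S) (scalars_mult S) (Id (SMod S) (scalars S)) \<epsilon>"

definition SBialg ::
  "'u ring \<Rightarrow> (('u smod, 'u slin) bimon,
     ('u smod, 'u slin) bimon \<times> 'u slin \<times> ('u smod, 'u slin) bimon) cat" where
  "SBialg S = structured_cat (SMod S) {B. bisemialgebra S B} fst
     (\<lambda>(B, \<mu>, \<eta>, \<Delta>, \<epsilon>) (B', \<mu>', \<eta>', \<Delta>', \<epsilon>') f.
        semialgebra_morphism S B \<mu> \<eta> B' \<mu>' \<eta>' f \<and> semicoalgebra_morphism S B \<Delta> \<epsilon> B' \<Delta>' \<epsilon>' f)"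

definition bisemialgebra_structures ::
  "'u ring \<Rightarrow> 'u smod \<Rightarrow> ('u slin \<times> 'u slin \<times> 'u slin \<times> 'u slin) set" where
  "bisemialgebra_structures S B = {(\<mu>, \<eta>, \<Delta>, \<epsilon>). bisemialgebra S (B, \<mu>, \<eta>, \<Delta>, \<epsilon>)}"


section \<open>Semimodules, semicomodules and Hopf semimodules\<close>

type_synonym 'u struct = "'u smod \<times> 'u slin"

text \<open>A right action of \<open>B\<close> on \<open>M\<close> is given as the linear map \<open>r: M \<otimes> B \<rightarrow> M\<close> that represents it,
  so that \<open>mb\<close> is \<open>r (m \<otimes> b)\<close>.\<close>

definition right_semimodules ::
  "'u ring \<Rightarrow> 'u smod \<Rightarrow> 'u slin \<Rightarrow> 'u slin \<Rightarrow> ('u struct, 'u struct \<times> 'u slin \<times> 'u struct) cat" where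
  "right_semimodules S B \<mu> \<eta> = structured_cat (SMod S)
     {(M, r). M \<in> Ob (SMod S) \<and> r \<in> Hom (SMod S) (tensor S M B) M \<and>
        (\<forall>m \<in> carrier M. \<forall>b \<in> carrier B. \<forall>c \<in> carrier B.
           app r (pure S M B (app r (pure S M B m b)) c) =
           app r (pure S M B m (app \<mu> (pure S B B b c)))) \<and>
        (\<forall>m \<in> carrier M. app r (pure S M B m (app \<eta> \<one>\<^bsub>S\<^esub>)) = m)}
     fst
     (\<lambda>(M, r) (N, r') f. \<forall>m \<in> carrier M. \<forall>b \<in> carrier B.
        app f (app r (pure S M B m b)) = app r' (pure S N B (app f m) b))"

definition right_semicomodules ::
  "'u ring \<Rightarrow> 'u smod \<Rightarrow> 'u slin \<Rightarrow> 'u slin \<Rightarrow> ('u struct, 'u struct \<times> 'u slin \<times> 'u struct) cat" where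
  "right_semicomodules S B \<Delta> \<epsilon> = structured_cat (SMod S)
     {(M, \<rho>). M \<in> Ob (SMod S) \<and> \<rho> \<in> Hom (SMod S) M (tensor S M B) \<and>
        (\<forall>m \<in> carrier M.
           app (Assoc (SModT S) M B B) (app (tensor_lin S \<rho> (Id (SMod S) B)) (app \<rho> m)) =
           app (tensor_lin S (Id (SMod S) M) \<Delta>) (app \<rho> m)) \<and>
        (\<forall>m \<in> carrier M.
           app (RUnit (SModT S) M) (app (tensor_lin S (Id (SMod S) M) \<epsilon>) (app \<rho> m)) = m)}
     fst
     (\<lambda>(M, \<rho>) (N, \<rho>') f. \<forall>m \<in> carrier M.
        app \<rho>' (app f m) = app (tensor_lin S f (Id (SMod S) B)) (app \<rho> m))"

text \<open>Writing \<open>\<rho>(m) = \<Sum> m\<^sub>0 \<otimes> m\<^sub>1\<close>, the map below sends \<open>(m \<otimes> b) \<otimes> (c \<otimes> d)\<close> to \<open>mc \<otimes> bd\<close>; applied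
  to \<open>\<rho>(m) \<otimes> \<Delta>(b)\<close> it gives \<open>\<Sum> m\<^sub>0b\<^sub>1 \<otimes> m\<^sub>1b\<^sub>2\<close>.\<close>

definition act_mult :: "'u ring \<Rightarrow> 'u smod \<Rightarrow> 'u slin \<Rightarrow> 'u smod \<Rightarrow> 'u slin \<Rightarrow> 'u slin" where
  "act_mult S B \<mu> M r =
     the_lin S (tensor S (tensor S M B) (tensor S B B)) (tensor S M B) (\<lambda>h.
       \<forall>m \<in> carrier M. \<forall>b \<in> carrier B. \<forall>c \<in> carrier B. \<forall>d \<in> carrier B.
         h (pure S (tensor S M B) (tensor S B B) (pure S M B m b) (pure S B B c d)) =
         pure S M B (app r (pure S M B m c)) (app \<mu> (pure S B B b d)))"

definition hopf_semimodules ::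
  "'u ring \<Rightarrow> ('u smod, 'u slin) bimon \<Rightarrow>
   ('u smod \<times> 'u slin \<times> 'u slin,
    ('u smod \<times> 'u slin \<times> 'u slin) \<times> 'u slin \<times> ('u smod \<times> 'u slin \<times> 'u slin)) cat" where
  "hopf_semimodules S = (\<lambda>(B, \<mu>, \<eta>, \<Delta>, \<epsilon>). structured_cat (SMod S)
     {(M, r, \<rho>). (M, r) \<in> Ob (right_semimodules S B \<mu> \<eta>) \<and>
        (M, \<rho>) \<in> Ob (right_semicomodules S B \<Delta> \<epsilon>) \<and>
        (\<forall>m \<in> carrier M. \<forall>b \<in> carrier B.
           app \<rho> (app r (pure S M B m b)) =
           app (act_mult S B \<mu> M r) (pure S (tensor S M B) (tensor S B B) (app \<rho> m) (app \<Delta> b)))}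
     fst
     (\<lambda>(M, r, \<rho>) (N, r', \<rho>') f.
        ((M, r), f, (N, r')) \<in> Ar (right_semimodules S B \<mu> \<eta>) \<and>
        ((M, \<rho>), f, (N, \<rho>')) \<in> Ar (right_semicomodules S B \<Delta> \<epsilon>)))"

text \<open>The comonad \<open>- \<otimes> B\<close> on right \<open>B\<close>-semimodules, with \<open>(n \<otimes> b)c = \<Sum> nc\<^sub>1 \<otimes> bc\<^sub>2\<close>. It is written
  for an arbitrary category of objects \<open>(N, r: N \<otimes> B \<rightarrow> N)\<close> and applied both to the category of right
  \<open>B\<close>-semimodules and to the Eilenberg-Moore category of the monad \<open>- \<otimes> B\<close>.\<close>

definition mod_fctr ::
  "'u ring \<Rightarrow> 'u smod \<Rightarrow> 'u slin \<Rightarrow> 'u slin \<Rightarrow>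
   ('u struct, 'u struct \<times> 'u slin \<times> 'u struct, 'u struct, 'u struct \<times> 'u slin \<times> 'u struct) fctr" where
  "mod_fctr S B \<mu> \<Delta> =
    (let F = (\<lambda>(N, r). (tensor S N B,
           the_lin S (tensor S (tensor S N B) B) (tensor S N B) (\<lambda>h.
             \<forall>z \<in> carrier (tensor S N B). \<forall>c \<in> carrier B.
               h (pure S (tensor S N B) B z c) =
               app (act_mult S B \<mu> N r) (pure S (tensor S N B) (tensor S B B) z (app \<Delta> c)))))
     in \<lparr>FOb = F,
         FAr = (\<lambda>(X, f, Y). (F X, tensor_lin S f (Id (SMod S) B), F Y))\<rparr>)"

definition mod_comult ::
  "'u ring \<Rightarrow> ('u struct, 'u struct \<times> 'u slin \<times> 'u struct) cat \<Rightarrow> 'u smod \<Rightarrow> 'u slin \<Rightarrow> 'u slin \<Rightarrow>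
   'u struct \<Rightarrow> 'u struct \<times> 'u slin \<times> 'u struct" where
  "mod_comult S A B \<mu> \<Delta> = (\<lambda>X \<in> Ob A.
     (FOb (mod_fctr S B \<mu> \<Delta>) X, right_comult (SModT S) B \<Delta> (fst X),
      FOb (mod_fctr S B \<mu> \<Delta>) (FOb (mod_fctr S B \<mu> \<Delta>) X)))"

definition mod_counit ::
  "'u ring \<Rightarrow> ('u struct, 'u struct \<times> 'u slin \<times> 'u struct) cat \<Rightarrow> 'u smod \<Rightarrow> 'u slin \<Rightarrow> 'u slin \<Rightarrow>
   'u slin \<Rightarrow> 'u struct \<Rightarrow> 'u struct \<times> 'u slin \<times> 'u struct" where
  "mod_counit S A B \<mu> \<Delta> \<epsilon> = (\<lambda>X \<in> Ob A.
     (FOb (mod_fctr S B \<mu> \<Delta>) X, right_counit (SModT S) \<epsilon> (fst X), X))"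

text \<open>The monad \<open>- \<otimes> B\<close> on right \<open>B\<close>-semicomodules, with coaction
  \<open>l \<otimes> b \<mapsto> \<Sum> l\<^sub>0 \<otimes> b\<^sub>1 \<otimes> l\<^sub>1b\<^sub>2\<close>; again for an arbitrary category of objects \<open>(L, \<rho>: L \<rightarrow> L \<otimes> B)\<close>.\<close>

definition coact_mult :: "'u ring \<Rightarrow> 'u smod \<Rightarrow> 'u slin \<Rightarrow> 'u smod \<Rightarrow> 'u slin" where
  "coact_mult S B \<mu> L =
     the_lin S (tensor S (tensor S L B) (tensor S B B)) (tensor S (tensor S L B) B) (\<lambda>h.
       \<forall>l \<in> carrier L. \<forall>a \<in> carrier B. \<forall>c \<in> carrier B. \<forall>d \<in> carrier B.
         h (pure S (tensor S L B) (tensor S B B) (pure S L B l a) (pure S B B c d)) =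
         pure S (tensor S L B) B (pure S L B l c) (app \<mu> (pure S B B a d)))"

definition comod_fctr ::
  "'u ring \<Rightarrow> 'u smod \<Rightarrow> 'u slin \<Rightarrow> 'u slin \<Rightarrow>
   ('u struct, 'u struct \<times> 'u slin \<times> 'u struct, 'u struct, 'u struct \<times> 'u slin \<times> 'u struct) fctr" where
  "comod_fctr S B \<mu> \<Delta> =
    (let F = (\<lambda>(L, \<rho>). (tensor S L B,
           the_lin S (tensor S L B) (tensor S (tensor S L B) B) (\<lambda>h.
             \<forall>l \<in> carrier L. \<forall>b \<in> carrier B.
               h (pure S L B l b) =
               app (coact_mult S B \<mu> L)
                 (pure S (tensor S L B) (tensor S B B) (app \<rho> l) (app \<Delta> b)))))
     in \<lparr>FOb = F,
         FAr = (\<lambda>(X, f, Y). (F X, tensor_lin S f (Id (SMod S) B), F Y))\<rparr>)"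

definition comod_mult ::
  "'u ring \<Rightarrow> ('u struct, 'u struct \<times> 'u slin \<times> 'u struct) cat \<Rightarrow> 'u smod \<Rightarrow> 'u slin \<Rightarrow> 'u slin \<Rightarrow>
   'u struct \<Rightarrow> 'u struct \<times> 'u slin \<times> 'u struct" where
  "comod_mult S A B \<mu> \<Delta> = (\<lambda>X \<in> Ob A.
     (FOb (comod_fctr S B \<mu> \<Delta>) (FOb (comod_fctr S B \<mu> \<Delta>) X), right_mult (SModT S) B \<mu> (fst X),
      FOb (comod_fctr S B \<mu> \<Delta>) X))"

definition comod_unit ::
  "'u ring \<Rightarrow> ('u struct, 'u struct \<times> 'u slin \<times> 'u struct) cat \<Rightarrow> 'u smod \<Rightarrow> 'u slin \<Rightarrow> 'u slin \<Rightarrow>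
   'u slin \<Rightarrow> 'u struct \<Rightarrow> 'u struct \<times> 'u slin \<times> 'u struct" where
  "comod_unit S A B \<mu> \<eta> \<Delta> = (\<lambda>X \<in> Ob A.
     (X, right_unit (SModT S) \<eta> (fst X), FOb (comod_fctr S B \<mu> \<Delta>) X))"

text \<open>\<open>(A)\<^sup>-\<^sup>\<otimes>\<^sup>B\<close> for a category \<open>A\<close> of modules and \<open>(A)\<^sub>-\<^sub>\<otimes>\<^sub>B\<close> for a category \<open>A\<close> of comodules.\<close>

definition comodules_over ::
  "'u ring \<Rightarrow> ('u struct, 'u struct \<times> 'u slin \<times> 'u struct) cat \<Rightarrow> ('u smod, 'u slin) bimon \<Rightarrow> _" where
  "comodules_over S A = (\<lambda>(B, \<mu>, \<eta>, \<Delta>, \<epsilon>).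
     EM_comodules A (mod_fctr S B \<mu> \<Delta>) (mod_comult S A B \<mu> \<Delta>) (mod_counit S A B \<mu> \<Delta> \<epsilon>))"

definition modules_over ::
  "'u ring \<Rightarrow> ('u struct, 'u struct \<times> 'u slin \<times> 'u struct) cat \<Rightarrow> ('u smod, 'u slin) bimon \<Rightarrow> _" where
  "modules_over S A = (\<lambda>(B, \<mu>, \<eta>, \<Delta>, \<epsilon>).
     EM_modules A (comod_fctr S B \<mu> \<Delta>) (comod_mult S A B \<mu> \<Delta>) (comod_unit S A B \<mu> \<eta> \<Delta>))"

end

theory Submission
  imports Defs
begin

text \<open>Linear maps out of a tensor product are determined by their values on pure elements, and all
  structural identities are checked on these; an element such as \<open>\<Delta>(b)\<close> that is not pure is first
  replaced by an arbitrary element of the tensor product, to which both sides of the identity are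
  additively extended.

  A transformation \<open>P \<otimes> - \<rightarrow> Q \<otimes> -\<close> is determined by its component at \<open>S\<close>, since every element of \<open>X\<close>
  is the image of \<open>1\<close> under a linear map \<open>S \<rightarrow> X\<close>. So the four transformations of a bimonad structure on
  \<open>B \<otimes> -\<close> come from unique linear maps \<open>\<mu>\<close>, \<open>\<eta>\<close>, \<open>\<Delta>\<close>, \<open>\<epsilon>\<close>, and evaluating at \<open>X = S\<close> turns each
  bimonad axiom into the corresponding bimonoid axiom. The functor \<open>- \<otimes> B\<close> is the functor \<open>B \<otimes> -\<close>
  for the reversed tensor product, for which \<open>B\<close> has the same bimonoid structures.

  For a bisemialgebra \<open>B\<close>, a coaction \<open>M \<rightarrow> M \<otimes> B\<close> is \<open>B\<close>-linear if and only if it satisfies the Hopf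
  compatibility condition, if and only if the action \<open>M \<otimes> B \<rightarrow> M\<close> is \<open>B\<close>-colinear. Semimodules and
  Eilenberg-Moore modules are literally the same category, and likewise for semicomodules.\<close>

section \<open>The category of semimodules\<close>

text \<open>Without subtraction an equation cannot be tested by showing that a difference vanishes.
  The access to a tensor product is that its elements are finite sums of pure ones, so an identity
  in an argument that is not pure becomes an induction with separate cases for zero, pure elements
  and sums. Zero is preserved thanks to the scalar 0; additivity alone would not give it.

  Evaluation at X = S is reversible because the right unitor recovers u from u \<otimes> 1. The maps
  of the definitions are definite descriptions; each is first identified with an explicit map known
  on pure elements.

  For Hopf semimodules the organising fact is that B \<otimes> B acts on N \<otimes> B by (n
  \<otimes> b)(c \<otimes> d) = nc \<otimes> bd. The action of B on N \<otimes> B is the restriction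
  of this one along \<Delta>, and is associative and unital because \<Delta> is a morphism of
  semialgebras. On the side of semicomodules the same property of \<Delta> gives coassociativity,
  and multiplicativity of \<epsilon> gives counitality.\<close>

locale semimod_cat = comm_semiring S for S :: "'u::infinite ring" (structure)
begin

abbreviation lin :: "'u slin \<Rightarrow> bool" where "lin f \<equiv> f \<in> Ar (SMod S)"
abbreviation src :: "'u slin \<Rightarrow> 'u smod" where "src \<equiv> Dom (SMod S)"
abbreviation tgt :: "'u slin \<Rightarrow> 'u smod" where "tgt \<equiv> Cod (SMod S)"
abbreviation idn :: "'u smod \<Rightarrow> 'u slin" where "idn \<equiv> Id (SMod S)"
abbreviation comp :: "'u slin \<Rightarrow> 'u slin \<Rightarrow> 'u slin"  (infixr \<open>\<Zspot>\<close> 55) where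
  "g \<Zspot> f \<equiv> g \<cdot>\<^bsub>SMod S\<^esub> f"
abbreviation sm :: "'u smod \<Rightarrow> bool" where "sm M \<equiv> semimodule S M"
abbreviation I :: "'u smod" where "I \<equiv> scalars S"

lemma Ob_SMod [simp]: "M \<in> Ob (SMod S) \<longleftrightarrow> sm M"
  by (simp add: SMod_def)

lemma Hom_SMod [simp]: "f \<in> Hom (SMod S) M N \<longleftrightarrow> lin f \<and> src f = M \<and> tgt f = N"
  by (simp add: Hom_def)

lemma arrow_collapse: "(src f, app f, tgt f) = f"
  by (simp add: SMod_def app_def split: prod.splits)

lemma arrow_apps [simp]: "src (M, h, N) = M" "tgt (M, h, N) = N" "app (M, h, N) = h"
  by (simp_all add: SMod_def app_def)

lemma lin_iff: "lin f \<longleftrightarrow> sm (src f) \<and> sm (tgt f) \<and> app f \<in> carrier (src f) \<rightarrow>\<^sub>E carrier (tgt f) \<and>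
    (\<forall>x \<in> carrier (src f). \<forall>y \<in> carrier (src f). app f (x \<oplus>\<^bsub>src f\<^esub> y) = app f x \<oplus>\<^bsub>tgt f\<^esub> app f y) \<and>
    (\<forall>s \<in> carrier S. \<forall>x \<in> carrier (src f). app f (s \<odot>\<^bsub>src f\<^esub> x) = s \<odot>\<^bsub>tgt f\<^esub> app f x)"
  by (simp add: SMod_def app_def split: prod.splits)

lemma lin_semimodule [simp]: "lin f \<Longrightarrow> sm (src f)" "lin f \<Longrightarrow> sm (tgt f)"
  unfolding lin_iff by blast+

lemma app_closed [simp]: "lin f \<Longrightarrow> tgt f = N \<Longrightarrow> x \<in> carrier (src f) \<Longrightarrow> app f x \<in> carrier N"
  unfolding lin_iff by blast

lemma app_add [simp]:
  "lin f \<Longrightarrow> src f = M \<Longrightarrow> x \<in> carrier M \<Longrightarrow> y \<in> carrier M \<Longrightarrow>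
   app f (x \<oplus>\<^bsub>M\<^esub> y) = app f x \<oplus>\<^bsub>tgt f\<^esub> app f y"
  unfolding lin_iff by blast

lemma app_smult [simp]:
  "lin f \<Longrightarrow> src f = M \<Longrightarrow> s \<in> carrier S \<Longrightarrow> x \<in> carrier M \<Longrightarrow>
   app f (s \<odot>\<^bsub>M\<^esub> x) = s \<odot>\<^bsub>tgt f\<^esub> app f x"
  unfolding lin_iff by blast

lemma sm_add_closed [simp]: "sm M \<Longrightarrow> x \<in> carrier M \<Longrightarrow> y \<in> carrier M \<Longrightarrow> x \<oplus>\<^bsub>M\<^esub> y \<in> carrier M"
  by (intro abelian_monoid.a_closed semimodule.axioms(2))

lemma sm_zero_closed [simp]: "sm M \<Longrightarrow> \<zero>\<^bsub>M\<^esub> \<in> carrier M"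
  by (intro abelian_monoid.zero_closed semimodule.axioms(2))

lemma sm_smult_closed [simp]: "sm M \<Longrightarrow> s \<in> carrier S \<Longrightarrow> x \<in> carrier M \<Longrightarrow> s \<odot>\<^bsub>M\<^esub> x \<in> carrier M"
  by (intro semimodule.smult_closed)

lemma sm_zero_add [simp]: "sm M \<Longrightarrow> x \<in> carrier M \<Longrightarrow> \<zero>\<^bsub>M\<^esub> \<oplus>\<^bsub>M\<^esub> x = x"
    "sm M \<Longrightarrow> x \<in> carrier M \<Longrightarrow> x \<oplus>\<^bsub>M\<^esub> \<zero>\<^bsub>M\<^esub> = x"
  by (simp_all add: abelian_monoid.l_zero abelian_monoid.r_zero semimodule.axioms(2))

lemma sm_assoc: "sm M \<Longrightarrow> x \<in> carrier M \<Longrightarrow> y \<in> carrier M \<Longrightarrow> z \<in> carrier M \<Longrightarrow>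
    x \<oplus>\<^bsub>M\<^esub> y \<oplus>\<^bsub>M\<^esub> z = x \<oplus>\<^bsub>M\<^esub> (y \<oplus>\<^bsub>M\<^esub> z)"
  by (intro abelian_monoid.a_assoc semimodule.axioms(2))

lemma sm_add_swap: "sm M \<Longrightarrow> x \<in> carrier M \<Longrightarrow> y \<in> carrier M \<Longrightarrow> z \<in> carrier M \<Longrightarrow>
    w \<in> carrier M \<Longrightarrow> (x \<oplus>\<^bsub>M\<^esub> y) \<oplus>\<^bsub>M\<^esub> (z \<oplus>\<^bsub>M\<^esub> w) = (x \<oplus>\<^bsub>M\<^esub> z) \<oplus>\<^bsub>M\<^esub> (y \<oplus>\<^bsub>M\<^esub> w)"
  by (metis abelian_monoid.a_lcomm semimodule.axioms(2) sm_add_closed sm_assoc)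

lemma sm_smult [simp]:
  "sm M \<Longrightarrow> x \<in> carrier M \<Longrightarrow> \<one> \<odot>\<^bsub>M\<^esub> x = x"
  "sm M \<Longrightarrow> x \<in> carrier M \<Longrightarrow> \<zero> \<odot>\<^bsub>M\<^esub> x = \<zero>\<^bsub>M\<^esub>"
  "sm M \<Longrightarrow> s \<in> carrier S \<Longrightarrow> s \<odot>\<^bsub>M\<^esub> \<zero>\<^bsub>M\<^esub> = \<zero>\<^bsub>M\<^esub>"
  "sm M \<Longrightarrow> s \<in> carrier S \<Longrightarrow> x \<in> carrier M \<Longrightarrow> y \<in> carrier M \<Longrightarrow>
    s \<odot>\<^bsub>M\<^esub> (x \<oplus>\<^bsub>M\<^esub> y) = s \<odot>\<^bsub>M\<^esub> x \<oplus>\<^bsub>M\<^esub> s \<odot>\<^bsub>M\<^esub> y"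
  by (simp_all add: semimodule.smult_one semimodule.smult_l_null semimodule.smult_r_null
      semimodule.smult_r_distr)

lemma sm_smult_smult: "sm M \<Longrightarrow> s \<in> carrier S \<Longrightarrow> t \<in> carrier S \<Longrightarrow> x \<in> carrier M \<Longrightarrow>
    s \<odot>\<^bsub>M\<^esub> (t \<odot>\<^bsub>M\<^esub> x) = (s \<otimes> t) \<odot>\<^bsub>M\<^esub> x"
  by (simp add: semimodule.smult_assoc)

lemma sm_smult_add: "sm M \<Longrightarrow> s \<in> carrier S \<Longrightarrow> t \<in> carrier S \<Longrightarrow> x \<in> carrier M \<Longrightarrow>
    (s \<oplus> t) \<odot>\<^bsub>M\<^esub> x = s \<odot>\<^bsub>M\<^esub> x \<oplus>\<^bsub>M\<^esub> t \<odot>\<^bsub>M\<^esub> x"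
  by (simp add: semimodule.smult_l_distr)

text \<open>Additivity does not force f(0) = 0 when there is no subtraction; the zero is written as
  0 times 0 and the scalar is pulled out.\<close>

lemma app_zero [simp]: "lin f \<Longrightarrow> src f = M \<Longrightarrow> app f \<zero>\<^bsub>M\<^esub> = \<zero>\<^bsub>tgt f\<^esub>"
proof -
  assume f: "lin f" "src f = M"
  then have "app f (\<zero> \<odot>\<^bsub>M\<^esub> \<zero>\<^bsub>M\<^esub>) = \<zero> \<odot>\<^bsub>tgt f\<^esub> app f \<zero>\<^bsub>M\<^esub>"
    by (intro app_smult) (auto simp del: sm_smult)
  with f show ?thesis by (metis app_closed lin_semimodule sm_smult(2) sm_zero_closed)
qed

text \<open>Arrows carry extensional functions, so two of them cannot differ off the carrier of
  their source.\<close>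

lemma arr_eqI:
  assumes "lin f" "lin g" "src f = src g" "tgt f = tgt g"
    and "\<And>x. x \<in> carrier (src g) \<Longrightarrow> app f x = app g x"
  shows "f = g"
proof -
  have e: "app h \<in> extensional (carrier (src h))" if "lin h" for h
    using that unfolding lin_iff by (simp add: PiE_def)
  have "app f = app g"
    using e[OF assms(1)] e[OF assms(2)] assms(3,5) by (intro extensionalityI[of _ "carrier (src g)"]) simp_all
  then show ?thesis using assms(3,4) by (metis arrow_collapse)
qed

lemma linI:
  assumes "sm M" "sm N" "\<And>x. x \<in> carrier M \<Longrightarrow> h x \<in> carrier N"
    and "\<And>x y. x \<in> carrier M \<Longrightarrow> y \<in> carrier M \<Longrightarrow> h (x \<oplus>\<^bsub>M\<^esub> y) = h x \<oplus>\<^bsub>N\<^esub> h y"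
    and "\<And>s x. s \<in> carrier S \<Longrightarrow> x \<in> carrier M \<Longrightarrow> h (s \<odot>\<^bsub>M\<^esub> x) = s \<odot>\<^bsub>N\<^esub> h x"
  shows "lin (M, restrict h (carrier M), N)"
  unfolding lin_iff using assms by auto

lemma Id_SMod [simp]: "src (idn M) = M" "tgt (idn M) = M" "sm M \<Longrightarrow> lin (idn M)"
    "x \<in> carrier M \<Longrightarrow> app (idn M) x = x"
  by (auto simp: SMod_def app_def)

lemma Comp_arrows [simp]: "src (g \<Zspot> f) = src f" "tgt (g \<Zspot> f) = tgt g"
  by (auto simp: SMod_def split: prod.splits)

lemma app_Comp [simp]: "x \<in> carrier (src f) \<Longrightarrow> app (g \<Zspot> f) x = app g (app f x)"
  by (auto simp: SMod_def app_def compose_def split: prod.splits)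

lemma lin_Comp [simp]:
  assumes "lin f" "lin g" "tgt f = src g"
  shows "lin (g \<Zspot> f)"
proof -
  have "app (g \<Zspot> f) \<in> extensional (carrier (src f))"
    by (auto simp: SMod_def app_def split: prod.splits)
  then show ?thesis unfolding lin_iff[of "g \<Zspot> f"] using assms by (auto simp: PiE_def)
qed

lemma Comp_Id [simp]:
  "lin f \<Longrightarrow> tgt f = M \<Longrightarrow> idn M \<Zspot> f = f" "lin f \<Longrightarrow> src f = M \<Longrightarrow> f \<Zspot> idn M = f"
  by (auto intro!: arr_eqI)

lemma Comp_assoc:
  "lin f \<Longrightarrow> lin g \<Longrightarrow> lin h \<Longrightarrow> tgt f = src g \<Longrightarrow> tgt g = src h \<Longrightarrow> (h \<Zspot> g) \<Zspot> f = h \<Zspot> g \<Zspot> f"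
  by (auto intro!: arr_eqI)

lemma category_SMod: "category (SMod S)"
  by unfold_locales (auto simp: Comp_assoc)

lemma inv_arr_eqI:
  assumes "lin f" "lin g" "src g = tgt f" "tgt g = src f"
    and "\<And>x. x \<in> carrier (src f) \<Longrightarrow> app g (app f x) = x"
    and "\<And>y. y \<in> carrier (src g) \<Longrightarrow> app f (app g y) = y"
  shows "inv_arr (SMod S) f = g"
  unfolding inv_arr_def
proof (rule the_equality)
  show "g \<in> Hom (SMod S) (tgt f) (src f) \<and> g \<Zspot> f = idn (src f) \<and> f \<Zspot> g = idn (tgt f)"
    using assms by (auto intro!: arr_eqI)
  fix h assume h: "h \<in> Hom (SMod S) (tgt f) (src f) \<and> h \<Zspot> f = idn (src f) \<and> f \<Zspot> h = idn (tgt f)"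
  have "app h y = app g y" if "y \<in> carrier (src g)" for y
  proof -
    \<comment> \<open>Since y = f(g(y)), a left inverse h must take the value g(y) at y.\<close>
    have "app (h \<Zspot> f) (app g y) = app g y" using h that assms by simp
    then show ?thesis using assms that by simp
  qed
  then show "h = g" using h assms by (intro arr_eqI) auto
qed

lemma the_lin_eqI:
  assumes "lin f" "src f = M" "tgt f = N" "P (app f)"
    and "\<And>g. lin g \<Longrightarrow> src g = M \<Longrightarrow> tgt g = N \<Longrightarrow> P (app g) \<Longrightarrow> g = f"
  shows "the_lin S M N P = f"
  unfolding the_lin_def Hom_SMod by (rule the_equality) (use assms in blast)+

lemma scalars_simps [simp]: "carrier I = carrier S" "\<zero>\<^bsub>I\<^esub> = \<zero>" "x \<oplus>\<^bsub>I\<^esub> y = x \<oplus> y" "s \<odot>\<^bsub>I\<^esub> x = s \<otimes> x"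
  by (simp_all add: scalars_def)

lemma sm_scalars [simp]: "sm I"
proof -
  have "abelian_monoid I"
    by (rule abelian_monoidI) (auto simp: a_assoc intro: a_comm)
  then show ?thesis
    by (intro semimodule.intro semimodule_axioms.intro comm_semiring_axioms)
      (auto simp: l_distr r_distr m_assoc)
qed

text \<open>S is generated by 1 as a semimodule over itself.\<close>

lemma arr_scalars_eqI:
  assumes "lin f" "lin g" "src f = I" "src g = I" "tgt f = tgt g" "app f \<one> = app g \<one>"
  shows "f = g"
proof (rule arr_eqI)
  fix x assume x: "x \<in> carrier (src g)"
  \<comment> \<open>The product x1 is kept in the form of a scalar action, so that linearity applies
    to it.\<close>
  have "app f (x \<odot>\<^bsub>I\<^esub> \<one>) = app g (x \<odot>\<^bsub>I\<^esub> \<one>)"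
    using x assms by (simp del: scalars_simps(4))
  then show "app f x = app g x" using x assms by simp
qed (use assms in auto)

section \<open>Tensor products of semimodules\<close>


abbreviation ten :: "'u smod \<Rightarrow> 'u smod \<Rightarrow> 'u smod" where "ten \<equiv> tensor S"

lemma sm_tensor [simp]: "sm M \<Longrightarrow> sm N \<Longrightarrow> sm (ten M N)"
  by (rule semimodule_tensor)

lemma pure_closed [simp]:
  "sm M \<Longrightarrow> sm N \<Longrightarrow> m \<in> carrier M \<Longrightarrow> n \<in> carrier N \<Longrightarrow> pure S M N m n \<in> carrier (ten M N)"
  unfolding pure_def by (rule tensor_class_closed) auto

lemma pure_add_left:
  assumes "sm M" "sm N" "m \<in> carrier M" "m' \<in> carrier M" "n \<in> carrier N"
  shows "pure S M N (m \<oplus>\<^bsub>M\<^esub> m') n = pure S M N m n \<oplus>\<^bsub>ten M N\<^esub> pure S M N m' n"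
proof -
  have "pure S M N (m \<oplus>\<^bsub>M\<^esub> m') n = tensor_class S M N {#(m, n), (m', n)#}"
    unfolding pure_def using assms by (intro tensor_class_eqI tensor_cong.add_left)
  also have "{#(m, n), (m', n)#} = {#(m, n)#} + {#(m', n)#}" by simp
  also have "tensor_class S M N \<dots> = pure S M N m n \<oplus>\<^bsub>ten M N\<^esub> pure S M N m' n"
    unfolding pure_def using assms by (intro tensor_add[symmetric]) auto
  finally show ?thesis .
qed

lemma pure_add_right:
  assumes "sm M" "sm N" "m \<in> carrier M" "n \<in> carrier N" "n' \<in> carrier N"
  shows "pure S M N m (n \<oplus>\<^bsub>N\<^esub> n') = pure S M N m n \<oplus>\<^bsub>ten M N\<^esub> pure S M N m n'"
proof -
  have "pure S M N m (n \<oplus>\<^bsub>N\<^esub> n') = tensor_class S M N {#(m, n), (m, n')#}"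
    unfolding pure_def using assms by (intro tensor_class_eqI tensor_cong.add_right)
  also have "{#(m, n), (m, n')#} = {#(m, n)#} + {#(m, n')#}" by simp
  also have "tensor_class S M N \<dots> = pure S M N m n \<oplus>\<^bsub>ten M N\<^esub> pure S M N m n'"
    unfolding pure_def using assms by (intro tensor_add[symmetric]) auto
  finally show ?thesis .
qed

lemma pure_smult_left:
  assumes "sm M" "sm N" "s \<in> carrier S" "m \<in> carrier M" "n \<in> carrier N"
  shows "pure S M N (s \<odot>\<^bsub>M\<^esub> m) n = s \<odot>\<^bsub>ten M N\<^esub> pure S M N m n"
  unfolding pure_def using assms by (subst tensor_smult) auto

text \<open>The scalar action on a tensor product is defined on the left factors, so the scalar is
  first moved across by the generator \<open>smult\<close> of the congruence.\<close>

lemma pure_smult_right: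
  assumes "sm M" "sm N" "s \<in> carrier S" "m \<in> carrier M" "n \<in> carrier N"
  shows "pure S M N m (s \<odot>\<^bsub>N\<^esub> n) = s \<odot>\<^bsub>ten M N\<^esub> pure S M N m n"
proof -
  have "pure S M N (s \<odot>\<^bsub>M\<^esub> m) n = pure S M N m (s \<odot>\<^bsub>N\<^esub> n)"
    unfolding pure_def using assms by (intro tensor_class_eqI) (auto intro: tensor_cong.smult)
  then show ?thesis using assms by (simp add: pure_smult_left)
qed

text \<open>Every element is the class of a finite formal sum; induction on the multiset builds it
  from the empty class by adding one pure element at a time.\<close>

lemma tensor_induct [consumes 3, case_names zero pure add]:
  assumes "sm M" "sm N" "z \<in> carrier (ten M N)" "P \<zero>\<^bsub>ten M N\<^esub>"
    and pure: "\<And>m n. m \<in> carrier M \<Longrightarrow> n \<in> carrier N \<Longrightarrow> P (pure S M N m n)"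
    and add: "\<And>u v. u \<in> carrier (ten M N) \<Longrightarrow> v \<in> carrier (ten M N) \<Longrightarrow> P u \<Longrightarrow> P v \<Longrightarrow>
      P (u \<oplus>\<^bsub>ten M N\<^esub> v)"
  shows "P z"
proof -
  obtain x where x: "x \<in> formal M N" "z = tensor_class S M N x"
    by (rule tensor_carrierE[OF assms(1-3)])
  have "P (tensor_class S M N x)"
    using x(1)
  proof (induction x)
    case empty
    then show ?case using assms(4) by (simp add: tensor_zero[OF assms(1,2)])
  next
    case (add q x)
    then have q: "{#q#} \<in> formal M N" "x \<in> formal M N" by auto
    have "tensor_class S M N {#q#} = pure S M N (fst q) (snd q)" by (simp add: pure_def)
    then have "P (tensor_class S M N {#q#} \<oplus>\<^bsub>ten M N\<^esub> tensor_class S M N x)"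
      using add.prems q add.IH
      by (intro assms(6) tensor_class_closed[OF assms(1,2)]) (auto intro: pure)
    then show ?case using q by (simp add: tensor_add[OF assms(1,2)])
  qed
  then show ?thesis using x(2) by simp
qed

lemma tensor_eqI:
  assumes "lin f" "lin g" "src f = ten M N" "src g = ten M N" "tgt f = tgt g" "sm M" "sm N"
    and "\<And>m n. m \<in> carrier M \<Longrightarrow> n \<in> carrier N \<Longrightarrow>
      app f (pure S M N m n) = app g (pure S M N m n)"
  shows "f = g"
proof (rule arr_eqI)
  fix x assume "x \<in> carrier (src g)"
  then have "x \<in> carrier (ten M N)" using assms by simp
  with assms(6,7) show "app f x = app g x"
    by (induction x rule: tensor_induct) (use assms in auto)
qed (use assms in auto)

section \<open>Lifting bilinear and trilinear maps\<close>

definition bilin :: "'u smod \<Rightarrow> 'u smod \<Rightarrow> 'u smod \<Rightarrow> ('u \<Rightarrow> 'u \<Rightarrow> 'u) \<Rightarrow> bool" where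
  "bilin M N P \<phi> \<longleftrightarrow> sm M \<and> sm N \<and> sm P \<and>
    (\<forall>m \<in> carrier M. \<forall>n \<in> carrier N. \<phi> m n \<in> carrier P) \<and>
    (\<forall>m \<in> carrier M. \<forall>m' \<in> carrier M. \<forall>n \<in> carrier N. \<phi> (m \<oplus>\<^bsub>M\<^esub> m') n = \<phi> m n \<oplus>\<^bsub>P\<^esub> \<phi> m' n) \<and>
    (\<forall>m \<in> carrier M. \<forall>n \<in> carrier N. \<forall>n' \<in> carrier N. \<phi> m (n \<oplus>\<^bsub>N\<^esub> n') = \<phi> m n \<oplus>\<^bsub>P\<^esub> \<phi> m n') \<and>
    (\<forall>s \<in> carrier S. \<forall>m \<in> carrier M. \<forall>n \<in> carrier N. \<phi> (s \<odot>\<^bsub>M\<^esub> m) n = s \<odot>\<^bsub>P\<^esub> \<phi> m n) \<and>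
    (\<forall>s \<in> carrier S. \<forall>m \<in> carrier M. \<forall>n \<in> carrier N. \<phi> m (s \<odot>\<^bsub>N\<^esub> n) = s \<odot>\<^bsub>P\<^esub> \<phi> m n)"

lemma bilin_lift:
  assumes "bilin M N P \<phi>"
  shows "\<exists>f. lin f \<and> src f = ten M N \<and> tgt f = P \<and>
    (\<forall>m \<in> carrier M. \<forall>n \<in> carrier N. app f (pure S M N m n) = \<phi> m n)"
proof -
  have "\<exists>!f. f \<in> Hom (SMod S) (ten M N) P \<and>
     (\<forall>m \<in> carrier M. \<forall>n \<in> carrier N. app f (pure S M N m n) = \<phi> m n)"
    using assms unfolding bilin_def by (intro tensor_universal) blast+
  then show ?thesis by auto
qed

text \<open>For fixed q the map in (m, n) lifts to \<open>g q\<close> on M \<otimes> N. The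
  dependence of \<open>g q\<close> on q is linear, as is checked on pure elements of M \<otimes> N,
  so (u, q) \<mapsto> \<open>g q\<close>(u) is bilinear and can be lifted once more.\<close>

lemma trilin_lift:
  assumes N: "sm N"
    and left: "\<And>q. q \<in> carrier Q \<Longrightarrow> bilin M N P (\<lambda>m n. \<phi> m n q)"
    and right: "\<And>n. n \<in> carrier N \<Longrightarrow> bilin M Q P (\<lambda>m q. \<phi> m n q)"
  shows "\<exists>f. lin f \<and> src f = ten (ten M N) Q \<and> tgt f = P \<and>
    (\<forall>m \<in> carrier M. \<forall>n \<in> carrier N. \<forall>q \<in> carrier Q.
       app f (pure S (ten M N) Q (pure S M N m n) q) = \<phi> m n q)"
proof -
  \<comment> \<open>The zero of N supplies one instance of \<open>right\<close>, which already
    contains that M, Q and P are semimodules.\<close>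
  have sms: "sm M" "sm Q" "sm P" using right[of "\<zero>\<^bsub>N\<^esub>"] N by (auto simp: bilin_def)
  have "\<forall>q \<in> carrier Q. \<exists>f. lin f \<and> src f = ten M N \<and> tgt f = P \<and>
    (\<forall>m \<in> carrier M. \<forall>n \<in> carrier N. app f (pure S M N m n) = \<phi> m n q)"
    using bilin_lift[OF left] by blast
  then obtain g where g: "\<And>q. q \<in> carrier Q \<Longrightarrow> lin (g q)" "\<And>q. q \<in> carrier Q \<Longrightarrow> src (g q) = ten M N"
      "\<And>q. q \<in> carrier Q \<Longrightarrow> tgt (g q) = P"
      "\<And>q m n. q \<in> carrier Q \<Longrightarrow> m \<in> carrier M \<Longrightarrow> n \<in> carrier N \<Longrightarrow> app (g q) (pure S M N m n) = \<phi> m n q"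
    by (metis (no_types, lifting) bchoice)
  have add: "app (g (q \<oplus>\<^bsub>Q\<^esub> q')) u = app (g q) u \<oplus>\<^bsub>P\<^esub> app (g q') u"
    if q: "q \<in> carrier Q" "q' \<in> carrier Q" and u: "u \<in> carrier (ten M N)" for q q' u
    using sms(1) N u
  proof (induction u rule: tensor_induct)
    case (pure m n)
    then show ?case using right[of n] q sms by (simp add: g bilin_def)
  next
    case (add u v)
    then show ?case using q sms g by (simp add: sm_add_swap)
  qed (use q sms g in simp)
  have smult: "app (g (s \<odot>\<^bsub>Q\<^esub> q)) u = s \<odot>\<^bsub>P\<^esub> app (g q) u"
    if q: "s \<in> carrier S" "q \<in> carrier Q" and u: "u \<in> carrier (ten M N)" for s q u
    using sms(1) N u
  proof (induction u rule: tensor_induct)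
    case (pure m n)
    then show ?case using right[of n] q sms by (simp add: g bilin_def)
  qed (use q sms g in simp_all)
  have "bilin (ten M N) Q P (\<lambda>u q. app (g q) u)"
    unfolding bilin_def using sms N g by (auto simp: add smult)
  from bilin_lift[OF this] show ?thesis using g sms N by auto
qed

lemma the_lin_props:
  assumes "\<exists>f. lin f \<and> src f = M \<and> tgt f = N \<and> P (app f)"
    and "\<And>f g. lin f \<Longrightarrow> lin g \<Longrightarrow> src f = M \<Longrightarrow> src g = M \<Longrightarrow> tgt f = N \<Longrightarrow> tgt g = N \<Longrightarrow>
      P (app f) \<Longrightarrow> P (app g) \<Longrightarrow> f = g"
  shows "lin (the_lin S M N P)" "src (the_lin S M N P) = M" "tgt (the_lin S M N P) = N"
    "P (app (the_lin S M N P))"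
proof -
  obtain f where f: "lin f" "src f = M" "tgt f = N" "P (app f)" using assms(1) by blast
  then have "the_lin S M N P = f" using assms(2) by (intro the_lin_eqI) blast+
  then show "lin (the_lin S M N P)" "src (the_lin S M N P) = M" "tgt (the_lin S M N P) = N"
    "P (app (the_lin S M N P))" using f by simp_all
qed

lemma tensor_eqI3:
  assumes "lin f" "lin g" "src f = ten (ten M N) Q" "src g = ten (ten M N) Q" "tgt f = tgt g"
    and sms: "sm M" "sm N" "sm Q"
    and eq: "\<And>m n q. m \<in> carrier M \<Longrightarrow> n \<in> carrier N \<Longrightarrow> q \<in> carrier Q \<Longrightarrow>
      app f (pure S (ten M N) Q (pure S M N m n) q) = app g (pure S (ten M N) Q (pure S M N m n) q)"
  shows "f = g"
proof (rule tensor_eqI[of f g "ten M N" Q])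
  fix u q assume u: "u \<in> carrier (ten M N)" and q: "q \<in> carrier Q"
  \<comment> \<open>Base case of the induction on u: the scalar 0 is pulled out of the first
    factor.\<close>
  have z: "pure S (ten M N) Q \<zero>\<^bsub>ten M N\<^esub> q = \<zero>\<^bsub>ten (ten M N) Q\<^esub>"
    using pure_smult_left[of "ten M N" Q \<zero> "\<zero>\<^bsub>ten M N\<^esub>" q] sms q by simp
  from sms(1,2) u show "app f (pure S (ten M N) Q u q) = app g (pure S (ten M N) Q u q)"
    by (induction u rule: tensor_induct) (use assms q z in \<open>auto simp: pure_add_left\<close>)
qed (use assms in auto)

lemma tensor_eqI3':
  assumes "lin f" "lin g" "src f = ten M (ten N Q)" "src g = ten M (ten N Q)" "tgt f = tgt g"
    and sms: "sm M" "sm N" "sm Q"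
    and eq: "\<And>m n q. m \<in> carrier M \<Longrightarrow> n \<in> carrier N \<Longrightarrow> q \<in> carrier Q \<Longrightarrow>
      app f (pure S M (ten N Q) m (pure S N Q n q)) = app g (pure S M (ten N Q) m (pure S N Q n q))"
  shows "f = g"
proof (rule tensor_eqI[of f g M "ten N Q"])
  fix m u assume m: "m \<in> carrier M" and u: "u \<in> carrier (ten N Q)"
  have z: "pure S M (ten N Q) m \<zero>\<^bsub>ten N Q\<^esub> = \<zero>\<^bsub>ten M (ten N Q)\<^esub>"
    using pure_smult_right[of M "ten N Q" \<zero> m "\<zero>\<^bsub>ten N Q\<^esub>"] sms m by simp
  from sms(2,3) u show "app f (pure S M (ten N Q) m u) = app g (pure S M (ten N Q) m u)"
    by (induction u rule: tensor_induct) (use assms m z in \<open>auto simp: pure_add_right\<close>)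
qed (use assms in auto)

end

section \<open>Tensor products described by their pure elements\<close>

text \<open>All coherence maps are specified by their values on pure elements only. The reversed tensor
  product \<open>(M, N) \<mapsto> N \<otimes> M\<close> satisfies the same axioms, so that results on \<open>B \<otimes> -\<close> yield
  those on \<open>- \<otimes> B\<close>.\<close>

locale semimod_tensor = semimod_cat S for S :: "'u::infinite ring" (structure) +
  fixes tens :: "'u smod \<Rightarrow> 'u smod \<Rightarrow> 'u smod"  (infixl \<open>\<boxtimes>\<close> 70)
    and pt :: "'u smod \<Rightarrow> 'u smod \<Rightarrow> 'u \<Rightarrow> 'u \<Rightarrow> 'u"
    and tarr :: "'u slin \<Rightarrow> 'u slin \<Rightarrow> 'u slin"  (infixl \<open>\<star>\<close> 70)
    and as asi :: "'u smod \<Rightarrow> 'u smod \<Rightarrow> 'u smod \<Rightarrow> 'u slin"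
    and lu lui ru rui :: "'u smod \<Rightarrow> 'u slin"
    and tw :: "'u smod \<Rightarrow> 'u smod \<Rightarrow> 'u slin"
  assumes sm_tens [simp]: "sm M \<Longrightarrow> sm N \<Longrightarrow> sm (M \<boxtimes> N)"
    and pt_closed [simp]: "sm M \<Longrightarrow> sm N \<Longrightarrow> m \<in> carrier M \<Longrightarrow> n \<in> carrier N \<Longrightarrow>
      pt M N m n \<in> carrier (M \<boxtimes> N)"
    and pt_add_left [simp]: "sm M \<Longrightarrow> sm N \<Longrightarrow> m \<in> carrier M \<Longrightarrow> m' \<in> carrier M \<Longrightarrow>
      n \<in> carrier N \<Longrightarrow> pt M N (m \<oplus>\<^bsub>M\<^esub> m') n = pt M N m n \<oplus>\<^bsub>M \<boxtimes> N\<^esub> pt M N m' n"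
    and pt_add_right [simp]: "sm M \<Longrightarrow> sm N \<Longrightarrow> m \<in> carrier M \<Longrightarrow> n \<in> carrier N \<Longrightarrow>
      n' \<in> carrier N \<Longrightarrow> pt M N m (n \<oplus>\<^bsub>N\<^esub> n') = pt M N m n \<oplus>\<^bsub>M \<boxtimes> N\<^esub> pt M N m n'"
    and pt_smult_left [simp]: "sm M \<Longrightarrow> sm N \<Longrightarrow> s \<in> carrier S \<Longrightarrow> m \<in> carrier M \<Longrightarrow>
      n \<in> carrier N \<Longrightarrow> pt M N (s \<odot>\<^bsub>M\<^esub> m) n = s \<odot>\<^bsub>M \<boxtimes> N\<^esub> pt M N m n"
    and pt_smult_right [simp]: "sm M \<Longrightarrow> sm N \<Longrightarrow> s \<in> carrier S \<Longrightarrow> m \<in> carrier M \<Longrightarrow>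
      n \<in> carrier N \<Longrightarrow> pt M N m (s \<odot>\<^bsub>N\<^esub> n) = s \<odot>\<^bsub>M \<boxtimes> N\<^esub> pt M N m n"
    and tens_induct [consumes 3, case_names zero pure add]:
      "sm M \<Longrightarrow> sm N \<Longrightarrow> z \<in> carrier (M \<boxtimes> N) \<Longrightarrow> Q \<zero>\<^bsub>M \<boxtimes> N\<^esub> \<Longrightarrow>
       (\<And>m n. m \<in> carrier M \<Longrightarrow> n \<in> carrier N \<Longrightarrow> Q (pt M N m n)) \<Longrightarrow>
       (\<And>u v. u \<in> carrier (M \<boxtimes> N) \<Longrightarrow> v \<in> carrier (M \<boxtimes> N) \<Longrightarrow> Q u \<Longrightarrow> Q v \<Longrightarrow>
         Q (u \<oplus>\<^bsub>M \<boxtimes> N\<^esub> v)) \<Longrightarrow> Q z"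
    and tarr [simp]: "lin f \<Longrightarrow> lin g \<Longrightarrow> lin (f \<star> g)"
      "lin f \<Longrightarrow> lin g \<Longrightarrow> src (f \<star> g) = src f \<boxtimes> src g"
      "lin f \<Longrightarrow> lin g \<Longrightarrow> tgt (f \<star> g) = tgt f \<boxtimes> tgt g"
      "lin f \<Longrightarrow> lin g \<Longrightarrow> src f = M \<Longrightarrow> src g = N \<Longrightarrow> m \<in> carrier M \<Longrightarrow> n \<in> carrier N \<Longrightarrow>
       app (f \<star> g) (pt M N m n) = pt (tgt f) (tgt g) (app f m) (app g n)"
    and as [simp]: "sm M \<Longrightarrow> sm N \<Longrightarrow> sm P \<Longrightarrow> lin (as M N P)"
      "sm M \<Longrightarrow> sm N \<Longrightarrow> sm P \<Longrightarrow> src (as M N P) = M \<boxtimes> N \<boxtimes> P"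
      "sm M \<Longrightarrow> sm N \<Longrightarrow> sm P \<Longrightarrow> tgt (as M N P) = M \<boxtimes> (N \<boxtimes> P)"
      "sm M \<Longrightarrow> sm N \<Longrightarrow> sm P \<Longrightarrow> m \<in> carrier M \<Longrightarrow> n \<in> carrier N \<Longrightarrow> q \<in> carrier P \<Longrightarrow>
       app (as M N P) (pt (M \<boxtimes> N) P (pt M N m n) q) = pt M (N \<boxtimes> P) m (pt N P n q)"
    and asi [simp]: "sm M \<Longrightarrow> sm N \<Longrightarrow> sm P \<Longrightarrow> lin (asi M N P)"
      "sm M \<Longrightarrow> sm N \<Longrightarrow> sm P \<Longrightarrow> src (asi M N P) = M \<boxtimes> (N \<boxtimes> P)"
      "sm M \<Longrightarrow> sm N \<Longrightarrow> sm P \<Longrightarrow> tgt (asi M N P) = M \<boxtimes> N \<boxtimes> P"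
      "sm M \<Longrightarrow> sm N \<Longrightarrow> sm P \<Longrightarrow> m \<in> carrier M \<Longrightarrow> n \<in> carrier N \<Longrightarrow> q \<in> carrier P \<Longrightarrow>
       app (asi M N P) (pt M (N \<boxtimes> P) m (pt N P n q)) = pt (M \<boxtimes> N) P (pt M N m n) q"
    and lu [simp]: "sm M \<Longrightarrow> lin (lu M)" "sm M \<Longrightarrow> src (lu M) = I \<boxtimes> M" "sm M \<Longrightarrow> tgt (lu M) = M"
      "sm M \<Longrightarrow> s \<in> carrier S \<Longrightarrow> m \<in> carrier M \<Longrightarrow> app (lu M) (pt I M s m) = s \<odot>\<^bsub>M\<^esub> m"
    and lui [simp]: "sm M \<Longrightarrow> lin (lui M)" "sm M \<Longrightarrow> src (lui M) = M" "sm M \<Longrightarrow> tgt (lui M) = I \<boxtimes> M"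
      "sm M \<Longrightarrow> m \<in> carrier M \<Longrightarrow> app (lui M) m = pt I M \<one> m"
    and ru [simp]: "sm M \<Longrightarrow> lin (ru M)" "sm M \<Longrightarrow> src (ru M) = M \<boxtimes> I" "sm M \<Longrightarrow> tgt (ru M) = M"
      "sm M \<Longrightarrow> s \<in> carrier S \<Longrightarrow> m \<in> carrier M \<Longrightarrow> app (ru M) (pt M I m s) = s \<odot>\<^bsub>M\<^esub> m"
    and rui [simp]: "sm M \<Longrightarrow> lin (rui M)" "sm M \<Longrightarrow> src (rui M) = M" "sm M \<Longrightarrow> tgt (rui M) = M \<boxtimes> I"
      "sm M \<Longrightarrow> m \<in> carrier M \<Longrightarrow> app (rui M) m = pt M I m \<one>"
    and tw [simp]: "sm M \<Longrightarrow> sm N \<Longrightarrow> lin (tw M N)" "sm M \<Longrightarrow> sm N \<Longrightarrow> src (tw M N) = M \<boxtimes> N"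
      "sm M \<Longrightarrow> sm N \<Longrightarrow> tgt (tw M N) = N \<boxtimes> M"
      "sm M \<Longrightarrow> sm N \<Longrightarrow> m \<in> carrier M \<Longrightarrow> n \<in> carrier N \<Longrightarrow>
       app (tw M N) (pt M N m n) = pt N M n m"
begin

lemma pt_zero [simp]:
  "sm M \<Longrightarrow> sm N \<Longrightarrow> n \<in> carrier N \<Longrightarrow> pt M N \<zero>\<^bsub>M\<^esub> n = \<zero>\<^bsub>M \<boxtimes> N\<^esub>"
  "sm M \<Longrightarrow> sm N \<Longrightarrow> m \<in> carrier M \<Longrightarrow> pt M N m \<zero>\<^bsub>N\<^esub> = \<zero>\<^bsub>M \<boxtimes> N\<^esub>"
  using pt_smult_left[of M N \<zero> "\<zero>\<^bsub>M\<^esub>" n] pt_smult_right[of M N \<zero> m "\<zero>\<^bsub>N\<^esub>"] by simp_all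

text \<open>Completes the evaluation of \<open>lui M \<Zspot> lu M\<close> on s \<otimes> m:
  bilinearity turns 1 \<otimes> sm into s(1 \<otimes> m), and the scalar is then absorbed into the
  first factor.\<close>

lemma pt_scalars_left [simp]:
  "sm M \<Longrightarrow> s \<in> carrier S \<Longrightarrow> m \<in> carrier M \<Longrightarrow> s \<odot>\<^bsub>I \<boxtimes> M\<^esub> pt I M \<one> m = pt I M s m"
  using pt_smult_left[of I M s \<one> m] by simp

lemma pt_scalars_right [simp]:
  "sm M \<Longrightarrow> s \<in> carrier S \<Longrightarrow> m \<in> carrier M \<Longrightarrow> s \<odot>\<^bsub>M \<boxtimes> I\<^esub> pt M I m \<one> = pt M I m s"
  using pt_smult_right[of M I s m \<one>] by simp

lemma tens_eqI:
  assumes "lin f" "lin g" "src f = M \<boxtimes> N" "src g = M \<boxtimes> N" "tgt f = tgt g" "sm M" "sm N"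
    and "\<And>m n. m \<in> carrier M \<Longrightarrow> n \<in> carrier N \<Longrightarrow> app f (pt M N m n) = app g (pt M N m n)"
  shows "f = g"
proof (rule arr_eqI)
  fix x assume "x \<in> carrier (src g)"
  then have "x \<in> carrier (M \<boxtimes> N)" using assms by simp
  with assms(6,7) show "app f x = app g x"
    by (induction x rule: tens_induct) (use assms in auto)
qed (use assms in auto)

lemma tens_eqI_left:
  assumes "lin f" "lin g" "src f = M \<boxtimes> N \<boxtimes> P" "src g = M \<boxtimes> N \<boxtimes> P" "tgt f = tgt g"
    and sms: "sm M" "sm N" "sm P"
    and eq: "\<And>m n q. m \<in> carrier M \<Longrightarrow> n \<in> carrier N \<Longrightarrow> q \<in> carrier P \<Longrightarrow>
      app f (pt (M \<boxtimes> N) P (pt M N m n) q) = app g (pt (M \<boxtimes> N) P (pt M N m n) q)"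
  shows "f = g"
proof (rule tens_eqI[of f g "M \<boxtimes> N" P])
  fix u q assume u: "u \<in> carrier (M \<boxtimes> N)" and q: "q \<in> carrier P"
  from sms(1,2) u show "app f (pt (M \<boxtimes> N) P u q) = app g (pt (M \<boxtimes> N) P u q)"
    by (induction u rule: tens_induct) (use assms q in auto)
qed (use assms in auto)

lemma tens_eqI_right:
  assumes "lin f" "lin g" "src f = M \<boxtimes> (N \<boxtimes> P)" "src g = M \<boxtimes> (N \<boxtimes> P)" "tgt f = tgt g"
    and sms: "sm M" "sm N" "sm P"
    and eq: "\<And>m n q. m \<in> carrier M \<Longrightarrow> n \<in> carrier N \<Longrightarrow> q \<in> carrier P \<Longrightarrow>
      app f (pt M (N \<boxtimes> P) m (pt N P n q)) = app g (pt M (N \<boxtimes> P) m (pt N P n q))"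
  shows "f = g"
proof (rule tens_eqI[of f g M "N \<boxtimes> P"])
  fix m u assume m: "m \<in> carrier M" and u: "u \<in> carrier (N \<boxtimes> P)"
  from sms(2,3) u show "app f (pt M (N \<boxtimes> P) m u) = app g (pt M (N \<boxtimes> P) m u)"
    by (induction u rule: tens_induct) (use assms m in auto)
qed (use assms in auto)

lemma tens_eqI_square:
  assumes "lin f" "lin g" "src f = (M \<boxtimes> N) \<boxtimes> (P \<boxtimes> R)" "src g = (M \<boxtimes> N) \<boxtimes> (P \<boxtimes> R)" "tgt f = tgt g"
    and sms: "sm M" "sm N" "sm P" "sm R"
    and eq: "\<And>m n q r. m \<in> carrier M \<Longrightarrow> n \<in> carrier N \<Longrightarrow> q \<in> carrier P \<Longrightarrow> r \<in> carrier R \<Longrightarrow>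
      app f (pt (M \<boxtimes> N) (P \<boxtimes> R) (pt M N m n) (pt P R q r)) =
      app g (pt (M \<boxtimes> N) (P \<boxtimes> R) (pt M N m n) (pt P R q r))"
  shows "f = g"
proof (rule tens_eqI_left[of f g M N "P \<boxtimes> R"])
  fix m n u assume m: "m \<in> carrier M" "n \<in> carrier N" and u: "u \<in> carrier (P \<boxtimes> R)"
  from sms(3,4) u
  show "app f (pt (M \<boxtimes> N) (P \<boxtimes> R) (pt M N m n) u) = app g (pt (M \<boxtimes> N) (P \<boxtimes> R) (pt M N m n) u)"
    by (induction u rule: tens_induct) (use assms m in auto)
qed (use assms in auto)

lemma tarr_id [simp]: "sm M \<Longrightarrow> sm N \<Longrightarrow> idn M \<star> idn N = idn (M \<boxtimes> N)"
  by (rule tens_eqI[of _ _ M N]) auto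

lemma tarr_comp:
  assumes "lin f" "lin g" "lin f'" "lin g'" "tgt f = src f'" "tgt g = src g'"
  shows "(f' \<star> g') \<Zspot> (f \<star> g) = (f' \<Zspot> f) \<star> (g' \<Zspot> g)"
  using assms by (intro tens_eqI[of _ _ "src f" "src g"]) auto

lemma inverse_laws:
  "sm M \<Longrightarrow> sm N \<Longrightarrow> sm P \<Longrightarrow> asi M N P \<Zspot> as M N P = idn (M \<boxtimes> N \<boxtimes> P)"
  "sm M \<Longrightarrow> sm N \<Longrightarrow> sm P \<Longrightarrow> as M N P \<Zspot> asi M N P = idn (M \<boxtimes> (N \<boxtimes> P))"
  "sm M \<Longrightarrow> lui M \<Zspot> lu M = idn (I \<boxtimes> M)" "sm M \<Longrightarrow> lu M \<Zspot> lui M = idn M"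
  "sm M \<Longrightarrow> rui M \<Zspot> ru M = idn (M \<boxtimes> I)" "sm M \<Longrightarrow> ru M \<Zspot> rui M = idn M"
proof -
  assume "sm M" "sm N" "sm P"
  then show "asi M N P \<Zspot> as M N P = idn (M \<boxtimes> N \<boxtimes> P)"
    by (intro tens_eqI_left[of _ _ M N P]) simp_all
  from \<open>sm M\<close> \<open>sm N\<close> \<open>sm P\<close> show "as M N P \<Zspot> asi M N P = idn (M \<boxtimes> (N \<boxtimes> P))"
    by (intro tens_eqI_right[of _ _ M N P]) simp_all
next
  assume M: "sm M"
  show "lui M \<Zspot> lu M = idn (I \<boxtimes> M)" using M by (intro tens_eqI[of _ _ I M]) simp_all
  show "rui M \<Zspot> ru M = idn (M \<boxtimes> I)" using M by (intro tens_eqI[of _ _ M I]) simp_all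
  show "lu M \<Zspot> lui M = idn M" "ru M \<Zspot> rui M = idn M" using M by (auto intro!: arr_eqI)
qed

text \<open>Elementwise form of \<open>inverse_laws\<close>. In the last two equations the inverse
  unitor has been replaced by its value, because it is known on all elements and not only on pure
  ones.\<close>

lemma inverse_apps [simp]:
  "sm M \<Longrightarrow> sm N \<Longrightarrow> sm P \<Longrightarrow> u \<in> carrier (M \<boxtimes> N \<boxtimes> P) \<Longrightarrow> app (asi M N P) (app (as M N P) u) = u"
  "sm M \<Longrightarrow> sm N \<Longrightarrow> sm P \<Longrightarrow> v \<in> carrier (M \<boxtimes> (N \<boxtimes> P)) \<Longrightarrow> app (as M N P) (app (asi M N P) v) = v"
  "sm M \<Longrightarrow> w \<in> carrier (I \<boxtimes> M) \<Longrightarrow> pt I M \<one> (app (lu M) w) = w"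
  "sm M \<Longrightarrow> x \<in> carrier (M \<boxtimes> I) \<Longrightarrow> pt M I (app (ru M) x) \<one> = x"
proof -
  assume "sm M" "sm N" "sm P"
  then show "u \<in> carrier (M \<boxtimes> N \<boxtimes> P) \<Longrightarrow> app (asi M N P) (app (as M N P) u) = u"
    "v \<in> carrier (M \<boxtimes> (N \<boxtimes> P)) \<Longrightarrow> app (as M N P) (app (asi M N P) v) = v"
    using arg_cong[OF inverse_laws(1)[of M N P], of "\<lambda>f. app f u"]
      arg_cong[OF inverse_laws(2)[of M N P], of "\<lambda>f. app f v"] by simp_all
next
  assume "sm M"
  then show "w \<in> carrier (I \<boxtimes> M) \<Longrightarrow> pt I M \<one> (app (lu M) w) = w"
    "x \<in> carrier (M \<boxtimes> I) \<Longrightarrow> pt M I (app (ru M) x) \<one> = x"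
    using arg_cong[OF inverse_laws(3)[of M], of "\<lambda>f. app f w"]
      arg_cong[OF inverse_laws(5)[of M], of "\<lambda>f. app f x"] by simp_all
qed

declare inverse_laws [simp]

lemma inverse_arrows [simp]:
  "sm M \<Longrightarrow> sm N \<Longrightarrow> sm P \<Longrightarrow> inv_arr (SMod S) (as M N P) = asi M N P"
  "sm M \<Longrightarrow> sm N \<Longrightarrow> sm P \<Longrightarrow> inv_arr (SMod S) (asi M N P) = as M N P"
  "sm M \<Longrightarrow> inv_arr (SMod S) (lu M) = lui M"
  "sm M \<Longrightarrow> inv_arr (SMod S) (ru M) = rui M"
  by (auto intro!: inv_arr_eqI)

text \<open>Packs the abstract product as monoidal data, so that one development of B \<otimes> -
  covers two cases: for the standard product \<open>V\<close> is \<open>SModT S\<close>, and for the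
  reversed product the left constructions over \<open>V\<close> are the right constructions over
  \<open>SModT S\<close>.\<close>

definition V :: "('u smod, 'u slin) smcat" where
  "V = cat.extend (SMod S)
    \<lparr>TOb = tens, TAr = tarr, TUnit = I, Assoc = as, LUnit = lu, RUnit = ru, Twist = tw\<rparr>"

lemma V_simps [simp]:
  "Ob V = {M. sm M}" "Ar V = Ar (SMod S)" "Dom V = src" "Cod V = tgt" "Id V = idn"
  "Comp V = comp" "TOb V = tens" "TAr V = tarr" "TUnit V = I"
  "Assoc V = as" "LUnit V = lu" "RUnit V = ru" "Twist V = tw"
  by (simp_all add: V_def cat.extend_def) (simp_all add: SMod_def)

lemma Hom_V [simp]: "Hom V = Hom (SMod S)"
  by (intro ext) (simp add: Hom_def)

lemma inv_arr_V [simp]: "inv_arr V = inv_arr (SMod S)"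
  by (intro ext) (simp add: inv_arr_def)

lemma middle_V [simp]:
  assumes "sm X" "sm Y" "sm Z" "sm W"
  shows "lin (middle V X Y Z W)" "src (middle V X Y Z W) = X \<boxtimes> Y \<boxtimes> (Z \<boxtimes> W)"
    "tgt (middle V X Y Z W) = X \<boxtimes> Z \<boxtimes> (Y \<boxtimes> W)"
    "x \<in> carrier X \<Longrightarrow> y \<in> carrier Y \<Longrightarrow> z \<in> carrier Z \<Longrightarrow> w \<in> carrier W \<Longrightarrow>
      app (middle V X Y Z W) (pt (X \<boxtimes> Y) (Z \<boxtimes> W) (pt X Y x y) (pt Z W z w)) =
      pt (X \<boxtimes> Z) (Y \<boxtimes> W) (pt X Z x z) (pt Y W y w)"
  using assms by (simp_all add: middle_def)

section \<open>Bimonoids and bimonads\<close>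


lemma arr_eq_iff:
  "lin f \<Longrightarrow> lin g \<Longrightarrow> src f = M \<Longrightarrow> src g = M \<Longrightarrow> tgt f = tgt g \<Longrightarrow>
   f = g \<longleftrightarrow> (\<forall>x \<in> carrier M. app f x = app g x)"
  by (metis arr_eqI)

lemma tens_eq_iff:
  "lin f \<Longrightarrow> lin g \<Longrightarrow> src f = M \<boxtimes> N \<Longrightarrow> src g = M \<boxtimes> N \<Longrightarrow> tgt f = tgt g \<Longrightarrow> sm M \<Longrightarrow> sm N \<Longrightarrow>
   f = g \<longleftrightarrow> (\<forall>m \<in> carrier M. \<forall>n \<in> carrier N. app f (pt M N m n) = app g (pt M N m n))"
  using tens_eqI[of f g M N] by blast

lemma tens_eq_iff_left:
  "lin f \<Longrightarrow> lin g \<Longrightarrow> src f = M \<boxtimes> N \<boxtimes> P \<Longrightarrow> src g = M \<boxtimes> N \<boxtimes> P \<Longrightarrow> tgt f = tgt g \<Longrightarrow>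
   sm M \<Longrightarrow> sm N \<Longrightarrow> sm P \<Longrightarrow>
   f = g \<longleftrightarrow> (\<forall>m \<in> carrier M. \<forall>n \<in> carrier N. \<forall>q \<in> carrier P.
     app f (pt (M \<boxtimes> N) P (pt M N m n) q) = app g (pt (M \<boxtimes> N) P (pt M N m n) q))"
  using tens_eqI_left[of f g M N P] by blast

lemma tens_eq_iff_right:
  "lin f \<Longrightarrow> lin g \<Longrightarrow> src f = M \<boxtimes> (N \<boxtimes> P) \<Longrightarrow> src g = M \<boxtimes> (N \<boxtimes> P) \<Longrightarrow> tgt f = tgt g \<Longrightarrow>
   sm M \<Longrightarrow> sm N \<Longrightarrow> sm P \<Longrightarrow>
   f = g \<longleftrightarrow> (\<forall>m \<in> carrier M. \<forall>n \<in> carrier N. \<forall>q \<in> carrier P.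
     app f (pt M (N \<boxtimes> P) m (pt N P n q)) = app g (pt M (N \<boxtimes> P) m (pt N P n q)))"
  using tens_eqI_right[of f g M N P] by blast

text \<open>Covers the source B \<otimes> (B \<otimes> (B \<otimes> X)) of the associativity law of
  the monad B \<otimes> -.\<close>

lemma tens_eq_iff_right4:
  assumes "lin f" "lin g" "src f = M \<boxtimes> (N \<boxtimes> (P \<boxtimes> Q))" "src g = M \<boxtimes> (N \<boxtimes> (P \<boxtimes> Q))" "tgt f = tgt g"
    and sms: "sm M" "sm N" "sm P" "sm Q"
  shows "f = g \<longleftrightarrow> (\<forall>m \<in> carrier M. \<forall>n \<in> carrier N. \<forall>q \<in> carrier P. \<forall>r \<in> carrier Q.
     app f (pt M (N \<boxtimes> (P \<boxtimes> Q)) m (pt N (P \<boxtimes> Q) n (pt P Q q r))) =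
     app g (pt M (N \<boxtimes> (P \<boxtimes> Q)) m (pt N (P \<boxtimes> Q) n (pt P Q q r))))" (is "_ \<longleftrightarrow> ?R")
proof
  assume R: ?R
  show "f = g"
  proof (rule tens_eqI_right[of f g M N "P \<boxtimes> Q"])
    fix m n u assume m: "m \<in> carrier M" "n \<in> carrier N" and u: "u \<in> carrier (P \<boxtimes> Q)"
    from sms(3,4) u show "app f (pt M (N \<boxtimes> (P \<boxtimes> Q)) m (pt N (P \<boxtimes> Q) n u)) =
        app g (pt M (N \<boxtimes> (P \<boxtimes> Q)) m (pt N (P \<boxtimes> Q) n u))"
      by (induction u rule: tens_induct) (use assms m R in auto)
  qed (use assms in auto)
qed simp

lemma arr_scalars_eq_iff:
  "lin f \<Longrightarrow> lin g \<Longrightarrow> src f = I \<Longrightarrow> src g = I \<Longrightarrow> tgt f = tgt g \<Longrightarrow>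
   f = g \<longleftrightarrow> app f \<one> = app g \<one>"
  by (metis arr_scalars_eqI)

lemma app_scalars:
  "lin f \<Longrightarrow> src f = I \<Longrightarrow> s \<in> carrier S \<Longrightarrow> app f s = s \<odot>\<^bsub>tgt f\<^esub> app f \<one>"
  using app_smult[of f I s \<one>] by simp

text \<open>This and the next four definitions are the components of the transformations on B
  \<otimes> -, freed from the restriction to objects and with the inverse coherence maps made
  explicit.\<close>

definition lmult :: "'u smod \<Rightarrow> 'u slin \<Rightarrow> 'u smod \<Rightarrow> 'u slin" where
  "lmult B \<mu> X = (\<mu> \<star> idn X) \<Zspot> asi B B X"

definition lunit :: "'u slin \<Rightarrow> 'u smod \<Rightarrow> 'u slin" where
  "lunit \<eta> X = (\<eta> \<star> idn X) \<Zspot> lui X"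

definition lcomult :: "'u smod \<Rightarrow> 'u slin \<Rightarrow> 'u smod \<Rightarrow> 'u slin" where
  "lcomult B \<Delta> X = as B B X \<Zspot> (\<Delta> \<star> idn X)"

definition lcounit :: "'u slin \<Rightarrow> 'u smod \<Rightarrow> 'u slin" where
  "lcounit \<epsilon> X = lu X \<Zspot> (\<epsilon> \<star> idn X)"

definition ltwist :: "'u smod \<Rightarrow> 'u smod \<Rightarrow> 'u slin" where
  "ltwist B X = as B B X \<Zspot> (tw B B \<star> idn X) \<Zspot> asi B B X"

lemma lmult [simp]:
  assumes "lin \<mu>" "src \<mu> = B \<boxtimes> B" "tgt \<mu> = B" "sm B" "sm X"
  shows "lin (lmult B \<mu> X)" "src (lmult B \<mu> X) = B \<boxtimes> (B \<boxtimes> X)" "tgt (lmult B \<mu> X) = B \<boxtimes> X"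
    "a \<in> carrier B \<Longrightarrow> b \<in> carrier B \<Longrightarrow> x \<in> carrier X \<Longrightarrow>
      app (lmult B \<mu> X) (pt B (B \<boxtimes> X) a (pt B X b x)) = pt B X (app \<mu> (pt B B a b)) x"
  using assms by (simp_all add: lmult_def)

lemma lunit [simp]:
  assumes "lin \<eta>" "src \<eta> = I" "tgt \<eta> = B" "sm B" "sm X"
  shows "lin (lunit \<eta> X)" "src (lunit \<eta> X) = X" "tgt (lunit \<eta> X) = B \<boxtimes> X"
    "x \<in> carrier X \<Longrightarrow> app (lunit \<eta> X) x = pt B X (app \<eta> \<one>) x"
  using assms by (simp_all add: lunit_def)

lemma lcomult [simp]:
  assumes "lin \<Delta>" "src \<Delta> = B" "tgt \<Delta> = B \<boxtimes> B" "sm B" "sm X"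
  shows "lin (lcomult B \<Delta> X)" "src (lcomult B \<Delta> X) = B \<boxtimes> X" "tgt (lcomult B \<Delta> X) = B \<boxtimes> (B \<boxtimes> X)"
    "b \<in> carrier B \<Longrightarrow> x \<in> carrier X \<Longrightarrow>
      app (lcomult B \<Delta> X) (pt B X b x) = app (as B B X) (pt (B \<boxtimes> B) X (app \<Delta> b) x)"
  using assms by (simp_all add: lcomult_def)

lemma lcounit [simp]:
  assumes "lin \<epsilon>" "src \<epsilon> = B" "tgt \<epsilon> = I" "sm B" "sm X"
  shows "lin (lcounit \<epsilon> X)" "src (lcounit \<epsilon> X) = B \<boxtimes> X" "tgt (lcounit \<epsilon> X) = X"
    "b \<in> carrier B \<Longrightarrow> x \<in> carrier X \<Longrightarrow> app (lcounit \<epsilon> X) (pt B X b x) = app \<epsilon> b \<odot>\<^bsub>X\<^esub> x"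
proof -
  note assms [simp]
  show "lin (lcounit \<epsilon> X)" "src (lcounit \<epsilon> X) = B \<boxtimes> X" "tgt (lcounit \<epsilon> X) = X"
    by (simp_all add: lcounit_def)
  assume "b \<in> carrier B" "x \<in> carrier X"
  moreover from this have "app \<epsilon> b \<in> carrier I" by (intro app_closed) simp_all
  ultimately show "app (lcounit \<epsilon> X) (pt B X b x) = app \<epsilon> b \<odot>\<^bsub>X\<^esub> x" by (simp add: lcounit_def)
qed

lemma ltwist [simp]:
  assumes "sm B" "sm X"
  shows "lin (ltwist B X)" "src (ltwist B X) = B \<boxtimes> (B \<boxtimes> X)" "tgt (ltwist B X) = B \<boxtimes> (B \<boxtimes> X)"
    "a \<in> carrier B \<Longrightarrow> b \<in> carrier B \<Longrightarrow> x \<in> carrier X \<Longrightarrow>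
      app (ltwist B X) (pt B (B \<boxtimes> X) a (pt B X b x)) = pt B (B \<boxtimes> X) b (pt B X a x)"
  using assms by (simp_all add: ltwist_def)

lemma left_transformations [simp]:
  assumes "sm B" "sm X"
  shows "left_mult V B \<mu> X = lmult B \<mu> X" "left_unit V \<eta> X = lunit \<eta> X"
    "left_comult V B \<Delta> X = lcomult B \<Delta> X" "left_counit V \<epsilon> X = lcounit \<epsilon> X"
    "left_twist V B X = ltwist B X"
  using assms by (simp_all add: left_mult_def left_unit_def left_comult_def left_counit_def
      left_twist_def lmult_def lunit_def lcomult_def lcounit_def ltwist_def)

lemma scalars_closed [simp]: "lin \<epsilon> \<Longrightarrow> tgt \<epsilon> = I \<Longrightarrow> b \<in> carrier (src \<epsilon>) \<Longrightarrow> app \<epsilon> b \<in> carrier S"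
  using app_closed[of \<epsilon> I b] by simp

text \<open>The right unitor sends u \<otimes> 1 back to u. This is what makes evaluation at X = S
  lossless.\<close>

lemma pt_cancel: "pt Q I u \<one> = pt Q I v \<one> \<Longrightarrow> sm Q \<Longrightarrow> u \<in> carrier Q \<Longrightarrow> v \<in> carrier Q \<Longrightarrow> u = v"
  by (drule arg_cong[of _ _ "app (ru Q)"]) simp

lemma as_cancel:
  assumes "app (as B B I) (pt (B \<boxtimes> B) I u \<one>) = app (as B B I) (pt (B \<boxtimes> B) I v \<one>)"
    and "sm B" "u \<in> carrier (B \<boxtimes> B)" "v \<in> carrier (B \<boxtimes> B)"
  shows "u = v"
  using arg_cong[OF assms(1), of "app (asi B B I)"] assms(2-) by - (rule pt_cancel[of "B \<boxtimes> B" u v]; simp)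

section \<open>Element forms of the bimonoid axioms\<close>

context
  fixes B :: "'u smod" and \<mu> \<eta> \<Delta> \<epsilon> :: "'u slin"
  assumes B [simp]: "sm B"
    and mu [simp]: "lin \<mu>" "src \<mu> = B \<boxtimes> B" "tgt \<mu> = B"
    and eta [simp]: "lin \<eta>" "src \<eta> = I" "tgt \<eta> = B"
    and Delta [simp]: "lin \<Delta>" "src \<Delta> = B" "tgt \<Delta> = B \<boxtimes> B"
    and eps [simp]: "lin \<epsilon>" "src \<epsilon> = B" "tgt \<epsilon> = I"
begin

text \<open>Since \<eta>(s) = s \<eta>(1), an equation of maps out of I \<otimes> B or B \<otimes> I
  need only be tested at the scalar 1, so the unit laws become conditions on the single element
  \<eta>(1).\<close>

lemma is_monoid_iff:
  "is_monoid V B \<mu> \<eta> \<longleftrightarrow>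
     (\<forall>a \<in> carrier B. \<forall>b \<in> carrier B. \<forall>c \<in> carrier B.
        app \<mu> (pt B B (app \<mu> (pt B B a b)) c) = app \<mu> (pt B B a (app \<mu> (pt B B b c)))) \<and>
     (\<forall>a \<in> carrier B. app \<mu> (pt B B (app \<eta> \<one>) a) = a) \<and>
     (\<forall>a \<in> carrier B. app \<mu> (pt B B a (app \<eta> \<one>)) = a)"
proof -
  have "\<mu> \<Zspot> (\<eta> \<star> idn B) = lu B \<longleftrightarrow> (\<forall>a \<in> carrier B. app \<mu> (pt B B (app \<eta> \<one>) a) = a)"
  proof
    assume e: "\<mu> \<Zspot> (\<eta> \<star> idn B) = lu B"
    show "\<forall>a \<in> carrier B. app \<mu> (pt B B (app \<eta> \<one>) a) = a"
    proof
      fix a assume "a \<in> carrier B"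
      moreover have "app (\<mu> \<Zspot> (\<eta> \<star> idn B)) (pt I B \<one> a) = app (lu B) (pt I B \<one> a)" by (simp only: e)
      ultimately show "app \<mu> (pt B B (app \<eta> \<one>) a) = a" by simp
    qed
  next
    assume "\<forall>a \<in> carrier B. app \<mu> (pt B B (app \<eta> \<one>) a) = a"
    note h = this
    show "\<mu> \<Zspot> (\<eta> \<star> idn B) = lu B"
    proof (rule tens_eqI[of _ _ I B])
      fix s a assume "s \<in> carrier I" "a \<in> carrier B"
      moreover from this have "app \<eta> s = s \<odot>\<^bsub>B\<^esub> app \<eta> \<one>" using app_scalars[of \<eta> s] by simp
      ultimately show "app (\<mu> \<Zspot> (\<eta> \<star> idn B)) (pt I B s a) = app (lu B) (pt I B s a)"
        using h by simp
    qed simp_all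
  qed
  moreover have "\<mu> \<Zspot> (idn B \<star> \<eta>) = ru B \<longleftrightarrow> (\<forall>a \<in> carrier B. app \<mu> (pt B B a (app \<eta> \<one>)) = a)"
  proof
    assume e: "\<mu> \<Zspot> (idn B \<star> \<eta>) = ru B"
    show "\<forall>a \<in> carrier B. app \<mu> (pt B B a (app \<eta> \<one>)) = a"
    proof
      fix a assume "a \<in> carrier B"
      moreover have "app (\<mu> \<Zspot> (idn B \<star> \<eta>)) (pt B I a \<one>) = app (ru B) (pt B I a \<one>)" by (simp only: e)
      ultimately show "app \<mu> (pt B B a (app \<eta> \<one>)) = a" by simp
    qed
  next
    assume "\<forall>a \<in> carrier B. app \<mu> (pt B B a (app \<eta> \<one>)) = a"
    note h = this
    show "\<mu> \<Zspot> (idn B \<star> \<eta>) = ru B"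
    proof (rule tens_eqI[of _ _ B I])
      fix a s assume "s \<in> carrier I" "a \<in> carrier B"
      moreover from this have "app \<eta> s = s \<odot>\<^bsub>B\<^esub> app \<eta> \<one>" using app_scalars[of \<eta> s] by simp
      ultimately show "app (\<mu> \<Zspot> (idn B \<star> \<eta>)) (pt B I a s) = app (ru B) (pt B I a s)"
        using h by simp
    qed simp_all
  qed
  moreover have "\<mu> \<Zspot> (\<mu> \<star> idn B) = \<mu> \<Zspot> (idn B \<star> \<mu>) \<Zspot> as B B B \<longleftrightarrow>
    (\<forall>a \<in> carrier B. \<forall>b \<in> carrier B. \<forall>c \<in> carrier B.
        app \<mu> (pt B B (app \<mu> (pt B B a b)) c) = app \<mu> (pt B B a (app \<mu> (pt B B b c))))"
    by (subst tens_eq_iff_left[of _ _ B B B]) simp_all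
  ultimately show ?thesis by (simp add: is_monoid_def)
qed

lemma is_comonoid_iff:
  "is_comonoid V B \<Delta> \<epsilon> \<longleftrightarrow>
     (\<forall>b \<in> carrier B. app (as B B B) (app (\<Delta> \<star> idn B) (app \<Delta> b)) = app (idn B \<star> \<Delta>) (app \<Delta> b)) \<and>
     (\<forall>b \<in> carrier B. app (lu B) (app (\<epsilon> \<star> idn B) (app \<Delta> b)) = b) \<and>
     (\<forall>b \<in> carrier B. app (ru B) (app (idn B \<star> \<epsilon>) (app \<Delta> b)) = b)"
  by (simp add: is_comonoid_def arr_eq_iff[of _ _ B])

lemma is_bimonoid_iff:
  "is_bimonoid V (B, \<mu>, \<eta>, \<Delta>, \<epsilon>) \<longleftrightarrow> is_monoid V B \<mu> \<eta> \<and> is_comonoid V B \<Delta> \<epsilon> \<and>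
     (\<forall>a \<in> carrier B. \<forall>b \<in> carrier B. app \<Delta> (app \<mu> (pt B B a b)) =
        app (\<mu> \<star> \<mu>) (app (middle V B B B B) (pt (B \<boxtimes> B) (B \<boxtimes> B) (app \<Delta> a) (app \<Delta> b)))) \<and>
     app \<Delta> (app \<eta> \<one>) = pt B B (app \<eta> \<one>) (app \<eta> \<one>) \<and>
     (\<forall>a \<in> carrier B. \<forall>b \<in> carrier B. app \<epsilon> (app \<mu> (pt B B a b)) = app \<epsilon> a \<otimes> app \<epsilon> b) \<and>
     app \<epsilon> (app \<eta> \<one>) = \<one>"
  by (simp add: tens_eq_iff[of "\<Delta> \<Zspot> \<mu>" _ B B] tens_eq_iff[of "\<epsilon> \<Zspot> \<mu>" _ B B] arr_scalars_eq_iff)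


section \<open>Monad and comonad axioms for B \<otimes> - against the axioms on B\<close>

lemma left_mult_assoc_iff:
  "(\<forall>X. sm X \<longrightarrow> lmult B \<mu> X \<Zspot> (idn B \<star> lmult B \<mu> X) = lmult B \<mu> X \<Zspot> lmult B \<mu> (B \<boxtimes> X)) \<longleftrightarrow>
   (\<forall>a \<in> carrier B. \<forall>b \<in> carrier B. \<forall>c \<in> carrier B.
      app \<mu> (pt B B (app \<mu> (pt B B a b)) c) = app \<mu> (pt B B a (app \<mu> (pt B B b c))))" (is "?L \<longleftrightarrow> ?R")
proof
  assume ?L
  \<comment> \<open>The pattern for all of these equivalences: the component at \<open>I\<close> is
    evaluated with the last factor equal to 1, which then cancels. Conversely the factor X is
    carried along unchanged by every map in the law.\<close>
  then have e: "lmult B \<mu> I \<Zspot> (idn B \<star> lmult B \<mu> I) = lmult B \<mu> I \<Zspot> lmult B \<mu> (B \<boxtimes> I)" by simp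
  show ?R
  proof (intro ballI)
    fix a b c assume "a \<in> carrier B" "b \<in> carrier B" "c \<in> carrier B"
    then show "app \<mu> (pt B B (app \<mu> (pt B B a b)) c) = app \<mu> (pt B B a (app \<mu> (pt B B b c)))"
      using arg_cong[OF e, of "\<lambda>f. app f (pt B (B \<boxtimes> (B \<boxtimes> I)) a (pt B (B \<boxtimes> I) b (pt B I c \<one>)))"]
      by - (rule pt_cancel[of B]; simp)
  qed
next
  assume ?R
  then show ?L by (auto simp: tens_eq_iff_right4[of _ _ B B B])
qed

text \<open>Applying B \<otimes> - to the unit inserts \<eta>(1) to the right of a, so this monad
  law is the right unit law of B; the unit at B \<otimes> X inserts it to the left.\<close>

lemma left_mult_unit_iff:
  "(\<forall>X. sm X \<longrightarrow> lmult B \<mu> X \<Zspot> (idn B \<star> lunit \<eta> X) = idn (B \<boxtimes> X)) \<longleftrightarrow>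
   (\<forall>a \<in> carrier B. app \<mu> (pt B B a (app \<eta> \<one>)) = a)" (is "?L \<longleftrightarrow> ?R")
proof
  assume ?L
  then have e: "lmult B \<mu> I \<Zspot> (idn B \<star> lunit \<eta> I) = idn (B \<boxtimes> I)" by simp
  show ?R
  proof
    fix a assume "a \<in> carrier B"
    then show "app \<mu> (pt B B a (app \<eta> \<one>)) = a"
      using arg_cong[OF e, of "\<lambda>f. app f (pt B I a \<one>)"] by - (rule pt_cancel[of B]; simp)
  qed
next
  assume ?R
  then show ?L by (auto simp: tens_eq_iff[of _ _ B])
qed

lemma left_unit_mult_iff:
  "(\<forall>X. sm X \<longrightarrow> lmult B \<mu> X \<Zspot> lunit \<eta> (B \<boxtimes> X) = idn (B \<boxtimes> X)) \<longleftrightarrow>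
   (\<forall>a \<in> carrier B. app \<mu> (pt B B (app \<eta> \<one>) a) = a)" (is "?L \<longleftrightarrow> ?R")
proof
  assume ?L
  then have e: "lmult B \<mu> I \<Zspot> lunit \<eta> (B \<boxtimes> I) = idn (B \<boxtimes> I)" by simp
  show ?R
  proof
    fix a assume "a \<in> carrier B"
    then show "app \<mu> (pt B B (app \<eta> \<one>) a) = a"
      using arg_cong[OF e, of "\<lambda>f. app f (pt B I a \<one>)"] by - (rule pt_cancel[of B]; simp)
  qed
next
  assume ?R
  then show ?L by (auto simp: tens_eq_iff[of _ _ B])
qed

text \<open>Both ways of comultiplying a second time factor through B \<otimes> (B \<otimes> B),
  followed by the same reassociation A from (B \<otimes> (B \<otimes> B)) \<otimes> X to B \<otimes>
  (B \<otimes> (B \<otimes> X)). The element z takes the place of \<Delta>(b), which need not be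
  pure.\<close>

lemma left_comult_iterated:
  assumes X [simp]: "sm X" and x [simp]: "x \<in> carrier X" and z: "z \<in> carrier (B \<boxtimes> B)"
  defines "A \<equiv> (idn B \<star> as B B X) \<Zspot> as B (B \<boxtimes> B) X"
  shows "app (idn B \<star> lcomult B \<Delta> X) (app (as B B X) (pt (B \<boxtimes> B) X z x)) =
      app A (pt (B \<boxtimes> (B \<boxtimes> B)) X (app (idn B \<star> \<Delta>) z) x)"
    and "app (lcomult B \<Delta> (B \<boxtimes> X)) (app (as B B X) (pt (B \<boxtimes> B) X z x)) =
      app A (pt (B \<boxtimes> (B \<boxtimes> B)) X (app (as B B B) (app (\<Delta> \<star> idn B) z)) x)"
proof -
  show "app (idn B \<star> lcomult B \<Delta> X) (app (as B B X) (pt (B \<boxtimes> B) X z x)) =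
      app A (pt (B \<boxtimes> (B \<boxtimes> B)) X (app (idn B \<star> \<Delta>) z) x)"
    using B B z by (induction z rule: tens_induct) (simp_all add: A_def)
  \<comment> \<open>When z is a pure element a \<otimes> b, the inner comultiplication produces w =
    \<Delta>(a), again not pure; this needs an induction of its own.\<close>
  have gen: "app (as B B (B \<boxtimes> X)) (pt (B \<boxtimes> B) (B \<boxtimes> X) w (pt B X b x)) =
      app A (pt (B \<boxtimes> (B \<boxtimes> B)) X (app (as B B B) (pt (B \<boxtimes> B) B w b)) x)"
    if b [simp]: "b \<in> carrier B" and w: "w \<in> carrier (B \<boxtimes> B)" for w b
    using B B w by (induction w rule: tens_induct) (simp_all add: A_def)
  show "app (lcomult B \<Delta> (B \<boxtimes> X)) (app (as B B X) (pt (B \<boxtimes> B) X z x)) =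
      app A (pt (B \<boxtimes> (B \<boxtimes> B)) X (app (as B B B) (app (\<Delta> \<star> idn B) z)) x)"
    using B B z by (induction z rule: tens_induct) (simp_all add: A_def gen[unfolded A_def])
qed

lemma left_comult_coassoc_iff:
  "(\<forall>X. sm X \<longrightarrow> (idn B \<star> lcomult B \<Delta> X) \<Zspot> lcomult B \<Delta> X = lcomult B \<Delta> (B \<boxtimes> X) \<Zspot> lcomult B \<Delta> X) \<longleftrightarrow>
   (\<forall>b \<in> carrier B. app (as B B B) (app (\<Delta> \<star> idn B) (app \<Delta> b)) = app (idn B \<star> \<Delta>) (app \<Delta> b))"
  (is "?L \<longleftrightarrow> ?R")
proof
  assume ?L
  then have e: "(idn B \<star> lcomult B \<Delta> I) \<Zspot> lcomult B \<Delta> I = lcomult B \<Delta> (B \<boxtimes> I) \<Zspot> lcomult B \<Delta> I" by simp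
  show ?R
  proof
    fix b assume b: "b \<in> carrier B"
    \<comment> \<open>Undoes the inner half of the reassociation A at X = I, so that the outer
      associator and the factor 1 can be cancelled.\<close>
    have inv: "app (asi B (B \<boxtimes> B) I) (app (idn B \<star> asi B B I) (app (idn B \<star> as B B I) u)) =
        app (asi B (B \<boxtimes> B) I) u" if "u \<in> carrier (B \<boxtimes> (B \<boxtimes> B \<boxtimes> I))" for u
      using that arg_cong[OF tarr_comp[of "idn B" "as B B I" "idn B" "asi B B I"], of "\<lambda>f. app f u"]
      by simp
    show "app (as B B B) (app (\<Delta> \<star> idn B) (app \<Delta> b)) = app (idn B \<star> \<Delta>) (app \<Delta> b)"
      using b arg_cong[OF e, of "\<lambda>f. app (asi B (B \<boxtimes> B) I) (app (idn B \<star> asi B B I) (app f (pt B I b \<one>)))"]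
      by - (rule pt_cancel[of "B \<boxtimes> (B \<boxtimes> B)"]; simp add: left_comult_iterated inv)
  qed
next
  assume ?R
  then show ?L by (auto simp: tens_eq_iff[of _ _ B] left_comult_iterated)
qed

lemma left_counit_right_iff:
  "(\<forall>X. sm X \<longrightarrow> (idn B \<star> lcounit \<epsilon> X) \<Zspot> lcomult B \<Delta> X = idn (B \<boxtimes> X)) \<longleftrightarrow>
   (\<forall>b \<in> carrier B. app (ru B) (app (idn B \<star> \<epsilon>) (app \<Delta> b)) = b)" (is "?L \<longleftrightarrow> ?R")
proof -
  have gen: "app (idn B \<star> lcounit \<epsilon> X) (app (as B B X) (pt (B \<boxtimes> B) X z x)) =
      pt B X (app (ru B) (app (idn B \<star> \<epsilon>) z)) x"
    if [simp]: "sm X" "x \<in> carrier X" and z: "z \<in> carrier (B \<boxtimes> B)" for X x z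
    using B B z by (induction z rule: tens_induct) simp_all
  show ?thesis
  proof
    assume ?L
    then have e: "(idn B \<star> lcounit \<epsilon> I) \<Zspot> lcomult B \<Delta> I = idn (B \<boxtimes> I)" by simp
    show ?R
    proof
      fix b assume "b \<in> carrier B"
      then show "app (ru B) (app (idn B \<star> \<epsilon>) (app \<Delta> b)) = b"
        using arg_cong[OF e, of "\<lambda>f. app f (pt B I b \<one>)"] by - (rule pt_cancel[of B]; simp add: gen)
    qed
  next
    assume ?R
    then show ?L by (auto simp: tens_eq_iff[of _ _ B] gen)
  qed
qed

lemma left_counit_left_iff:
  "(\<forall>X. sm X \<longrightarrow> lcounit \<epsilon> (B \<boxtimes> X) \<Zspot> lcomult B \<Delta> X = idn (B \<boxtimes> X)) \<longleftrightarrow>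
   (\<forall>b \<in> carrier B. app (lu B) (app (\<epsilon> \<star> idn B) (app \<Delta> b)) = b)" (is "?L \<longleftrightarrow> ?R")
proof -
  have gen: "app (lcounit \<epsilon> (B \<boxtimes> X)) (app (as B B X) (pt (B \<boxtimes> B) X z x)) =
      pt B X (app (lu B) (app (\<epsilon> \<star> idn B) z)) x"
    if [simp]: "sm X" "x \<in> carrier X" and z: "z \<in> carrier (B \<boxtimes> B)" for X x z
    using B B z by (induction z rule: tens_induct) simp_all
  show ?thesis
  proof
    assume ?L
    then have e: "lcounit \<epsilon> (B \<boxtimes> I) \<Zspot> lcomult B \<Delta> I = idn (B \<boxtimes> I)" by simp
    show ?R
    proof
      fix b assume "b \<in> carrier B"
      then show "app (lu B) (app (\<epsilon> \<star> idn B) (app \<Delta> b)) = b"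
        using arg_cong[OF e, of "\<lambda>f. app f (pt B I b \<one>)"] by - (rule pt_cancel[of B]; simp add: gen)
    qed
  next
    assume ?R
    then show ?L by (auto simp: tens_eq_iff[of _ _ B] gen)
  qed
qed

lemma left_counit_mult_iff:
  "(\<forall>X. sm X \<longrightarrow> lcounit \<epsilon> X \<Zspot> lmult B \<mu> X = lcounit \<epsilon> X \<Zspot> (idn B \<star> lcounit \<epsilon> X)) \<longleftrightarrow>
   (\<forall>a \<in> carrier B. \<forall>b \<in> carrier B. app \<epsilon> (app \<mu> (pt B B a b)) = app \<epsilon> a \<otimes> app \<epsilon> b)" (is "?L \<longleftrightarrow> ?R")
proof
  assume ?L
  then have e: "lcounit \<epsilon> I \<Zspot> lmult B \<mu> I = lcounit \<epsilon> I \<Zspot> (idn B \<star> lcounit \<epsilon> I)" by simp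
  show ?R
  proof (intro ballI)
    fix a b assume "a \<in> carrier B" "b \<in> carrier B"
    then show "app \<epsilon> (app \<mu> (pt B B a b)) = app \<epsilon> a \<otimes> app \<epsilon> b"
      using arg_cong[OF e, of "\<lambda>f. app f (pt B (B \<boxtimes> I) a (pt B I b \<one>))"] by simp
  qed
next
  assume ?R
  \<comment> \<open>Pulling scalars out of a \<otimes> \<epsilon>(b)x yields
    \<epsilon>(b)\<epsilon>(a)x; commutativity of S restores the order.\<close>
  then show ?L by (auto simp: tens_eq_iff_right[of _ _ B B] sm_smult_smult m_comm)
qed

lemma left_counit_unit_iff:
  "(\<forall>X. sm X \<longrightarrow> lcounit \<epsilon> X \<Zspot> lunit \<eta> X = idn X) \<longleftrightarrow> app \<epsilon> (app \<eta> \<one>) = \<one>" (is "?L \<longleftrightarrow> ?R")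
proof
  assume ?L
  then have e: "lcounit \<epsilon> I \<Zspot> lunit \<eta> I = idn I" by simp
  show ?R using arg_cong[OF e, of "\<lambda>f. app f \<one>"] by simp
next
  assume ?R
  then show ?L by (auto simp: arr_eq_iff)
qed

lemma left_comult_unit_iff:
  "(\<forall>X. sm X \<longrightarrow> lcomult B \<Delta> X \<Zspot> lunit \<eta> X = lunit \<eta> (B \<boxtimes> X) \<Zspot> lunit \<eta> X) \<longleftrightarrow>
   app \<Delta> (app \<eta> \<one>) = pt B B (app \<eta> \<one>) (app \<eta> \<one>)" (is "?L \<longleftrightarrow> ?R")
proof
  assume ?L
  then have e: "lcomult B \<Delta> I \<Zspot> lunit \<eta> I = lunit \<eta> (B \<boxtimes> I) \<Zspot> lunit \<eta> I" by simp
  show ?R using arg_cong[OF e, of "\<lambda>f. app f \<one>"] by - (rule as_cancel[of B]; simp)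
next
  assume ?R
  then show ?L by (auto simp: arr_eq_iff)
qed

text \<open>The twist in the middle exchanges the second and third factors of a1 \<otimes> (a2
  \<otimes> (b1 \<otimes> (b2 \<otimes> x))), after which the two multiplications give a1b1
  \<otimes> (a2b2 \<otimes> x). So the right side is the componentwise product of \<Delta>(a) and
  \<Delta>(b), tensored with x.\<close>

lemma left_bimonad_iff:
  "(\<forall>X. sm X \<longrightarrow> lcomult B \<Delta> X \<Zspot> lmult B \<mu> X =
      (lmult B \<mu> (B \<boxtimes> X) \<Zspot> (idn B \<star> (idn B \<star> lmult B \<mu> X))) \<Zspot> (idn B \<star> ltwist B (B \<boxtimes> X)) \<Zspot>
      (lcomult B \<Delta> (B \<boxtimes> (B \<boxtimes> X)) \<Zspot> (idn B \<star> lcomult B \<Delta> X))) \<longleftrightarrow>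
   (\<forall>a \<in> carrier B. \<forall>b \<in> carrier B. app \<Delta> (app \<mu> (pt B B a b)) =
        app (\<mu> \<star> \<mu>) (app (middle V B B B B) (pt (B \<boxtimes> B) (B \<boxtimes> B) (app \<Delta> a) (app \<Delta> b))))"
  (is "(\<forall>X. sm X \<longrightarrow> ?l X = ?r X) \<longleftrightarrow> ?R")
proof -
  let ?sq = "\<lambda>z w. app (\<mu> \<star> \<mu>) (app (middle V B B B B) (pt (B \<boxtimes> B) (B \<boxtimes> B) z w))"
  \<comment> \<open>The elements z and w replace \<Delta>(a) and \<Delta>(b); the identity is
    additive in each, hence the nested inductions.\<close>
  have gen: "app (lmult B \<mu> (B \<boxtimes> X)) (app (idn B \<star> (idn B \<star> lmult B \<mu> X))
      (app (idn B \<star> ltwist B (B \<boxtimes> X)) (app (as B B (B \<boxtimes> (B \<boxtimes> X)))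
        (pt (B \<boxtimes> B) (B \<boxtimes> (B \<boxtimes> X)) z (app (as B B X) (pt (B \<boxtimes> B) X w x)))))) =
      app (as B B X) (pt (B \<boxtimes> B) X (?sq z w) x)"
    if [simp]: "sm X" "x \<in> carrier X" and z: "z \<in> carrier (B \<boxtimes> B)" and w: "w \<in> carrier (B \<boxtimes> B)" for X x z w
    using B B z
  proof (induction z rule: tens_induct)
    case (pure a b)
    note [simp] = pure
    show ?case using B B w by (induction w rule: tens_induct) simp_all
  qed (use w in simp_all)
  show ?thesis
  proof
    assume "\<forall>X. sm X \<longrightarrow> ?l X = ?r X"
    then have e: "?l I = ?r I" by simp
    show ?R
    proof (intro ballI)
      fix a b assume "a \<in> carrier B" "b \<in> carrier B"
      then show "app \<Delta> (app \<mu> (pt B B a b)) = ?sq (app \<Delta> a) (app \<Delta> b)"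
        using arg_cong[OF e, of "\<lambda>f. app f (pt B (B \<boxtimes> I) a (pt B I b \<one>))"]
        by - (rule as_cancel[of B]; simp add: gen)
    qed
  next
    assume ?R
    then show "\<forall>X. sm X \<longrightarrow> ?l X = ?r X" by (auto simp: tens_eq_iff_right[of _ _ B B] gen)
  qed
qed

end


section \<open>Natural transformations between tensor functors\<close>

lemma left_tensor_simps [simp]:
  "FOb (left_tensor V B) = (\<lambda>X. B \<boxtimes> X)" "FAr (left_tensor V B) = (\<lambda>f. idn B \<star> f)"
  by (simp_all add: left_tensor_def)

lemma fctr_simps [simp]:
  "FOb (comp_fctr G F) = (\<lambda>X. FOb G (FOb F X))" "FAr (comp_fctr G F) = (\<lambda>f. FAr G (FAr F f))"
  "FOb id_fctr = (\<lambda>X. X)" "FAr id_fctr = (\<lambda>f. f)"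
  by (simp_all add: comp_fctr_def id_fctr_def)

lemma is_functor_left_tensor:
  assumes [simp]: "sm B"
  shows "is_functor V V (left_tensor V B)" "is_functor V V id_fctr"
    "is_functor V V (comp_fctr (left_tensor V B) (left_tensor V B))"
  by (auto simp: is_functor_def tarr_comp)

lemma natural_determined:
  assumes [simp]: "sm P" "sm Q"
    and t [simp]: "\<And>X. sm X \<Longrightarrow> lin (t X)" "\<And>X. sm X \<Longrightarrow> src (t X) = P \<boxtimes> X"
      "\<And>X. sm X \<Longrightarrow> tgt (t X) = Q \<boxtimes> X"
    and nat: "\<And>f. lin f \<Longrightarrow> t (tgt f) \<Zspot> (idn P \<star> f) = (idn Q \<star> f) \<Zspot> t (src f)"
    and X [simp]: "sm X"
  shows "t X = (ru Q \<Zspot> t I \<Zspot> rui P) \<star> idn X"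
proof (rule tens_eqI[of _ _ P X])
  fix u x assume [simp]: "u \<in> carrier P" "x \<in> carrier X"
  \<comment> \<open>The linear map s \<mapsto> sx, chosen because it sends 1 to x.\<close>
  define f where "f = (I, restrict (\<lambda>s. s \<odot>\<^bsub>X\<^esub> x) (carrier I), X)"
  have "lin f" unfolding f_def by (rule linI) (simp_all add: sm_smult_add sm_smult_smult)
  moreover have "src f = I" "tgt f = X" "\<And>s. s \<in> carrier S \<Longrightarrow> app f s = s \<odot>\<^bsub>X\<^esub> x"
    by (simp_all add: f_def)
  ultimately have f [simp]: "lin f" "src f = I" "tgt f = X" "app f \<one> = x" by simp_all
  define w where "w = app (t I) (pt P I u \<one>)"
  have [simp]: "w \<in> carrier (Q \<boxtimes> I)" unfolding w_def by (intro app_closed) simp_all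
  have "app (t X) (pt P X u x) = app (idn Q \<star> f) w"
    using arg_cong[OF nat[OF f(1)], of "\<lambda>g. app g (pt P I u \<one>)"] by (simp add: w_def)
  \<comment> \<open>Every element of Q \<otimes> I is of the form q \<otimes> 1, so id \<otimes> f
    only has to be evaluated on a pure element, where it replaces 1 by x.\<close>
  also have "\<dots> = app (idn Q \<star> f) (pt Q I (app (ru Q) w) \<one>)" by simp
  also have "\<dots> = pt Q X (app (ru Q) w) x" by (subst tarr(4)) simp_all
  finally show "app (t X) (pt P X u x) = app ((ru Q \<Zspot> t I \<Zspot> rui P) \<star> idn X) (pt P X u x)"
    by (simp add: w_def)
qed simp_all

context
  fixes B :: "'u smod"
  assumes B [simp]: "sm B"
begin

abbreviation (input) "F \<equiv> left_tensor V B"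

lemma nat_trans_VI:
  assumes "t \<in> extensional {M. sm M}" "is_functor V V G" "is_functor V V H"
    and "\<And>X. sm X \<Longrightarrow> lin (t X) \<and> src (t X) = FOb G X \<and> tgt (t X) = FOb H X"
    and "\<And>f. lin f \<Longrightarrow> t (tgt f) \<Zspot> FAr G f = FAr H f \<Zspot> t (src f)"
  shows "t \<in> nat_trans V V G H"
  using assms by (simp add: nat_trans_def)

lemma left_transformations_natural:
  shows "lin \<mu> \<Longrightarrow> src \<mu> = B \<boxtimes> B \<Longrightarrow> tgt \<mu> = B \<Longrightarrow> left_mult V B \<mu> \<in> nat_trans V V (comp_fctr F F) F"
    and "lin \<eta> \<Longrightarrow> src \<eta> = I \<Longrightarrow> tgt \<eta> = B \<Longrightarrow> left_unit V \<eta> \<in> nat_trans V V id_fctr F"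
    and "lin \<Delta> \<Longrightarrow> src \<Delta> = B \<Longrightarrow> tgt \<Delta> = B \<boxtimes> B \<Longrightarrow> left_comult V B \<Delta> \<in> nat_trans V V F (comp_fctr F F)"
    and "lin \<epsilon> \<Longrightarrow> src \<epsilon> = B \<Longrightarrow> tgt \<epsilon> = I \<Longrightarrow> left_counit V \<epsilon> \<in> nat_trans V V F id_fctr"
proof -
  have ext: "left_mult V B \<mu> \<in> extensional {M. sm M}" "left_unit V \<eta> \<in> extensional {M. sm M}"
    "left_comult V B \<Delta> \<in> extensional {M. sm M}" "left_counit V \<epsilon> \<in> extensional {M. sm M}"
    by (simp_all add: left_mult_def left_unit_def left_comult_def left_counit_def)
  have tr: "sm X \<Longrightarrow> left_unit V \<eta> X = lunit \<eta> X" "sm X \<Longrightarrow> left_counit V \<epsilon> X = lcounit \<epsilon> X" for X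
    by (rule left_transformations[OF B]; simp)+
  {
    assume [simp]: "lin \<mu>" "src \<mu> = B \<boxtimes> B" "tgt \<mu> = B"
    show "left_mult V B \<mu> \<in> nat_trans V V (comp_fctr F F) F"
      using ext by (intro nat_trans_VI) (simp_all add: is_functor_left_tensor[OF B] tens_eq_iff_right[of _ _ B B])
  next
    assume [simp]: "lin \<eta>" "src \<eta> = I" "tgt \<eta> = B"
    show "left_unit V \<eta> \<in> nat_trans V V id_fctr F"
      using ext by (intro nat_trans_VI) (simp_all add: is_functor_left_tensor[OF B] tr arr_eq_iff)
  next
    assume [simp]: "lin \<Delta>" "src \<Delta> = B" "tgt \<Delta> = B \<boxtimes> B"
    \<comment> \<open>Naturality of the associator in its last argument, with z in place of
      \<Delta>(b).\<close>
    have "app (as B B (tgt f)) (pt (B \<boxtimes> B) (tgt f) z (app f x)) =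
        app (idn B \<star> (idn B \<star> f)) (app (as B B (src f)) (pt (B \<boxtimes> B) (src f) z x))"
      if [simp]: "lin f" "x \<in> carrier (src f)" and z: "z \<in> carrier (B \<boxtimes> B)" for f x z
      using B B z by (induction z rule: tens_induct) simp_all
    then show "left_comult V B \<Delta> \<in> nat_trans V V F (comp_fctr F F)"
      using ext by (intro nat_trans_VI) (simp_all add: is_functor_left_tensor[OF B] tens_eq_iff[of _ _ B])
  next
    assume [simp]: "lin \<epsilon>" "src \<epsilon> = B" "tgt \<epsilon> = I"
    show "left_counit V \<epsilon> \<in> nat_trans V V F id_fctr"
      using ext by (intro nat_trans_VI) (simp_all add: is_functor_left_tensor[OF B] tr tens_eq_iff[of _ _ B])
  }
qed

text \<open>Injectivity of the correspondence: the component at S, evaluated on elements with last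
  factor 1, returns the values of the underlying linear map.\<close>

lemma left_transformations_cancel:
  shows "left_mult V B \<mu> = left_mult V B \<mu>' \<Longrightarrow> lin \<mu> \<Longrightarrow> src \<mu> = B \<boxtimes> B \<Longrightarrow> tgt \<mu> = B \<Longrightarrow>
      lin \<mu>' \<Longrightarrow> src \<mu>' = B \<boxtimes> B \<Longrightarrow> tgt \<mu>' = B \<Longrightarrow> \<mu> = \<mu>'"
    and "left_unit V \<eta> = left_unit V \<eta>' \<Longrightarrow> lin \<eta> \<Longrightarrow> src \<eta> = I \<Longrightarrow> tgt \<eta> = B \<Longrightarrow>
      lin \<eta>' \<Longrightarrow> src \<eta>' = I \<Longrightarrow> tgt \<eta>' = B \<Longrightarrow> \<eta> = \<eta>'"
    and "left_comult V B \<Delta> = left_comult V B \<Delta>' \<Longrightarrow> lin \<Delta> \<Longrightarrow> src \<Delta> = B \<Longrightarrow> tgt \<Delta> = B \<boxtimes> B \<Longrightarrow>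
      lin \<Delta>' \<Longrightarrow> src \<Delta>' = B \<Longrightarrow> tgt \<Delta>' = B \<boxtimes> B \<Longrightarrow> \<Delta> = \<Delta>'"
    and "left_counit V \<epsilon> = left_counit V \<epsilon>' \<Longrightarrow> lin \<epsilon> \<Longrightarrow> src \<epsilon> = B \<Longrightarrow> tgt \<epsilon> = I \<Longrightarrow>
      lin \<epsilon>' \<Longrightarrow> src \<epsilon>' = B \<Longrightarrow> tgt \<epsilon>' = I \<Longrightarrow> \<epsilon> = \<epsilon>'"
proof -
  have tr: "left_unit V \<eta> I = lunit \<eta> I" "left_counit V \<epsilon> I = lcounit \<epsilon> I" for \<eta> \<epsilon>
    by (rule left_transformations[OF B sm_scalars])+
  {
    assume e: "left_mult V B \<mu> = left_mult V B \<mu>'"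
      and [simp]: "lin \<mu>" "src \<mu> = B \<boxtimes> B" "tgt \<mu> = B" "lin \<mu>'" "src \<mu>' = B \<boxtimes> B" "tgt \<mu>' = B"
    show "\<mu> = \<mu>'"
    proof (rule tens_eqI[of _ _ B B])
      fix a b assume "a \<in> carrier B" "b \<in> carrier B"
      then show "app \<mu> (pt B B a b) = app \<mu>' (pt B B a b)"
        using arg_cong[OF e, of "\<lambda>t. app (t I) (pt B (B \<boxtimes> I) a (pt B I b \<one>))"]
        by - (rule pt_cancel[of B]; simp)
    qed simp_all
  next
    assume e: "left_unit V \<eta> = left_unit V \<eta>'"
      and [simp]: "lin \<eta>" "src \<eta> = I" "tgt \<eta> = B" "lin \<eta>'" "src \<eta>' = I" "tgt \<eta>' = B"
    show "\<eta> = \<eta>'"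
      using arg_cong[OF e, of "\<lambda>t. app (t I) \<one>"]
      by - (rule arr_scalars_eqI; (rule pt_cancel[of B])?; simp add: tr)
  next
    assume e: "left_comult V B \<Delta> = left_comult V B \<Delta>'"
      and [simp]: "lin \<Delta>" "src \<Delta> = B" "tgt \<Delta> = B \<boxtimes> B" "lin \<Delta>'" "src \<Delta>' = B" "tgt \<Delta>' = B \<boxtimes> B"
    show "\<Delta> = \<Delta>'"
    proof (rule arr_eqI)
      fix b assume "b \<in> carrier (src \<Delta>')"
      then show "app \<Delta> b = app \<Delta>' b"
        using arg_cong[OF e, of "\<lambda>t. app (t I) (pt B I b \<one>)"] by - (rule as_cancel[of B]; simp)
    qed simp_all
  next
    assume e: "left_counit V \<epsilon> = left_counit V \<epsilon>'"
      and [simp]: "lin \<epsilon>" "src \<epsilon> = B" "tgt \<epsilon> = I" "lin \<epsilon>'" "src \<epsilon>' = B" "tgt \<epsilon>' = I"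
    show "\<epsilon> = \<epsilon>'"
    proof (rule arr_eqI)
      fix b assume "b \<in> carrier (src \<epsilon>')"
      then show "app \<epsilon> b = app \<epsilon>' b"
        using arg_cong[OF e, of "\<lambda>t. app (t I) (pt B I b \<one>)"] by (simp add: tr)
    qed simp_all
  }
qed

lemma nat_trans_V:
  assumes "t \<in> nat_trans V V G H"
  shows "t \<in> extensional {M. sm M}" "sm X \<Longrightarrow> lin (t X)" "sm X \<Longrightarrow> src (t X) = FOb G X"
    "sm X \<Longrightarrow> tgt (t X) = FOb H X" "lin f \<Longrightarrow> t (tgt f) \<Zspot> FAr G f = FAr H f \<Zspot> t (src f)"
  using assms by (auto simp: nat_trans_def)

text \<open>Surjectivity for the multiplication. The associator brings the source B \<otimes> (B
  \<otimes> X) into the form P \<otimes> X with P = B \<otimes> B, so that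
  \<open>natural_determined\<close> applies.\<close>

lemma nat_trans_left_mult:
  assumes "m \<in> nat_trans V V (comp_fctr F F) F"
  shows "\<exists>\<mu>. lin \<mu> \<and> src \<mu> = B \<boxtimes> B \<and> tgt \<mu> = B \<and> m = left_mult V B \<mu>"
proof -
  note m [simp] = nat_trans_V(2-4)[OF assms, simplified]
  define t where "t X = m X \<Zspot> as B B X" for X
  define \<mu> where "\<mu> = ru B \<Zspot> t I \<Zspot> rui (B \<boxtimes> B)"
  have t: "sm X \<Longrightarrow> lin (t X)" "sm X \<Longrightarrow> src (t X) = B \<boxtimes> B \<boxtimes> X" "sm X \<Longrightarrow> tgt (t X) = B \<boxtimes> X" for X
    by (simp_all add: t_def)
  have nat: "t (tgt f) \<Zspot> (idn (B \<boxtimes> B) \<star> f) = (idn B \<star> f) \<Zspot> t (src f)" if f [simp]: "lin f" for f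
  proof (rule tens_eqI_left[of _ _ B B "src f"])
    fix a b x assume "a \<in> carrier B" "b \<in> carrier B" "x \<in> carrier (src f)"
    then show "app (t (tgt f) \<Zspot> (idn (B \<boxtimes> B) \<star> f)) (pt (B \<boxtimes> B) (src f) (pt B B a b) x) =
        app ((idn B \<star> f) \<Zspot> t (src f)) (pt (B \<boxtimes> B) (src f) (pt B B a b) x)"
      using arg_cong[OF nat_trans_V(5)[OF assms f], of "\<lambda>g. app g (pt B (B \<boxtimes> src f) a (pt B (src f) b x))"]
      by (simp add: t_def)
  qed (simp_all add: t)
  have mu: "lin \<mu>" "src \<mu> = B \<boxtimes> B" "tgt \<mu> = B" by (simp_all add: \<mu>_def t)
  have "m X = lmult B \<mu> X" if [simp]: "sm X" for X
  proof -
    have "t X = \<mu> \<star> idn X" unfolding \<mu>_def by (rule natural_determined) (simp_all add: t nat)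
    then have "t X \<Zspot> asi B B X = lmult B \<mu> X" by (simp add: lmult_def)
    moreover have "t X \<Zspot> asi B B X = m X" by (simp add: t_def Comp_assoc)
    ultimately show ?thesis by simp
  qed
  then have "m = left_mult V B \<mu>"
    using nat_trans_V(1)[OF assms] by (intro extensionalityI[of _ "{M. sm M}"]) (simp_all, simp add: left_mult_def)
  with mu show ?thesis by blast
qed

text \<open>Here the target is what needs rewriting: composing with the inverse associator gives Q
  \<otimes> X with Q = B \<otimes> B.\<close>

lemma nat_trans_left_comult:
  assumes "d \<in> nat_trans V V F (comp_fctr F F)"
  shows "\<exists>\<Delta>. lin \<Delta> \<and> src \<Delta> = B \<and> tgt \<Delta> = B \<boxtimes> B \<and> d = left_comult V B \<Delta>"
proof -
  note d [simp] = nat_trans_V(2-4)[OF assms, simplified]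
  define t where "t X = asi B B X \<Zspot> d X" for X
  define \<Delta> where "\<Delta> = ru (B \<boxtimes> B) \<Zspot> t I \<Zspot> rui B"
  have t: "sm X \<Longrightarrow> lin (t X)" "sm X \<Longrightarrow> src (t X) = B \<boxtimes> X" "sm X \<Longrightarrow> tgt (t X) = B \<boxtimes> B \<boxtimes> X" for X
    by (simp_all add: t_def)
  have nat: "t (tgt f) \<Zspot> (idn B \<star> f) = (idn (B \<boxtimes> B) \<star> f) \<Zspot> t (src f)" if f [simp]: "lin f" for f
  proof -
    have "t (tgt f) \<Zspot> (idn B \<star> f) = asi B B (tgt f) \<Zspot> (idn B \<star> (idn B \<star> f)) \<Zspot> d (src f)"
      using nat_trans_V(5)[OF assms f] by (simp add: t_def Comp_assoc)
    also have "\<dots> = (asi B B (tgt f) \<Zspot> (idn B \<star> (idn B \<star> f))) \<Zspot> d (src f)" by (simp add: Comp_assoc)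
    also have "asi B B (tgt f) \<Zspot> (idn B \<star> (idn B \<star> f)) = (idn (B \<boxtimes> B) \<star> f) \<Zspot> asi B B (src f)"
      by (rule tens_eqI_right[of _ _ B B "src f"]) simp_all
    also have "((idn (B \<boxtimes> B) \<star> f) \<Zspot> asi B B (src f)) \<Zspot> d (src f) = (idn (B \<boxtimes> B) \<star> f) \<Zspot> t (src f)"
      by (simp add: t_def Comp_assoc)
    finally show ?thesis .
  qed
  have Delta: "lin \<Delta>" "src \<Delta> = B" "tgt \<Delta> = B \<boxtimes> B" by (simp_all add: \<Delta>_def t)
  have "d X = lcomult B \<Delta> X" if [simp]: "sm X" for X
  proof -
    have "t X = \<Delta> \<star> idn X" unfolding \<Delta>_def by (rule natural_determined) (simp_all add: t nat)
    then have "as B B X \<Zspot> t X = lcomult B \<Delta> X" by (simp add: lcomult_def)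
    moreover have "as B B X \<Zspot> t X = d X" by (simp add: t_def flip: Comp_assoc)
    ultimately show ?thesis by simp
  qed
  then have "d = left_comult V B \<Delta>"
    using nat_trans_V(1)[OF assms] by (intro extensionalityI[of _ "{M. sm M}"]) (simp_all, simp add: left_comult_def)
  with Delta show ?thesis by blast
qed

text \<open>The identity functor is treated as I \<otimes> - through the left unitor, that is, P =
  I; for the counit the inverse unitor gives Q = I.\<close>

lemma nat_trans_left_unit:
  assumes "e \<in> nat_trans V V id_fctr F"
  shows "\<exists>\<eta>. lin \<eta> \<and> src \<eta> = I \<and> tgt \<eta> = B \<and> e = left_unit V \<eta>"
proof -
  note e [simp] = nat_trans_V(2-4)[OF assms, simplified]
  define t where "t X = e X \<Zspot> lu X" for X
  define \<eta> where "\<eta> = ru B \<Zspot> t I \<Zspot> rui I"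
  have t: "sm X \<Longrightarrow> lin (t X)" "sm X \<Longrightarrow> src (t X) = I \<boxtimes> X" "sm X \<Longrightarrow> tgt (t X) = B \<boxtimes> X" for X
    by (simp_all add: t_def)
  have nat: "t (tgt f) \<Zspot> (idn I \<star> f) = (idn B \<star> f) \<Zspot> t (src f)" if f [simp]: "lin f" for f
  proof -
    have "t (tgt f) \<Zspot> (idn I \<star> f) = e (tgt f) \<Zspot> lu (tgt f) \<Zspot> (idn I \<star> f)"
      by (simp add: t_def Comp_assoc)
    also have "lu (tgt f) \<Zspot> (idn I \<star> f) = f \<Zspot> lu (src f)"
      by (rule tens_eqI[of _ _ I "src f"]) simp_all
    also have "e (tgt f) \<Zspot> f \<Zspot> lu (src f) = (e (tgt f) \<Zspot> f) \<Zspot> lu (src f)" by (simp add: Comp_assoc)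
    also have "\<dots> = (idn B \<star> f) \<Zspot> t (src f)"
      using nat_trans_V(5)[OF assms f] by (simp add: t_def Comp_assoc)
    finally show ?thesis .
  qed
  have eta: "lin \<eta>" "src \<eta> = I" "tgt \<eta> = B" by (simp_all add: \<eta>_def t)
  have "e X = lunit \<eta> X" if [simp]: "sm X" for X
  proof -
    have "t X = \<eta> \<star> idn X" unfolding \<eta>_def by (rule natural_determined) (simp_all add: t nat)
    then have "t X \<Zspot> lui X = lunit \<eta> X" by (simp add: lunit_def)
    moreover have "t X \<Zspot> lui X = e X" by (simp add: t_def Comp_assoc)
    ultimately show ?thesis by simp
  qed
  moreover have "left_unit V \<eta> X = lunit \<eta> X" if "sm X" for X by (rule left_transformations[OF B that])
  ultimately have "e = left_unit V \<eta>"
    using nat_trans_V(1)[OF assms] by (intro extensionalityI[of _ "{M. sm M}"]) (simp_all, simp add: left_unit_def)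
  with eta show ?thesis by blast
qed

lemma nat_trans_left_counit:
  assumes "c \<in> nat_trans V V F id_fctr"
  shows "\<exists>\<epsilon>. lin \<epsilon> \<and> src \<epsilon> = B \<and> tgt \<epsilon> = I \<and> c = left_counit V \<epsilon>"
proof -
  note c [simp] = nat_trans_V(2-4)[OF assms, simplified]
  define t where "t X = lui X \<Zspot> c X" for X
  define \<epsilon> where "\<epsilon> = ru I \<Zspot> t I \<Zspot> rui B"
  have t: "sm X \<Longrightarrow> lin (t X)" "sm X \<Longrightarrow> src (t X) = B \<boxtimes> X" "sm X \<Longrightarrow> tgt (t X) = I \<boxtimes> X" for X
    by (simp_all add: t_def)
  have nat: "t (tgt f) \<Zspot> (idn B \<star> f) = (idn I \<star> f) \<Zspot> t (src f)" if f [simp]: "lin f" for f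
  proof -
    have "t (tgt f) \<Zspot> (idn B \<star> f) = lui (tgt f) \<Zspot> f \<Zspot> c (src f)"
      using nat_trans_V(5)[OF assms f] by (simp add: t_def Comp_assoc)
    also have "\<dots> = (lui (tgt f) \<Zspot> f) \<Zspot> c (src f)" by (simp add: Comp_assoc)
    also have "lui (tgt f) \<Zspot> f = (idn I \<star> f) \<Zspot> lui (src f)" by (rule arr_eqI) simp_all
    also have "((idn I \<star> f) \<Zspot> lui (src f)) \<Zspot> c (src f) = (idn I \<star> f) \<Zspot> t (src f)"
      by (simp add: t_def Comp_assoc)
    finally show ?thesis .
  qed
  have eps: "lin \<epsilon>" "src \<epsilon> = B" "tgt \<epsilon> = I" by (simp_all add: \<epsilon>_def t)
  have "c X = lcounit \<epsilon> X" if [simp]: "sm X" for X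
  proof -
    have "t X = \<epsilon> \<star> idn X" unfolding \<epsilon>_def by (rule natural_determined) (simp_all add: t nat)
    then have "lu X \<Zspot> t X = lcounit \<epsilon> X" by (simp add: lcounit_def)
    moreover have "lu X \<Zspot> t X = c X" by (simp add: t_def flip: Comp_assoc)
    ultimately show ?thesis by simp
  qed
  moreover have "left_counit V \<epsilon> X = lcounit \<epsilon> X" if "sm X" for X by (rule left_transformations[OF B that])
  ultimately have "c = left_counit V \<epsilon>"
    using nat_trans_V(1)[OF assms] by (intro extensionalityI[of _ "{M. sm M}"]) (simp_all, simp add: left_counit_def)
  with eps show ?thesis by blast
qed

text \<open>The naturality demands are met by any maps of the right types, so only families of
  equations indexed by X remain, and each is equivalent to one axiom on B.\<close>

lemma bimonad_iff_bimonoid: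
  assumes mu [simp]: "lin \<mu>" "src \<mu> = B \<boxtimes> B" "tgt \<mu> = B"
    and eta [simp]: "lin \<eta>" "src \<eta> = I" "tgt \<eta> = B"
    and Delta [simp]: "lin \<Delta>" "src \<Delta> = B" "tgt \<Delta> = B \<boxtimes> B"
    and eps [simp]: "lin \<epsilon>" "src \<epsilon> = B" "tgt \<epsilon> = I"
  shows "(left_mult V B \<mu>, left_unit V \<eta>, left_comult V B \<Delta>, left_counit V \<epsilon>)
      \<in> bimonad_structures V F (left_twist V B) \<longleftrightarrow> is_bimonoid V (B, \<mu>, \<eta>, \<Delta>, \<epsilon>)" (is "?L \<longleftrightarrow> _")
proof -
  note typed = B mu eta Delta eps
  have tr [simp]: "left_unit V \<eta> X = lunit \<eta> X" "left_counit V \<epsilon> X = lcounit \<epsilon> X" if "sm X" for X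
    by (rule left_transformations[OF B that])+
  note nts = left_transformations_natural(1)[OF mu] left_transformations_natural(2)[OF eta]
    left_transformations_natural(3)[OF Delta] left_transformations_natural(4)[OF eps]
  \<comment> \<open>The equation between counit and unit occurs twice below: as the unit condition
    of the monad morphism \<epsilon> and as the counit condition of the comonad morphism e.\<close>
  have "?L \<longleftrightarrow>
     (\<forall>X. sm X \<longrightarrow> lmult B \<mu> X \<Zspot> (idn B \<star> lmult B \<mu> X) = lmult B \<mu> X \<Zspot> lmult B \<mu> (B \<boxtimes> X)) \<and>
     (\<forall>X. sm X \<longrightarrow> lmult B \<mu> X \<Zspot> (idn B \<star> lunit \<eta> X) = idn (B \<boxtimes> X)) \<and>
     (\<forall>X. sm X \<longrightarrow> lmult B \<mu> X \<Zspot> lunit \<eta> (B \<boxtimes> X) = idn (B \<boxtimes> X)) \<and>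
     (\<forall>X. sm X \<longrightarrow> (idn B \<star> lcomult B \<Delta> X) \<Zspot> lcomult B \<Delta> X = lcomult B \<Delta> (B \<boxtimes> X) \<Zspot> lcomult B \<Delta> X) \<and>
     (\<forall>X. sm X \<longrightarrow> (idn B \<star> lcounit \<epsilon> X) \<Zspot> lcomult B \<Delta> X = idn (B \<boxtimes> X)) \<and>
     (\<forall>X. sm X \<longrightarrow> lcounit \<epsilon> (B \<boxtimes> X) \<Zspot> lcomult B \<Delta> X = idn (B \<boxtimes> X)) \<and>
     (\<forall>X. sm X \<longrightarrow> lcounit \<epsilon> X \<Zspot> lmult B \<mu> X = lcounit \<epsilon> X \<Zspot> (idn B \<star> lcounit \<epsilon> X)) \<and>
     (\<forall>X. sm X \<longrightarrow> lcounit \<epsilon> X \<Zspot> lunit \<eta> X = idn X) \<and>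
     (\<forall>X. sm X \<longrightarrow> lcomult B \<Delta> X \<Zspot> lunit \<eta> X = lunit \<eta> (B \<boxtimes> X) \<Zspot> lunit \<eta> X) \<and>
     (\<forall>X. sm X \<longrightarrow> lcounit \<epsilon> X \<Zspot> lunit \<eta> X = idn X) \<and>
     (\<forall>X. sm X \<longrightarrow> lcomult B \<Delta> X \<Zspot> lmult B \<mu> X =
      (lmult B \<mu> (B \<boxtimes> X) \<Zspot> (idn B \<star> (idn B \<star> lmult B \<mu> X))) \<Zspot> (idn B \<star> ltwist B (B \<boxtimes> X)) \<Zspot>
      (lcomult B \<Delta> (B \<boxtimes> (B \<boxtimes> X)) \<Zspot> (idn B \<star> lcomult B \<Delta> X)))"
    unfolding bimonad_structures_def monad_def comonad_def monad_morphism_def comonad_morphism_def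
    using nts by (simp add: hcomp_def id_trans_def)
  also have "\<dots> \<longleftrightarrow> is_bimonoid V (B, \<mu>, \<eta>, \<Delta>, \<epsilon>)"
    unfolding is_bimonoid_iff[OF typed] is_monoid_iff[OF typed] is_comonoid_iff[OF typed]
      left_mult_assoc_iff[OF typed] left_mult_unit_iff[OF typed] left_unit_mult_iff[OF typed]
      left_comult_coassoc_iff[OF typed] left_counit_right_iff[OF typed] left_counit_left_iff[OF typed]
      left_counit_mult_iff[OF typed] left_counit_unit_iff[OF typed] left_comult_unit_iff[OF typed]
      left_bimonad_iff[OF typed]
    by blast
  finally show ?thesis .
qed

theorem bimonoids_bij_bimonads:
  "bij_betw
     (\<lambda>(\<mu>, \<eta>, \<Delta>, \<epsilon>). (left_mult V B \<mu>, left_unit V \<eta>, left_comult V B \<Delta>, left_counit V \<epsilon>))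
     {(\<mu>, \<eta>, \<Delta>, \<epsilon>). is_bimonoid V (B, \<mu>, \<eta>, \<Delta>, \<epsilon>)}
     (bimonad_structures V F (left_twist V B))"
proof -
  have typed: "lin \<mu> \<and> src \<mu> = B \<boxtimes> B \<and> tgt \<mu> = B \<and> lin \<eta> \<and> src \<eta> = I \<and> tgt \<eta> = B \<and>
      lin \<Delta> \<and> src \<Delta> = B \<and> tgt \<Delta> = B \<boxtimes> B \<and> lin \<epsilon> \<and> src \<epsilon> = B \<and> tgt \<epsilon> = I"
    if "is_bimonoid V (B, \<mu>, \<eta>, \<Delta>, \<epsilon>)" for \<mu> \<eta> \<Delta> \<epsilon>
    using that by (simp add: is_monoid_def is_comonoid_def)
  let ?f = "\<lambda>(\<mu>, \<eta>, \<Delta>, \<epsilon>). (left_mult V B \<mu>, left_unit V \<eta>, left_comult V B \<Delta>, left_counit V \<epsilon>)"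
  let ?A = "{(\<mu>, \<eta>, \<Delta>, \<epsilon>). is_bimonoid V (B, \<mu>, \<eta>, \<Delta>, \<epsilon>)}"
  show ?thesis
  proof (intro bij_betw_imageI subset_antisym subsetI)
    have "x = y" if x: "x \<in> ?A" and y: "y \<in> ?A" and e: "?f x = ?f y" for x y
    proof -
      obtain \<mu> \<eta> \<Delta> \<epsilon> \<mu>' \<eta>' \<Delta>' \<epsilon>' where xy: "x = (\<mu>, \<eta>, \<Delta>, \<epsilon>)" "y = (\<mu>', \<eta>', \<Delta>', \<epsilon>')"
        by (metis prod.exhaust)
      then have t: "is_bimonoid V (B, \<mu>, \<eta>, \<Delta>, \<epsilon>)" "is_bimonoid V (B, \<mu>', \<eta>', \<Delta>', \<epsilon>')"
        using x y by (simp_all del: is_bimonoid.simps)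
      have "left_mult V B \<mu> = left_mult V B \<mu>'" "left_unit V \<eta> = left_unit V \<eta>'"
        "left_comult V B \<Delta> = left_comult V B \<Delta>'" "left_counit V \<epsilon> = left_counit V \<epsilon>'"
        using e xy by simp_all
      then have "\<mu> = \<mu>'" "\<eta> = \<eta>'" "\<Delta> = \<Delta>'" "\<epsilon> = \<epsilon>'"
        using typed[OF t(1)] typed[OF t(2)] left_transformations_cancel by metis+
      then show ?thesis using xy by simp
    qed
    then show "inj_on ?f ?A" by (rule inj_onI)
  next
    fix z assume "z \<in> ?f ` ?A"
    then obtain \<mu> \<eta> \<Delta> \<epsilon> where "is_bimonoid V (B, \<mu>, \<eta>, \<Delta>, \<epsilon>)" "z = ?f (\<mu>, \<eta>, \<Delta>, \<epsilon>)"
      by (auto simp del: is_bimonoid.simps)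
    then show "z \<in> bimonad_structures V F (left_twist V B)"
      using typed[of \<mu> \<eta> \<Delta> \<epsilon>] bimonad_iff_bimonoid[of \<mu> \<eta> \<Delta> \<epsilon>] by (simp del: is_bimonoid.simps)
  next
    fix z assume b: "z \<in> bimonad_structures V F (left_twist V B)"
    obtain m e d c where z: "z = (m, e, d, c)" by (metis prod.exhaust)
    have "m \<in> nat_trans V V (comp_fctr F F) F" "e \<in> nat_trans V V id_fctr F"
      "d \<in> nat_trans V V F (comp_fctr F F)" "c \<in> nat_trans V V F id_fctr"
      using b unfolding z bimonad_structures_def monad_def comonad_def by auto
    then obtain \<mu> \<eta> \<Delta> \<epsilon> where t: "lin \<mu>" "src \<mu> = B \<boxtimes> B" "tgt \<mu> = B" "lin \<eta>" "src \<eta> = I" "tgt \<eta> = B"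
      "lin \<Delta>" "src \<Delta> = B" "tgt \<Delta> = B \<boxtimes> B" "lin \<epsilon>" "src \<epsilon> = B" "tgt \<epsilon> = I"
      and e: "m = left_mult V B \<mu>" "e = left_unit V \<eta>" "d = left_comult V B \<Delta>" "c = left_counit V \<epsilon>"
      using nat_trans_left_mult nat_trans_left_unit nat_trans_left_comult nat_trans_left_counit by metis
    have "is_bimonoid V (B, \<mu>, \<eta>, \<Delta>, \<epsilon>)" using b bimonad_iff_bimonoid[OF t] unfolding z e by blast
    then show "z \<in> ?f ` ?A"
      unfolding z e by (intro image_eqI[of _ _ "(\<mu>, \<eta>, \<Delta>, \<epsilon>)"]) (simp_all del: is_bimonoid.simps)
  qed
qed

end

end

section \<open>The tensor product of semimodules and its reverse\<close>

lemma SModT_simps [simp]: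
  "Ob (SModT S) = Ob (SMod S)" "Ar (SModT S) = Ar (SMod S)" "Dom (SModT S) = Dom (SMod S)"
  "Cod (SModT S) = Cod (SMod S)" "Id (SModT S) = Id (SMod S)" "Comp (SModT S) = Comp (SMod S)"
  "TOb (SModT S) = tensor S" "TAr (SModT S) = tensor_lin S" "TUnit (SModT S) = scalars S"
  by (simp_all add: SModT_def cat.extend_def)

context semimod_cat
begin

text \<open>Plays two roles: the inverse of the associator, and, with its arguments reversed, the
  associator of the reversed product.\<close>

definition assoc_inv :: "'u smod \<Rightarrow> 'u smod \<Rightarrow> 'u smod \<Rightarrow> 'u slin" where
  "assoc_inv M N P = the_lin S (ten M (ten N P)) (ten (ten M N) P) (\<lambda>h.
     \<forall>m \<in> carrier M. \<forall>n \<in> carrier N. \<forall>p \<in> carrier P.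
       h (pure S M (ten N P) m (pure S N P n p)) = pure S (ten M N) P (pure S M N m n) p)"

definition lunit_inv :: "'u smod \<Rightarrow> 'u slin" where
  "lunit_inv M = (M, restrict (\<lambda>m. pure S I M \<one> m) (carrier M), ten I M)"

definition runit_inv :: "'u smod \<Rightarrow> 'u slin" where
  "runit_inv M = (M, restrict (\<lambda>m. pure S M I m \<one>) (carrier M), ten M I)"

lemmas pure_simps = pure_add_left pure_add_right pure_smult_left pure_smult_right

text \<open>The passage from a definite description to its defining property: existence is the
  universal property, uniqueness is equality on pure elements.\<close>

lemma bilin_the_lin:
  assumes b: "bilin M N P \<phi>"
  defines "f \<equiv> the_lin S (ten M N) P (\<lambda>h. \<forall>m \<in> carrier M. \<forall>n \<in> carrier N. h (pure S M N m n) = \<phi> m n)"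
  shows "lin f" "src f = ten M N" "tgt f = P"
    "m \<in> carrier M \<Longrightarrow> n \<in> carrier N \<Longrightarrow> app f (pure S M N m n) = \<phi> m n"
proof -
  have "sm M" "sm N" using b by (simp_all add: bilin_def)
  then have "g = h" if "lin g" "lin h" "src g = ten M N" "src h = ten M N" "tgt g = P" "tgt h = P"
    "\<forall>m \<in> carrier M. \<forall>n \<in> carrier N. app g (pure S M N m n) = \<phi> m n"
    "\<forall>m \<in> carrier M. \<forall>n \<in> carrier N. app h (pure S M N m n) = \<phi> m n" for g h
    using that by (intro tensor_eqI[of g h M N]) simp_all
  note * = the_lin_props[OF bilin_lift[OF b] this]
  show "lin f" "src f = ten M N" "tgt f = P"
    "m \<in> carrier M \<Longrightarrow> n \<in> carrier N \<Longrightarrow> app f (pure S M N m n) = \<phi> m n"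
    unfolding f_def using * by blast+
qed

lemma tensor_lin:
  assumes [simp]: "lin f" "lin g"
  shows "lin (tensor_lin S f g)" "src (tensor_lin S f g) = ten (src f) (src g)"
    "tgt (tensor_lin S f g) = ten (tgt f) (tgt g)"
    "m \<in> carrier (src f) \<Longrightarrow> n \<in> carrier (src g) \<Longrightarrow>
      app (tensor_lin S f g) (pure S (src f) (src g) m n) = pure S (tgt f) (tgt g) (app f m) (app g n)"
proof -
  have "bilin (src f) (src g) (ten (tgt f) (tgt g)) (\<lambda>m n. pure S (tgt f) (tgt g) (app f m) (app g n))"
    by (simp add: bilin_def pure_simps)
  note * = bilin_the_lin[OF this]
  show "lin (tensor_lin S f g)" "src (tensor_lin S f g) = ten (src f) (src g)"
    "tgt (tensor_lin S f g) = ten (tgt f) (tgt g)"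
    "m \<in> carrier (src f) \<Longrightarrow> n \<in> carrier (src g) \<Longrightarrow>
      app (tensor_lin S f g) (pure S (src f) (src g) m n) = pure S (tgt f) (tgt g) (app f m) (app g n)"
    unfolding tensor_lin_def Let_def using * by blast+
qed

lemma tensor_lin_pure:
  "lin f \<Longrightarrow> lin g \<Longrightarrow> src f = M \<Longrightarrow> src g = N \<Longrightarrow> m \<in> carrier M \<Longrightarrow> n \<in> carrier N \<Longrightarrow>
   app (tensor_lin S f g) (pure S M N m n) = pure S (tgt f) (tgt g) (app f m) (app g n)"
  using tensor_lin(4) by blast

lemma twist:
  assumes [simp]: "sm M" "sm N"
  defines "f \<equiv> Twist (SModT S) M N"
  shows "lin f" "src f = ten M N" "tgt f = ten N M"
    "m \<in> carrier M \<Longrightarrow> n \<in> carrier N \<Longrightarrow> app f (pure S M N m n) = pure S N M n m"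
proof -
  have "bilin M N (ten N M) (\<lambda>m n. pure S N M n m)"
    by (simp add: bilin_def pure_simps)
  note * = bilin_the_lin[OF this]
  have f: "f = the_lin S (ten M N) (ten N M) (\<lambda>h.
      \<forall>m \<in> carrier M. \<forall>n \<in> carrier N. h (pure S M N m n) = pure S N M n m)"
    by (simp add: f_def SModT_def cat.extend_def)
  show "lin f" "src f = ten M N" "tgt f = ten N M"
    "m \<in> carrier M \<Longrightarrow> n \<in> carrier N \<Longrightarrow> app f (pure S M N m n) = pure S N M n m"
    unfolding f using * by (simp_all only: scalars_simps)
qed

lemma left_unitor:
  assumes [simp]: "sm M"
  defines "f \<equiv> LUnit (SModT S) M"
  shows "lin f" "src f = ten I M" "tgt f = M"
    "s \<in> carrier S \<Longrightarrow> m \<in> carrier M \<Longrightarrow> app f (pure S I M s m) = s \<odot>\<^bsub>M\<^esub> m"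
proof -
  have "bilin I M M (\<lambda>s m. s \<odot>\<^bsub>M\<^esub> m)"
    by (simp add: bilin_def sm_smult_add sm_smult_smult m_comm)
  note * = bilin_the_lin[OF this]
  have f: "f = the_lin S (ten I M) M (\<lambda>h.
      \<forall>s \<in> carrier I. \<forall>m \<in> carrier M. h (pure S I M s m) = s \<odot>\<^bsub>M\<^esub> m)"
    by (simp add: f_def SModT_def cat.extend_def)
  show "lin f" "src f = ten I M" "tgt f = M"
    "s \<in> carrier S \<Longrightarrow> m \<in> carrier M \<Longrightarrow> app f (pure S I M s m) = s \<odot>\<^bsub>M\<^esub> m"
    unfolding f using * by (simp_all only: scalars_simps)
qed

lemma right_unitor:
  assumes [simp]: "sm M"
  defines "f \<equiv> RUnit (SModT S) M"
  shows "lin f" "src f = ten M I" "tgt f = M"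
    "s \<in> carrier S \<Longrightarrow> m \<in> carrier M \<Longrightarrow> app f (pure S M I m s) = s \<odot>\<^bsub>M\<^esub> m"
proof -
  have "bilin M I M (\<lambda>m s. s \<odot>\<^bsub>M\<^esub> m)"
    by (simp add: bilin_def sm_smult_add sm_smult_smult m_comm)
  note * = bilin_the_lin[OF this]
  have f: "f = the_lin S (ten M I) M (\<lambda>h.
      \<forall>m \<in> carrier M. \<forall>s \<in> carrier I. h (pure S M I m s) = s \<odot>\<^bsub>M\<^esub> m)"
    by (simp add: f_def SModT_def cat.extend_def)
  show "lin f" "src f = ten M I" "tgt f = M"
    "s \<in> carrier S \<Longrightarrow> m \<in> carrier M \<Longrightarrow> app f (pure S M I m s) = s \<odot>\<^bsub>M\<^esub> m"
    unfolding f using * by (simp_all only: scalars_simps)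
qed

lemma associator:
  assumes [simp]: "sm M" "sm N" "sm P"
  defines "f \<equiv> Assoc (SModT S) M N P"
  shows "lin f" "src f = ten (ten M N) P" "tgt f = ten M (ten N P)"
    "m \<in> carrier M \<Longrightarrow> n \<in> carrier N \<Longrightarrow> p \<in> carrier P \<Longrightarrow>
      app f (pure S (ten M N) P (pure S M N m n) p) = pure S M (ten N P) m (pure S N P n p)"
proof -
  have ex: "\<exists>f. lin f \<and> src f = ten (ten M N) P \<and> tgt f = ten M (ten N P) \<and>
    (\<forall>m \<in> carrier M. \<forall>n \<in> carrier N. \<forall>p \<in> carrier P.
       app f (pure S (ten M N) P (pure S M N m n) p) = pure S M (ten N P) m (pure S N P n p))"
    by (rule trilin_lift) (simp_all add: bilin_def pure_simps)
  have "g = h" if "lin g" "lin h" "src g = ten (ten M N) P" "src h = ten (ten M N) P" "tgt g = ten M (ten N P)" "tgt h = ten M (ten N P)"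
    "\<forall>m \<in> carrier M. \<forall>n \<in> carrier N. \<forall>p \<in> carrier P.
      app g (pure S (ten M N) P (pure S M N m n) p) = pure S M (ten N P) m (pure S N P n p)"
    "\<forall>m \<in> carrier M. \<forall>n \<in> carrier N. \<forall>p \<in> carrier P.
      app h (pure S (ten M N) P (pure S M N m n) p) = pure S M (ten N P) m (pure S N P n p)" for g h
    using that by (intro tensor_eqI3[of g h M N P]) simp_all
  note * = the_lin_props[OF ex this]
  have f: "f = the_lin S (ten (ten M N) P) (ten M (ten N P)) (\<lambda>h.
     \<forall>m \<in> carrier M. \<forall>n \<in> carrier N. \<forall>p \<in> carrier P.
       h (pure S (ten M N) P (pure S M N m n) p) = pure S M (ten N P) m (pure S N P n p))"
    by (simp add: f_def SModT_def cat.extend_def)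
  show "lin f" "src f = ten (ten M N) P" "tgt f = ten M (ten N P)"
    "m \<in> carrier M \<Longrightarrow> n \<in> carrier N \<Longrightarrow> p \<in> carrier P \<Longrightarrow>
      app f (pure S (ten M N) P (pure S M N m n) p) = pure S M (ten N P) m (pure S N P n p)"
    unfolding f using * by blast+
qed

text \<open>\<open>trilin_lift\<close> produces maps out of a product bracketed to the left. The map
  is therefore lifted from (N \<otimes> P) \<otimes> M and composed with the twist of M and N
  \<otimes> P.\<close>

lemma assoc_inv:
  assumes [simp]: "sm M" "sm N" "sm P"
  shows "lin (assoc_inv M N P)" "src (assoc_inv M N P) = ten M (ten N P)"
    "tgt (assoc_inv M N P) = ten (ten M N) P"
    "m \<in> carrier M \<Longrightarrow> n \<in> carrier N \<Longrightarrow> p \<in> carrier P \<Longrightarrow>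
      app (assoc_inv M N P) (pure S M (ten N P) m (pure S N P n p)) = pure S (ten M N) P (pure S M N m n) p"
proof -
  have "\<exists>f. lin f \<and> src f = ten (ten N P) M \<and> tgt f = ten (ten M N) P \<and>
    (\<forall>n \<in> carrier N. \<forall>p \<in> carrier P. \<forall>m \<in> carrier M.
       app f (pure S (ten N P) M (pure S N P n p) m) = pure S (ten M N) P (pure S M N m n) p)"
    by (rule trilin_lift) (simp_all add: bilin_def pure_simps)
  then obtain f where f: "lin f" "src f = ten (ten N P) M" "tgt f = ten (ten M N) P"
    "\<And>m n p. n \<in> carrier N \<Longrightarrow> p \<in> carrier P \<Longrightarrow> m \<in> carrier M \<Longrightarrow>
       app f (pure S (ten N P) M (pure S N P n p) m) = pure S (ten M N) P (pure S M N m n) p" by blast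
  have ex: "\<exists>f. lin f \<and> src f = ten M (ten N P) \<and> tgt f = ten (ten M N) P \<and>
    (\<forall>m \<in> carrier M. \<forall>n \<in> carrier N. \<forall>p \<in> carrier P.
       app f (pure S M (ten N P) m (pure S N P n p)) = pure S (ten M N) P (pure S M N m n) p)"
    by (rule exI[of _ "f \<Zspot> Twist (SModT S) M (ten N P)"]) (simp add: f twist)
  have "g = h" if "lin g" "lin h" "src g = ten M (ten N P)" "src h = ten M (ten N P)" "tgt g = ten (ten M N) P" "tgt h = ten (ten M N) P"
    "\<forall>m \<in> carrier M. \<forall>n \<in> carrier N. \<forall>p \<in> carrier P.
      app g (pure S M (ten N P) m (pure S N P n p)) = pure S (ten M N) P (pure S M N m n) p"
    "\<forall>m \<in> carrier M. \<forall>n \<in> carrier N. \<forall>p \<in> carrier P.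
      app h (pure S M (ten N P) m (pure S N P n p)) = pure S (ten M N) P (pure S M N m n) p" for g h
    using that by (intro tensor_eqI3'[of g h M N P]) simp_all
  note * = the_lin_props[OF ex this]
  show "lin (assoc_inv M N P)" "src (assoc_inv M N P) = ten M (ten N P)"
    "tgt (assoc_inv M N P) = ten (ten M N) P"
    "m \<in> carrier M \<Longrightarrow> n \<in> carrier N \<Longrightarrow> p \<in> carrier P \<Longrightarrow>
      app (assoc_inv M N P) (pure S M (ten N P) m (pure S N P n p)) = pure S (ten M N) P (pure S M N m n) p"
    unfolding assoc_inv_def using * by blast+
qed

lemma unit_inv:
  assumes [simp]: "sm M"
  shows "lin (lunit_inv M)" "src (lunit_inv M) = M" "tgt (lunit_inv M) = ten I M"
    "m \<in> carrier M \<Longrightarrow> app (lunit_inv M) m = pure S I M \<one> m"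
    "lin (runit_inv M)" "src (runit_inv M) = M" "tgt (runit_inv M) = ten M I"
    "m \<in> carrier M \<Longrightarrow> app (runit_inv M) m = pure S M I m \<one>"
proof -
  show "lin (lunit_inv M)" unfolding lunit_inv_def by (rule linI) (simp_all add: pure_simps)
  show "lin (runit_inv M)" unfolding runit_inv_def by (rule linI) (simp_all add: pure_simps)
qed (simp_all add: lunit_inv_def runit_inv_def)

lemma std_tensor: "semimod_tensor S (tensor S) (pure S) (tensor_lin S) (Assoc (SModT S)) assoc_inv
   (LUnit (SModT S)) lunit_inv (RUnit (SModT S)) runit_inv (Twist (SModT S))"
proof (intro semimod_tensor.intro semimod_tensor_axioms.intro semimod_cat_axioms)
  fix M N z Q
  show "sm M \<Longrightarrow> sm N \<Longrightarrow> z \<in> carrier (ten M N) \<Longrightarrow> Q \<zero>\<^bsub>ten M N\<^esub> \<Longrightarrow>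
       (\<And>m n. m \<in> carrier M \<Longrightarrow> n \<in> carrier N \<Longrightarrow> Q (pure S M N m n)) \<Longrightarrow>
       (\<And>u v. u \<in> carrier (ten M N) \<Longrightarrow> v \<in> carrier (ten M N) \<Longrightarrow> Q u \<Longrightarrow> Q v \<Longrightarrow>
         Q (u \<oplus>\<^bsub>ten M N\<^esub> v)) \<Longrightarrow> Q z"
    by (rule tensor_induct)
qed (simp_all add: pure_simps tensor_lin(1-3) tensor_lin_pure twist left_unitor right_unitor associator assoc_inv unit_inv)

text \<open>Writing M \<boxtimes> N for N \<otimes> M, the product (M \<boxtimes> N) \<boxtimes> P
  is P \<otimes> (N \<otimes> M). Hence reversal exchanges the associator with its inverse and the
  left unitors with the right ones.\<close>

lemma rev_tensor: "semimod_tensor S (\<lambda>M N. tensor S N M) (\<lambda>M N m n. pure S N M n m)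
   (\<lambda>f g. tensor_lin S g f) (\<lambda>M N P. assoc_inv P N M) (\<lambda>M N P. Assoc (SModT S) P N M)
   (RUnit (SModT S)) runit_inv (LUnit (SModT S)) lunit_inv (\<lambda>M N. Twist (SModT S) N M)"
proof (intro semimod_tensor.intro semimod_tensor_axioms.intro semimod_cat_axioms)
  fix M N z Q
  show "sm M \<Longrightarrow> sm N \<Longrightarrow> z \<in> carrier (ten N M) \<Longrightarrow> Q \<zero>\<^bsub>ten N M\<^esub> \<Longrightarrow>
       (\<And>m n. m \<in> carrier M \<Longrightarrow> n \<in> carrier N \<Longrightarrow> Q (pure S N M n m)) \<Longrightarrow>
       (\<And>u v. u \<in> carrier (ten N M) \<Longrightarrow> v \<in> carrier (ten N M) \<Longrightarrow> Q u \<Longrightarrow> Q v \<Longrightarrow>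
         Q (u \<oplus>\<^bsub>ten N M\<^esub> v)) \<Longrightarrow> Q z"
    by (rule tensor_induct[of N M])
qed (simp_all add: pure_simps tensor_lin(1-3) tensor_lin_pure twist left_unitor right_unitor associator assoc_inv unit_inv)

end

section \<open>Structured and Eilenberg-Moore categories\<close>

lemma category_structured_cat:
  assumes "category C" and U: "\<And>X. X \<in> A \<Longrightarrow> U X \<in> Ob C"
    and Id: "\<And>X. X \<in> A \<Longrightarrow> P X X (Id C (U X))"
    and Comp: "\<And>X Y Z f g. X \<in> A \<Longrightarrow> Y \<in> A \<Longrightarrow> Z \<in> A \<Longrightarrow> f \<in> Hom C (U X) (U Y) \<Longrightarrow>
      g \<in> Hom C (U Y) (U Z) \<Longrightarrow> P X Y f \<Longrightarrow> P Y Z g \<Longrightarrow> P X Z (g \<cdot>\<^bsub>C\<^esub> f)"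
  shows "category (structured_cat C A U P)"
proof -
  interpret category C by (rule assms)
  show ?thesis
  proof
    fix X assume "X \<in> Ob (structured_cat C A U P)"
    then show "Id (structured_cat C A U P) X \<in> Hom (structured_cat C A U P) X X"
      using U Id Id_Hom by (simp add: structured_cat_def Hom_def)
  next
    fix f g X Y Z
    assume "f \<in> Hom (structured_cat C A U P) X Y" "g \<in> Hom (structured_cat C A U P) Y Z"
    then obtain f' g' where fg: "f = (X, f', Y)" "g = (Y, g', Z)" "X \<in> A" "Y \<in> A" "Z \<in> A"
      "f' \<in> Hom C (U X) (U Y)" "g' \<in> Hom C (U Y) (U Z)" "P X Y f'" "P Y Z g'"
      by (auto simp: structured_cat_def Hom_def[of "\<lparr>Ob = A, Ar = _, Dom = _, Cod = _, Id = _, Comp = _\<rparr>"])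
    then show "g \<cdot>\<^bsub>structured_cat C A U P\<^esub> f \<in> Hom (structured_cat C A U P) X Z"
      using Comp[of X Y Z f' g'] Comp_Hom[of f' "U X" "U Y" g' "U Z"]
      by (simp add: structured_cat_def Hom_def[of "\<lparr>Ob = A, Ar = _, Dom = _, Cod = _, Id = _, Comp = _\<rparr>"])
  qed (auto simp: structured_cat_def Hom_def[of "\<lparr>Ob = A, Ar = _, Dom = _, Cod = _, Id = _, Comp = _\<rparr>"]
      intro: Id_left Id_right Comp_assoc)
qed

text \<open>Gives equality of categories, not just an isomorphism. The two conditions on morphisms
  are compared only on well-typed arrows, where equations of composites can be read on
  elements.\<close>

lemma structured_cat_cong:
  assumes "Hom C = Hom C'" "Id C = Id C'" "Comp C = Comp C'" "A = A'"
    and "\<And>X Y f. X \<in> A \<Longrightarrow> Y \<in> A \<Longrightarrow> f \<in> Hom C (U X) (U Y) \<Longrightarrow> P X Y f \<longleftrightarrow> P' X Y f"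
  shows "structured_cat C A U P = structured_cat C' A' U P'"
  unfolding structured_cat_def using assms by (auto simp: case_prod_beta)

lemma isomorphic_categories_refl: "category C \<Longrightarrow> isomorphic_categories C C"
  unfolding isomorphic_categories_def
  by (intro conjI exI[of _ id_fctr])
    (auto simp: id_fctr_def is_functor_def Hom_def category.Dom_Ob category.Cod_Ob)

text \<open>Bimonad structures depend on the underlying category but not on its tensor data; this
  lets those over the reversed product be read as structures over \<open>SModT S\<close>.\<close>

lemma bimonad_structures_cong:
  assumes "Ob C = Ob C'" "Ar C = Ar C'" "Dom C = Dom C'" "Cod C = Cod C'" "Id C = Id C'" "Comp C = Comp C'"
  shows "bimonad_structures C = bimonad_structures C'"
  using assms
  by (intro ext) (simp add: bimonad_structures_def monad_def comonad_def monad_morphism_def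
      comonad_morphism_def nat_trans_def is_functor_def Hom_def hcomp_def id_trans_def)

text \<open>The square for a composite is obtained by pasting the two given squares, with
  functoriality splitting F(gf).\<close>

lemma category_EM_comodules:
  assumes C: "category C" and F: "is_functor C C F"
  shows "category (EM_comodules C F d c)"
  unfolding EM_comodules_def
proof (rule category_structured_cat[OF C], goal_cases)
  case (1 X)
  then show ?case by auto
next
  case (2 X)
  then obtain M h where X: "X = (M, h)" "M \<in> Ob C" "h \<in> Hom C M (FOb F M)" by auto
  then show ?case
    using F category.Id_left[OF C X(3)] category.Id_right[OF C X(3)] by (simp add: is_functor_def)
next
  case (3 X Y Z f g)
  obtain M h N k P l where XYZ: "X = (M, h)" "Y = (N, k)" "Z = (P, l)" by (metis prod.exhaust)
  have h: "h \<in> Hom C M (FOb F M)" "k \<in> Hom C N (FOb F N)" "l \<in> Hom C P (FOb F P)"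
    and f: "f \<in> Hom C M N" and g: "g \<in> Hom C N P" and e: "k \<cdot>\<^bsub>C\<^esub> f = FAr F f \<cdot>\<^bsub>C\<^esub> h" "l \<cdot>\<^bsub>C\<^esub> g = FAr F g \<cdot>\<^bsub>C\<^esub> k"
    using 3 by (auto simp: XYZ)
  have Ff: "FAr F f \<in> Hom C (FOb F M) (FOb F N)" "FAr F g \<in> Hom C (FOb F N) (FOb F P)"
    and Fgf: "FAr F (g \<cdot>\<^bsub>C\<^esub> f) = FAr F g \<cdot>\<^bsub>C\<^esub> FAr F f"
    using F f g unfolding is_functor_def Hom_def by auto
  have "l \<cdot>\<^bsub>C\<^esub> (g \<cdot>\<^bsub>C\<^esub> f) = FAr F g \<cdot>\<^bsub>C\<^esub> (k \<cdot>\<^bsub>C\<^esub> f)"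
    using e(2) category.Comp_assoc[OF C f g h(3)] category.Comp_assoc[OF C f h(2) Ff(2)] by simp
  also have "\<dots> = FAr F (g \<cdot>\<^bsub>C\<^esub> f) \<cdot>\<^bsub>C\<^esub> h"
    unfolding e(1) Fgf by (rule category.Comp_assoc[OF C h(1) Ff, symmetric])
  finally show ?case by (simp add: XYZ)
qed

lemma category_EM_modules:
  assumes C: "category C" and F: "is_functor C C F"
  shows "category (EM_modules C F m e)"
  unfolding EM_modules_def
proof (rule category_structured_cat[OF C], goal_cases)
  case (1 X)
  then show ?case by auto
next
  case (2 X)
  then obtain M h where X: "X = (M, h)" "M \<in> Ob C" "h \<in> Hom C (FOb F M) M" by auto
  then show ?case
    using F category.Id_left[OF C X(3)] category.Id_right[OF C X(3)] by (simp add: is_functor_def)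
next
  case (3 X Y Z f g)
  obtain M h N k P l where XYZ: "X = (M, h)" "Y = (N, k)" "Z = (P, l)" by (metis prod.exhaust)
  have h: "h \<in> Hom C (FOb F M) M" "k \<in> Hom C (FOb F N) N" "l \<in> Hom C (FOb F P) P"
    and f: "f \<in> Hom C M N" and g: "g \<in> Hom C N P" and e: "f \<cdot>\<^bsub>C\<^esub> h = k \<cdot>\<^bsub>C\<^esub> FAr F f" "g \<cdot>\<^bsub>C\<^esub> k = l \<cdot>\<^bsub>C\<^esub> FAr F g"
    using 3 by (auto simp: XYZ)
  have Ff: "FAr F f \<in> Hom C (FOb F M) (FOb F N)" "FAr F g \<in> Hom C (FOb F N) (FOb F P)"
    and Fgf: "FAr F (g \<cdot>\<^bsub>C\<^esub> f) = FAr F g \<cdot>\<^bsub>C\<^esub> FAr F f"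
    using F f g unfolding is_functor_def Hom_def by auto
  have "(g \<cdot>\<^bsub>C\<^esub> f) \<cdot>\<^bsub>C\<^esub> h = g \<cdot>\<^bsub>C\<^esub> (k \<cdot>\<^bsub>C\<^esub> FAr F f)"
    using e(1) category.Comp_assoc[OF C h(1) f g] by simp
  also have "\<dots> = (l \<cdot>\<^bsub>C\<^esub> FAr F g) \<cdot>\<^bsub>C\<^esub> FAr F f"
    unfolding e(2)[symmetric] by (rule category.Comp_assoc[OF C Ff(1) h(2) g, symmetric])
  also have "\<dots> = l \<cdot>\<^bsub>C\<^esub> FAr F (g \<cdot>\<^bsub>C\<^esub> f)"
    unfolding Fgf by (rule category.Comp_assoc[OF C Ff h(3)])
  finally show ?case by (simp add: XYZ)
qed

text \<open>The second category is structured over a category that is itself structured over \<open>C\<close>, so its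
  arrows carry two layers of labels.\<close>

lemma isomorphic_structured_twice:
  fixes C :: "('o, 'a, 'x) cat_scheme" and U :: "'s \<Rightarrow> 'o" and U' :: "'t \<Rightarrow> 'r" and U0 :: "'r \<Rightarrow> 'o"
  assumes D_def: "D = structured_cat C A0 U0 P0"
    and cats: "category (structured_cat C A U P)" "category (structured_cat D A' U' P')"
    and \<alpha>: "\<And>X. X \<in> A \<Longrightarrow> \<alpha> X \<in> A'" "\<And>X. X \<in> A \<Longrightarrow> \<beta> (\<alpha> X) = X"
    and \<beta>: "\<And>Y. Y \<in> A' \<Longrightarrow> \<beta> Y \<in> A" "\<And>Y. Y \<in> A' \<Longrightarrow> \<alpha> (\<beta> Y) = Y"
    and U: "\<And>X. X \<in> A \<Longrightarrow> U0 (U' (\<alpha> X)) = U X"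
    and P: "\<And>X Y f. X \<in> A \<Longrightarrow> Y \<in> A \<Longrightarrow>
      f \<in> Hom C (U X) (U Y) \<and> P X Y f \<longleftrightarrow>
      (U' (\<alpha> X), f, U' (\<alpha> Y)) \<in> Ar D \<and> P' (\<alpha> X) (\<alpha> Y) (U' (\<alpha> X), f, U' (\<alpha> Y))"
  shows "isomorphic_categories (structured_cat C A U P) (structured_cat D A' U' P')"
proof -
  let ?F = "\<lparr>FOb = \<alpha>, FAr = (\<lambda>(X, f, Y). (\<alpha> X, (U' (\<alpha> X), f, U' (\<alpha> Y)), \<alpha> Y))\<rparr>"
  let ?G = "\<lparr>FOb = \<beta>, FAr = (\<lambda>(X, f, Y). (\<beta> X, fst (snd f), \<beta> Y))\<rparr>"
  have D: "Hom D x y = {(x, f, y) |f. (x, f, y) \<in> Ar D}" "(x, f, y) \<in> Ar D \<Longrightarrow> Dom D (x, f, y) = x"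
    "(x, f, y) \<in> Ar D \<Longrightarrow> Cod D (x, f, y) = y" "Id D x = (x, Id C (U0 x), x)"
    "(y, g, z) \<cdot>\<^bsub>D\<^esub> (x, f, y) = (x, g \<cdot>\<^bsub>C\<^esub> f, z)" for x y z f g
    by (auto simp: D_def structured_cat_def Hom_def)
  \<comment> \<open>The inner labels of such an arrow are forced by the outer ones, so forgetting
    them loses nothing.\<close>
  have P': "fst (snd f) \<in> Hom C (U (\<beta> X)) (U (\<beta> Y)) \<and> P (\<beta> X) (\<beta> Y) (fst (snd f)) \<and> f = (U' X, fst (snd f), U' Y)"
    if h: "X \<in> A'" "Y \<in> A'" "f \<in> Hom D (U' X) (U' Y)" "P' X Y f" for X Y f
  proof -
    obtain f' where f: "f = (U' X, f', U' Y)" "(U' X, f', U' Y) \<in> Ar D" using h(3) unfolding D by blast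
    show ?thesis using P[OF \<beta>(1) \<beta>(1), of X Y f'] h f \<beta>(2) by simp
  qed
  have F: "is_functor (structured_cat C A U P) (structured_cat D A' U' P') ?F"
    using P \<alpha>(1) U unfolding is_functor_def structured_cat_def[of C A U P] structured_cat_def[of D]
    by (auto simp: D Hom_def[of "\<lparr>Ob = A', Ar = _, Dom = _, Cod = _, Id = _, Comp = _\<rparr>"])
  have G: "is_functor (structured_cat D A' U' P') (structured_cat C A U P) ?G"
  proof -
    have id: "U0 (U' Y) = U (\<beta> Y)" if "Y \<in> A'" for Y using that U[of "\<beta> Y"] \<beta> by simp
    have comp: "fst (snd (g \<cdot>\<^bsub>D\<^esub> f)) = fst (snd g) \<cdot>\<^bsub>C\<^esub> fst (snd f)"
      if "f \<in> Hom D x y" "g \<in> Hom D y z" for f g x y z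
      using that unfolding D by (auto simp: D)
    show ?thesis
      unfolding is_functor_def structured_cat_def[of C A U P] structured_cat_def[of D]
      using P' \<beta>(1) id comp
      by (auto simp: D(4) Hom_def[of "\<lparr>Ob = A, Ar = _, Dom = _, Cod = _, Id = _, Comp = _\<rparr>"])
  qed
  have inv: "f = (U' X, fst (snd f), U' Y)" if "(X, f, Y) \<in> Ar (structured_cat D A' U' P')" for X Y f
    using P'[of X Y f] that by (simp add: structured_cat_def[of D])
  show ?thesis
    unfolding isomorphic_categories_def
  proof (intro conjI cats exI[of _ ?F] exI[of _ ?G] F G ballI)
    fix X assume "X \<in> Ob (structured_cat C A U P)"
    then show "FOb ?G (FOb ?F X) = X" using \<alpha> by (simp add: structured_cat_def)
  next
    fix f assume "f \<in> Ar (structured_cat C A U P)"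
    then show "FAr ?G (FAr ?F f) = f" using \<alpha> by (auto simp: structured_cat_def)
  next
    fix Y assume "Y \<in> Ob (structured_cat D A' U' P')"
    then show "FOb ?F (FOb ?G Y) = Y" using \<beta> by (simp add: structured_cat_def)
  next
    fix f assume "f \<in> Ar (structured_cat D A' U' P')"
    moreover obtain X f' Y where f: "f = (X, f', Y)" by (metis prod.exhaust)
    ultimately have XY: "X \<in> A'" "Y \<in> A'" and f': "f' = (U' X, fst (snd f'), U' Y)"
      using inv[of X f' Y] by (simp_all add: structured_cat_def[of D])
    have "FAr ?F (FAr ?G f) = (X, (U' X, fst (snd f'), U' Y), Y)" using \<beta>(2) XY f by simp
    then show "FAr ?F (FAr ?G f) = f" unfolding f'[symmetric] f .
  qed
qed

section \<open>Bisemialgebras as bimonoids\<close>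

context semimod_cat
begin

interpretation std: semimod_tensor S "tensor S" "pure S" "tensor_lin S" "Assoc (SModT S)" assoc_inv
  "LUnit (SModT S)" lunit_inv "RUnit (SModT S)" runit_inv "Twist (SModT S)"
  by (rule std_tensor)

lemma std_V: "std.V = SModT S"
  unfolding std.V_def by (simp add: SModT_def cat.extend_def)

lemma Hom_SModT: "Hom (SModT S) = Hom (SMod S)"
  by (intro ext) (simp add: Hom_def)

lemma inv_arr_SModT: "inv_arr (SModT S) = inv_arr (SMod S)"
  by (intro ext) (simp add: inv_arr_def Hom_SModT)

lemmas middle_SModT [simp] = std.middle_V[unfolded std_V]

lemma typed_bimonoid:
  assumes "is_bimonoid (SModT S) (B, \<mu>, \<eta>, \<Delta>, \<epsilon>) \<or> bisemialgebra S (B, \<mu>, \<eta>, \<Delta>, \<epsilon>)"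
  shows "sm B" "lin \<mu>" "src \<mu> = ten B B" "tgt \<mu> = B" "lin \<eta>" "src \<eta> = I" "tgt \<eta> = B"
    "lin \<Delta>" "src \<Delta> = B" "tgt \<Delta> = ten B B" "lin \<epsilon>" "src \<epsilon> = B" "tgt \<epsilon> = I"
  using assms by (auto simp: is_monoid_def is_comonoid_def Hom_SModT)

text \<open>The product (a \<otimes> b)(c \<otimes> d) = ac \<otimes> bd interchanges the middle
  factors and then applies \<mu> \<otimes> \<mu>. In this form multiplicativity of \<Delta> is the
  bimonoid equation.\<close>

lemma square_mult_eq:
  assumes [simp]: "sm B" "lin \<mu>" "src \<mu> = ten B B" "tgt \<mu> = B"
  shows "square_mult S B \<mu> = tensor_lin S \<mu> \<mu> \<Zspot> middle (SModT S) B B B B"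
  unfolding square_mult_def
proof (rule the_lin_eqI)
  fix g assume g: "lin g" "src g = ten (ten B B) (ten B B)" "tgt g = ten B B"
    "\<forall>a \<in> carrier B. \<forall>b \<in> carrier B. \<forall>c \<in> carrier B. \<forall>d \<in> carrier B.
         app g (pure S (ten B B) (ten B B) (pure S B B a b) (pure S B B c d)) =
         pure S B B (app \<mu> (pure S B B a c)) (app \<mu> (pure S B B b d))"
  then show "g = tensor_lin S \<mu> \<mu> \<Zspot> middle (SModT S) B B B B"
    by (intro std.tens_eqI_square[of _ _ B B B B]) simp_all
qed simp_all

lemma square_unit_eq:
  assumes [simp]: "sm B" "lin \<eta>" "src \<eta> = I" "tgt \<eta> = B"
  shows "square_unit S B \<eta> = tensor_lin S \<eta> \<eta> \<Zspot> lunit_inv I"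
  unfolding square_unit_def
proof (rule the_lin_eqI)
  fix g assume g: "lin g" "src g = I" "tgt g = ten B B" "app g \<one> = pure S B B (app \<eta> \<one>) (app \<eta> \<one>)"
  then show "g = tensor_lin S \<eta> \<eta> \<Zspot> lunit_inv I"
    by (intro arr_scalars_eqI) simp_all
qed simp_all

lemma scalars_mult_eq: "scalars_mult S = LUnit (SModT S) I"
  unfolding scalars_mult_def
proof (rule the_lin_eqI)
  fix g assume g: "lin g" "src g = ten I I" "tgt g = I"
    "\<forall>s \<in> carrier S. \<forall>t \<in> carrier S. app g (pure S I I s t) = s \<otimes> t"
  then show "g = LUnit (SModT S) I" by (intro std.tens_eqI[of _ _ I I]) simp_all
qed simp_all

text \<open>Either side implies that all maps have the right sources and targets, so the equivalence
  only has to be proved for typed data.\<close>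

lemma bisemialgebra_iff: "bisemialgebra S X \<longleftrightarrow> is_bimonoid (SModT S) X"
proof -
  obtain B \<mu> \<eta> \<Delta> \<epsilon> where X: "X = (B, \<mu>, \<eta>, \<Delta>, \<epsilon>)" by (metis prod.exhaust)
  have "bisemialgebra S (B, \<mu>, \<eta>, \<Delta>, \<epsilon>) \<longleftrightarrow> is_bimonoid (SModT S) (B, \<mu>, \<eta>, \<Delta>, \<epsilon>)"
    if typed [simp]: "sm B" "lin \<mu>" "src \<mu> = ten B B" "tgt \<mu> = B" "lin \<eta>" "src \<eta> = I" "tgt \<eta> = B"
    "lin \<Delta>" "src \<Delta> = B" "tgt \<Delta> = ten B B" "lin \<epsilon>" "src \<epsilon> = B" "tgt \<epsilon> = I"
    unfolding std.is_bimonoid_iff[OF typed, unfolded std_V]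
    by (auto simp: semialgebra_morphism_def square_mult_eq square_unit_eq scalars_mult_eq)
  then show ?thesis using typed_bimonoid X by metis
qed

lemma semialgebra_morphism_iff:
  assumes "f \<in> Hom (SMod S) A A'" and "lin \<mu>" "src \<mu> = ten A A" "tgt \<mu> = A" "lin \<eta>" "src \<eta> = I" "tgt \<eta> = A"
    "lin \<mu>'" "src \<mu>' = ten A' A'" "tgt \<mu>' = A'" "lin \<eta>'" "src \<eta>' = I" "tgt \<eta>' = A'"
  shows "semialgebra_morphism S A \<mu> \<eta> A' \<mu>' \<eta>' f \<longleftrightarrow> monoid_morphism (SModT S) \<mu> \<eta> \<mu>' \<eta>' f"
proof -
  have "sm A" "sm A'" using assms lin_semimodule by fastforce+
  then show ?thesis using assms
    by (simp add: semialgebra_morphism_def monoid_morphism_def std.tens_eq_iff[of _ _ A A] std.arr_scalars_eq_iff)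
qed

lemma semicoalgebra_morphism_iff:
  assumes "f \<in> Hom (SMod S) A A'" and "lin \<Delta>" "src \<Delta> = A" "tgt \<Delta> = ten A A" "lin \<epsilon>" "src \<epsilon> = A" "tgt \<epsilon> = I"
    "lin \<Delta>'" "src \<Delta>' = A'" "tgt \<Delta>' = ten A' A'" "lin \<epsilon>'" "src \<epsilon>' = A'" "tgt \<epsilon>' = I"
  shows "semicoalgebra_morphism S A \<Delta> \<epsilon> A' \<Delta>' \<epsilon>' f \<longleftrightarrow> comonoid_morphism (SModT S) \<Delta> \<epsilon> \<Delta>' \<epsilon>' f"
  using assms by (simp add: semicoalgebra_morphism_def comonoid_morphism_def std.arr_eq_iff[of _ _ A])

text \<open>The isomorphism in question is an equality: the objects agree by
  \<open>bisemialgebra_iff\<close>, and conditions on pure elements agree with equations of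
  arrows.\<close>

lemma SBialg_eq: "SBialg S = Bimonoid_cat (SModT S)"
  unfolding SBialg_def Bimonoid_cat_def
proof (rule structured_cat_cong)
  fix X Y f assume "X \<in> {B. bisemialgebra S B}" "Y \<in> {B. bisemialgebra S B}" "f \<in> Hom (SMod S) (fst X) (fst Y)"
  moreover obtain B \<mu> \<eta> \<Delta> \<epsilon> B' \<mu>' \<eta>' \<Delta>' \<epsilon>' where XY: "X = (B, \<mu>, \<eta>, \<Delta>, \<epsilon>)" "Y = (B', \<mu>', \<eta>', \<Delta>', \<epsilon>')"
    by (metis prod.exhaust)
  ultimately have b: "bisemialgebra S (B, \<mu>, \<eta>, \<Delta>, \<epsilon>)" "bisemialgebra S (B', \<mu>', \<eta>', \<Delta>', \<epsilon>')"
    and f: "f \<in> Hom (SMod S) B B'" by (simp_all del: bisemialgebra.simps)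
  note t = typed_bimonoid[OF disjI2[OF b(1)]] typed_bimonoid[OF disjI2[OF b(2)]]
  show "(case X of (B, \<mu>, \<eta>, \<Delta>, \<epsilon>) \<Rightarrow> \<lambda>(B', \<mu>', \<eta>', \<Delta>', \<epsilon>') f.
        semialgebra_morphism S B \<mu> \<eta> B' \<mu>' \<eta>' f \<and> semicoalgebra_morphism S B \<Delta> \<epsilon> B' \<Delta>' \<epsilon>' f) Y f \<longleftrightarrow>
      (case X of (B, \<mu>, \<eta>, \<Delta>, \<epsilon>) \<Rightarrow> \<lambda>(B', \<mu>', \<eta>', \<Delta>', \<epsilon>') f.
        monoid_morphism (SModT S) \<mu> \<eta> \<mu>' \<eta>' f \<and> comonoid_morphism (SModT S) \<Delta> \<epsilon> \<Delta>' \<epsilon>' f) Y f"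
    using f t by (simp add: XY semialgebra_morphism_iff[OF f] semicoalgebra_morphism_iff[OF f] del: Hom_SMod)
qed (simp_all add: Hom_SModT ext[OF bisemialgebra_iff] del: Hom_SMod)

lemma category_SBialg: "category (SBialg S)"
  unfolding SBialg_def
proof (rule category_structured_cat)
  show "category (SMod S)" by (rule category_SMod)
  fix X assume "X \<in> {B. bisemialgebra S B}"
  moreover obtain B \<mu> \<eta> \<Delta> \<epsilon> where X: "X = (B, \<mu>, \<eta>, \<Delta>, \<epsilon>)" by (metis prod.exhaust)
  ultimately have b: "bisemialgebra S (B, \<mu>, \<eta>, \<Delta>, \<epsilon>)" by simp
  note [simp] = typed_bimonoid[OF disjI2[OF b]]
  show "fst X \<in> Ob (SMod S)" by (simp add: X)
  show "(case X of (B, \<mu>, \<eta>, \<Delta>, \<epsilon>) \<Rightarrow> \<lambda>(B', \<mu>', \<eta>', \<Delta>', \<epsilon>') f.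
        semialgebra_morphism S B \<mu> \<eta> B' \<mu>' \<eta>' f \<and> semicoalgebra_morphism S B \<Delta> \<epsilon> B' \<Delta>' \<epsilon>' f) X (idn (fst X))"
    by (simp add: X semialgebra_morphism_def semicoalgebra_morphism_def)
next
  fix X Y Z f g
  assume "X \<in> {B. bisemialgebra S B}" "Y \<in> {B. bisemialgebra S B}" "Z \<in> {B. bisemialgebra S B}"
    and fg: "f \<in> Hom (SMod S) (fst X) (fst Y)" "g \<in> Hom (SMod S) (fst Y) (fst Z)"
    and "(case X of (B, \<mu>, \<eta>, \<Delta>, \<epsilon>) \<Rightarrow> \<lambda>(B', \<mu>', \<eta>', \<Delta>', \<epsilon>') f.
        semialgebra_morphism S B \<mu> \<eta> B' \<mu>' \<eta>' f \<and> semicoalgebra_morphism S B \<Delta> \<epsilon> B' \<Delta>' \<epsilon>' f) Y f"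
      "(case Y of (B, \<mu>, \<eta>, \<Delta>, \<epsilon>) \<Rightarrow> \<lambda>(B', \<mu>', \<eta>', \<Delta>', \<epsilon>') f.
        semialgebra_morphism S B \<mu> \<eta> B' \<mu>' \<eta>' f \<and> semicoalgebra_morphism S B \<Delta> \<epsilon> B' \<Delta>' \<epsilon>' f) Z g"
  moreover obtain B \<mu> \<eta> \<Delta> \<epsilon> B' \<mu>' \<eta>' \<Delta>' \<epsilon>' B'' \<mu>'' \<eta>'' \<Delta>'' \<epsilon>'' where
    XYZ: "X = (B, \<mu>, \<eta>, \<Delta>, \<epsilon>)" "Y = (B', \<mu>', \<eta>', \<Delta>', \<epsilon>')" "Z = (B'', \<mu>'', \<eta>'', \<Delta>'', \<epsilon>'')"
    by (metis prod.exhaust)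
  ultimately have b: "bisemialgebra S (B, \<mu>, \<eta>, \<Delta>, \<epsilon>)" "bisemialgebra S (B', \<mu>', \<eta>', \<Delta>', \<epsilon>')"
      "bisemialgebra S (B'', \<mu>'', \<eta>'', \<Delta>'', \<epsilon>'')"
    and f: "lin f" "src f = B" "tgt f = B'" "lin g" "src g = B'" "tgt g = B''"
    and m: "semialgebra_morphism S B \<mu> \<eta> B' \<mu>' \<eta>' f" "semicoalgebra_morphism S B \<Delta> \<epsilon> B' \<Delta>' \<epsilon>' f"
      "semialgebra_morphism S B' \<mu>' \<eta>' B'' \<mu>'' \<eta>'' g" "semicoalgebra_morphism S B' \<Delta>' \<epsilon>' B'' \<Delta>'' \<epsilon>'' g"
    by (simp_all del: bisemialgebra.simps)
  note [simp] = f typed_bimonoid[OF disjI2[OF b(1)]] typed_bimonoid[OF disjI2[OF b(2)]] typed_bimonoid[OF disjI2[OF b(3)]]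
  \<comment> \<open>Functoriality of the tensor product is needed at \<Delta>(a), which need not be
    pure.\<close>
  have "app (tensor_lin S g g) (app (tensor_lin S f f) z) = app (tensor_lin S (g \<Zspot> f) (g \<Zspot> f)) z"
    if "z \<in> carrier (ten B B)" for z
    using arg_cong[OF std.tarr_comp[of f f g g], of "\<lambda>h. app h z"] that by simp
  then show "(case X of (B, \<mu>, \<eta>, \<Delta>, \<epsilon>) \<Rightarrow> \<lambda>(B', \<mu>', \<eta>', \<Delta>', \<epsilon>') f.
        semialgebra_morphism S B \<mu> \<eta> B' \<mu>' \<eta>' f \<and> semicoalgebra_morphism S B \<Delta> \<epsilon> B' \<Delta>' \<epsilon>' f) Z (g \<Zspot> f)"
    using m by (simp add: XYZ semialgebra_morphism_def semicoalgebra_morphism_def)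
qed

theorem SBialg_isomorphic: "isomorphic_categories (SBialg S) (Bimonoid_cat (SModT S))"
  using isomorphic_categories_refl[OF category_SBialg] by (simp add: SBialg_eq)

section \<open>Bimonad structures on the two tensor functors\<close>

lemma bisemialgebra_structures_eq:
  "bisemialgebra_structures S B = {(\<mu>, \<eta>, \<Delta>, \<epsilon>). is_bimonoid (SModT S) (B, \<mu>, \<eta>, \<Delta>, \<epsilon>)}"
  by (simp add: bisemialgebra_structures_def bisemialgebra_iff del: bisemialgebra.simps is_bimonoid.simps)

theorem left_bimonads:
  assumes "sm B"
  shows "bij_betw
         (\<lambda>(\<mu>, \<eta>, \<Delta>, \<epsilon>).
           (left_mult (SModT S) B \<mu>, left_unit (SModT S) \<eta>,
            left_comult (SModT S) B \<Delta>, left_counit (SModT S) \<epsilon>))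
         (bisemialgebra_structures S B)
         (bimonad_structures (SModT S) (left_tensor (SModT S) B) (left_twist (SModT S) B))"
  using std.bimonoids_bij_bimonads[OF assms, unfolded std_V] unfolding bisemialgebra_structures_eq .

theorem right_bimonads:
  assumes B: "sm B"
  shows "bij_betw
         (\<lambda>(\<mu>, \<eta>, \<Delta>, \<epsilon>).
           (right_mult (SModT S) B \<mu>, right_unit (SModT S) \<eta>,
            right_comult (SModT S) B \<Delta>, right_counit (SModT S) \<epsilon>))
         (bisemialgebra_structures S B)
         (bimonad_structures (SModT S) (right_tensor (SModT S) B) (right_twist (SModT S) B))"
proof -
  interpret rev: semimod_tensor S "\<lambda>M N. tensor S N M" "\<lambda>M N m n. pure S N M n m"
    "\<lambda>f g. tensor_lin S g f" "\<lambda>M N P. assoc_inv P N M" "\<lambda>M N P. Assoc (SModT S) P N M"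
    "RUnit (SModT S)" runit_inv "LUnit (SModT S)" lunit_inv "\<lambda>M N. Twist (SModT S) N M"
    by (rule rev_tensor)
  have fctr: "left_tensor rev.V B = right_tensor (SModT S) B"
    by (simp add: left_tensor_def right_tensor_def)
  have trans: "left_mult rev.V B = right_mult (SModT S) B" "left_unit rev.V = right_unit (SModT S)"
    "left_comult rev.V B = right_comult (SModT S) B" "left_counit rev.V = right_counit (SModT S)"
    "left_twist rev.V B = right_twist (SModT S) B"
    using B by (auto simp: left_mult_def left_unit_def left_comult_def left_counit_def left_twist_def
      right_mult_def right_unit_def right_comult_def right_counit_def right_twist_def inv_arr_SModT
      fun_eq_iff restrict_def)
  have bim: "bimonad_structures rev.V = bimonad_structures (SModT S)"
    by (rule bimonad_structures_cong) (auto simp: SMod_def)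
  have "is_bimonoid rev.V (B, \<mu>, \<eta>, \<Delta>, \<epsilon>) \<longleftrightarrow> is_bimonoid (SModT S) (B, \<mu>, \<eta>, \<Delta>, \<epsilon>)" for \<mu> \<eta> \<Delta> \<epsilon>
  proof -
    have 1: ?thesis if typed: "sm B" "lin \<mu>" "src \<mu> = ten B B" "tgt \<mu> = B" "lin \<eta>" "src \<eta> = I" "tgt \<eta> = B"
      "lin \<Delta>" "src \<Delta> = B" "tgt \<Delta> = ten B B" "lin \<epsilon>" "src \<epsilon> = B" "tgt \<epsilon> = I"
    proof -
      note [simp] = typed
      \<comment> \<open>Interchanging the two middle factors is symmetric under reversal of the four
        factors.\<close>
      have mid: "middle rev.V B B B B = middle (SModT S) B B B B"
        by (rule std.tens_eqI_square[of _ _ B B B B]) simp_all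
      \<comment> \<open>The reversed coassociativity law is stated with the inverse associator;
        transposing it gives back the original law.\<close>
      have assoc: "app (assoc_inv B B B) u = v \<longleftrightarrow> app (Assoc (SModT S) B B B) v = u"
        if "u \<in> carrier (ten B (ten B B))" "v \<in> carrier (ten (ten B B) B)" for u v
        using that std.inverse_apps(1)[of B B B v] std.inverse_apps(2)[of B B B u] by auto
      \<comment> \<open>Reversal exchanges the arguments of \<mu>. The quantifiers over elements
        absorb this, except that multiplicativity of \<epsilon> becomes \<epsilon>(ba) =
        \<epsilon>(a)\<epsilon>(b), which calls for commutativity of S.\<close>
      show ?thesis
        unfolding rev.is_bimonoid_iff[OF typed] rev.is_monoid_iff[OF typed] rev.is_comonoid_iff[OF typed]
          std.is_bimonoid_iff[OF typed, unfolded std_V] std.is_monoid_iff[OF typed, unfolded std_V]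
          std.is_comonoid_iff[OF typed, unfolded std_V] mid
        by (auto simp: assoc intro!: m_comm)
    qed
    let ?typed = "sm B \<and> lin \<mu> \<and> src \<mu> = ten B B \<and> tgt \<mu> = B \<and> lin \<eta> \<and> src \<eta> = I \<and> tgt \<eta> = B \<and>
      lin \<Delta> \<and> src \<Delta> = B \<and> tgt \<Delta> = ten B B \<and> lin \<epsilon> \<and> src \<epsilon> = B \<and> tgt \<epsilon> = I"
    have 2: ?typed if "is_bimonoid rev.V (B, \<mu>, \<eta>, \<Delta>, \<epsilon>)"
      using that by (simp add: is_monoid_def is_comonoid_def)
    have 3: ?typed if "is_bimonoid (SModT S) (B, \<mu>, \<eta>, \<Delta>, \<epsilon>)"
      by (intro conjI typed_bimonoid[OF disjI1[OF that]])
    show ?thesis using 1 2 3 by blast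
  qed
  then have "{(\<mu>, \<eta>, \<Delta>, \<epsilon>). is_bimonoid rev.V (B, \<mu>, \<eta>, \<Delta>, \<epsilon>)} = bisemialgebra_structures S B"
    by (simp only: bisemialgebra_structures_eq)
  with rev.bimonoids_bij_bimonads[OF B] show ?thesis unfolding fctr trans bim by (simp only:)
qed

section \<open>Hopf semimodules\<close>

text \<open>The factorization into the interchange of middle factors and r \<otimes> \<mu> supplies
  the existence behind the definite description; uniqueness comes from pure elements in all four
  arguments.\<close>

lemma act_mult [simp]:
  assumes [simp]: "sm B" "lin \<mu>" "src \<mu> = ten B B" "tgt \<mu> = B" "sm M" "lin r" "src r = ten M B" "tgt r = M"
  shows "lin (act_mult S B \<mu> M r)" "src (act_mult S B \<mu> M r) = ten (ten M B) (ten B B)"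
    "tgt (act_mult S B \<mu> M r) = ten M B"
    "m \<in> carrier M \<Longrightarrow> b \<in> carrier B \<Longrightarrow> c \<in> carrier B \<Longrightarrow> d \<in> carrier B \<Longrightarrow>
      app (act_mult S B \<mu> M r) (pure S (ten M B) (ten B B) (pure S M B m b) (pure S B B c d)) =
      pure S M B (app r (pure S M B m c)) (app \<mu> (pure S B B b d))"
proof -
  have "act_mult S B \<mu> M r = tensor_lin S r \<mu> \<Zspot> middle (SModT S) M B B B"
    unfolding act_mult_def
  proof (rule the_lin_eqI)
    fix g assume "lin g" "src g = ten (ten M B) (ten B B)" "tgt g = ten M B"
      "\<forall>m \<in> carrier M. \<forall>b \<in> carrier B. \<forall>c \<in> carrier B. \<forall>d \<in> carrier B.
         app g (pure S (ten M B) (ten B B) (pure S M B m b) (pure S B B c d)) =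
         pure S M B (app r (pure S M B m c)) (app \<mu> (pure S B B b d))"
    then show "g = tensor_lin S r \<mu> \<Zspot> middle (SModT S) M B B B"
      by (intro std.tens_eqI_square[of _ _ M B B B]) simp_all
  qed simp_all
  then show "lin (act_mult S B \<mu> M r)" "src (act_mult S B \<mu> M r) = ten (ten M B) (ten B B)"
    "tgt (act_mult S B \<mu> M r) = ten M B"
    "m \<in> carrier M \<Longrightarrow> b \<in> carrier B \<Longrightarrow> c \<in> carrier B \<Longrightarrow> d \<in> carrier B \<Longrightarrow>
      app (act_mult S B \<mu> M r) (pure S (ten M B) (ten B B) (pure S M B m b) (pure S B B c d)) =
      pure S M B (app r (pure S M B m c)) (app \<mu> (pure S B B b d))"
    by simp_all
qed

lemma coact_mult [simp]:
  assumes [simp]: "sm B" "lin \<mu>" "src \<mu> = ten B B" "tgt \<mu> = B" "sm L"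
  shows "lin (coact_mult S B \<mu> L)" "src (coact_mult S B \<mu> L) = ten (ten L B) (ten B B)"
    "tgt (coact_mult S B \<mu> L) = ten (ten L B) B"
    "l \<in> carrier L \<Longrightarrow> b \<in> carrier B \<Longrightarrow> c \<in> carrier B \<Longrightarrow> d \<in> carrier B \<Longrightarrow>
      app (coact_mult S B \<mu> L) (pure S (ten L B) (ten B B) (pure S L B l b) (pure S B B c d)) =
      pure S (ten L B) B (pure S L B l c) (app \<mu> (pure S B B b d))"
proof -
  have "coact_mult S B \<mu> L = tensor_lin S (idn (ten L B)) \<mu> \<Zspot> middle (SModT S) L B B B"
    unfolding coact_mult_def
  proof (rule the_lin_eqI)
    fix g assume "lin g" "src g = ten (ten L B) (ten B B)" "tgt g = ten (ten L B) B"
      "\<forall>l \<in> carrier L. \<forall>a \<in> carrier B. \<forall>c \<in> carrier B. \<forall>d \<in> carrier B.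
         app g (pure S (ten L B) (ten B B) (pure S L B l a) (pure S B B c d)) =
         pure S (ten L B) B (pure S L B l c) (app \<mu> (pure S B B a d))"
    then show "g = tensor_lin S (idn (ten L B)) \<mu> \<Zspot> middle (SModT S) L B B B"
      by (intro std.tens_eqI_square[of _ _ L B B B]) simp_all
  qed simp_all
  then show "lin (coact_mult S B \<mu> L)" "src (coact_mult S B \<mu> L) = ten (ten L B) (ten B B)"
    "tgt (coact_mult S B \<mu> L) = ten (ten L B) B"
    "l \<in> carrier L \<Longrightarrow> b \<in> carrier B \<Longrightarrow> c \<in> carrier B \<Longrightarrow> d \<in> carrier B \<Longrightarrow>
      app (coact_mult S B \<mu> L) (pure S (ten L B) (ten B B) (pure S L B l b) (pure S B B c d)) =
      pure S (ten L B) B (pure S L B l c) (app \<mu> (pure S B B b d))"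
    by simp_all
qed

lemma tensor_lin_comp_app:
  "lin f \<Longrightarrow> lin g \<Longrightarrow> lin f' \<Longrightarrow> lin g' \<Longrightarrow> tgt f = src f' \<Longrightarrow> tgt g = src g' \<Longrightarrow>
   z \<in> carrier (ten (src f) (src g)) \<Longrightarrow>
   app (tensor_lin S f' g') (app (tensor_lin S f g) z) = app (tensor_lin S (f' \<Zspot> f) (g' \<Zspot> g)) z"
  using arg_cong[OF std.tarr_comp[of f g f' g'], of "\<lambda>h. app h z"] by simp

text \<open>Coassociativity of a semicomodule is stated with the associator, the comonad law with
  its inverse; this moves it from one side to the other.\<close>

lemma assoc_eq_iff:
  assumes "sm M" "sm N" "sm P" "u \<in> carrier (ten M (ten N P))" "v \<in> carrier (ten (ten M N) P)"
  shows "v = app (assoc_inv M N P) u \<longleftrightarrow> app (Assoc (SModT S) M N P) v = u"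
  using assms std.inverse_apps(1)[of M N P v] std.inverse_apps(2)[of M N P u] by auto

section \<open>Semimodules and semicomodules as Eilenberg-Moore categories\<close>

lemma right_transformations [simp]:
  assumes [simp]: "sm B" "sm X"
  shows "right_mult (SModT S) B \<mu> X = tensor_lin S (idn X) \<mu> \<Zspot> Assoc (SModT S) X B B"
    and "right_comult (SModT S) B \<Delta> X = assoc_inv X B B \<Zspot> tensor_lin S (idn X) \<Delta>"
  by (simp_all add: right_mult_def right_comult_def inv_arr_SModT)

lemma right_transformations_unit [simp]:
  assumes [simp]: "sm X"
  shows "right_unit (SModT S) \<eta> X = tensor_lin S (idn X) \<eta> \<Zspot> runit_inv X"
    and "right_counit (SModT S) \<epsilon> X = RUnit (SModT S) X \<Zspot> tensor_lin S (idn X) \<epsilon>"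
  by (simp_all add: right_unit_def right_counit_def inv_arr_SModT)

lemma right_semimodules_eq_EM:
  assumes [simp]: "sm B" "lin \<mu>" "src \<mu> = ten B B" "tgt \<mu> = B" "lin \<eta>" "src \<eta> = I" "tgt \<eta> = B"
  shows "right_semimodules S B \<mu> \<eta> =
    EM_modules (SModT S) (right_tensor (SModT S) B) (right_mult (SModT S) B \<mu>) (right_unit (SModT S) \<eta>)"
  unfolding right_semimodules_def EM_modules_def
proof (rule structured_cat_cong)
  show "{(M, r). M \<in> Ob (SMod S) \<and> r \<in> Hom (SMod S) (tensor S M B) M \<and>
        (\<forall>m \<in> carrier M. \<forall>b \<in> carrier B. \<forall>c \<in> carrier B.
           app r (pure S M B (app r (pure S M B m b)) c) =
           app r (pure S M B m (app \<mu> (pure S B B b c)))) \<and>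
        (\<forall>m \<in> carrier M. app r (pure S M B m (app \<eta> \<one>)) = m)} =
     {(X, h). X \<in> Ob (SModT S) \<and> h \<in> Hom (SModT S) (FOb (right_tensor (SModT S) B) X) X \<and>
        h \<cdot>\<^bsub>SModT S\<^esub> FAr (right_tensor (SModT S) B) h = h \<cdot>\<^bsub>SModT S\<^esub> right_mult (SModT S) B \<mu> X \<and>
        h \<cdot>\<^bsub>SModT S\<^esub> right_unit (SModT S) \<eta> X = Id (SModT S) X}" (is "?A = ?B")
  proof -
    have "(M, r) \<in> ?A \<longleftrightarrow> (M, r) \<in> ?B" for M r
    \<comment> \<open>Ill-typed pairs lie in neither set; for typed ones the equations of arrows can
      be tested on elements.\<close>
    proof (cases "sm M \<and> lin r \<and> src r = ten M B \<and> tgt r = M")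
      case True
      then have [simp]: "sm M" "lin r" "src r = ten M B" "tgt r = M" by simp_all
      show ?thesis
        by (simp add: Hom_SModT right_tensor_def std.tens_eq_iff_left[of _ _ M B B] std.arr_eq_iff[of _ _ M])
    next
      case False
      then show ?thesis by (auto simp: Hom_SModT right_tensor_def)
    qed
    then show ?thesis by auto
  qed
next
  fix X Y f
  assume "X \<in> {(M, r). M \<in> Ob (SMod S) \<and> r \<in> Hom (SMod S) (tensor S M B) M \<and>
        (\<forall>m \<in> carrier M. \<forall>b \<in> carrier B. \<forall>c \<in> carrier B.
           app r (pure S M B (app r (pure S M B m b)) c) =
           app r (pure S M B m (app \<mu> (pure S B B b c)))) \<and>
        (\<forall>m \<in> carrier M. app r (pure S M B m (app \<eta> \<one>)) = m)}"
    "Y \<in> {(M, r). M \<in> Ob (SMod S) \<and> r \<in> Hom (SMod S) (tensor S M B) M \<and>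
        (\<forall>m \<in> carrier M. \<forall>b \<in> carrier B. \<forall>c \<in> carrier B.
           app r (pure S M B (app r (pure S M B m b)) c) =
           app r (pure S M B m (app \<mu> (pure S B B b c)))) \<and>
        (\<forall>m \<in> carrier M. app r (pure S M B m (app \<eta> \<one>)) = m)}"
    "f \<in> Hom (SMod S) (fst X) (fst Y)"
  moreover obtain M r N r' where XY: "X = (M, r)" "Y = (N, r')" by (metis prod.exhaust)
  ultimately have [simp]: "sm M" "lin r" "src r = ten M B" "tgt r = M" "sm N" "lin r'" "src r' = ten N B"
    "tgt r' = N" "lin f" "src f = M" "tgt f = N" by simp_all
  show "(case X of (M, r) \<Rightarrow> \<lambda>(N, r') f. \<forall>m \<in> carrier M. \<forall>b \<in> carrier B.
        app f (app r (pure S M B m b)) = app r' (pure S N B (app f m) b)) Y f \<longleftrightarrow>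
     (case X of (X, h) \<Rightarrow> \<lambda>(Y, k) f. f \<cdot>\<^bsub>SModT S\<^esub> h = k \<cdot>\<^bsub>SModT S\<^esub> FAr (right_tensor (SModT S) B) f) Y f"
    by (simp add: XY right_tensor_def std.tens_eq_iff[of _ _ M B])
qed (simp_all add: Hom_SModT del: Hom_SMod)

lemma right_semicomodules_eq_EM:
  assumes [simp]: "sm B" "lin \<Delta>" "src \<Delta> = B" "tgt \<Delta> = ten B B" "lin \<epsilon>" "src \<epsilon> = B" "tgt \<epsilon> = I"
  shows "right_semicomodules S B \<Delta> \<epsilon> =
    EM_comodules (SModT S) (right_tensor (SModT S) B) (right_comult (SModT S) B \<Delta>) (right_counit (SModT S) \<epsilon>)"
  unfolding right_semicomodules_def EM_comodules_def
proof (rule structured_cat_cong)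
  show "{(M, \<rho>). M \<in> Ob (SMod S) \<and> \<rho> \<in> Hom (SMod S) M (tensor S M B) \<and>
        (\<forall>m \<in> carrier M.
           app (Assoc (SModT S) M B B) (app (tensor_lin S \<rho> (Id (SMod S) B)) (app \<rho> m)) =
           app (tensor_lin S (Id (SMod S) M) \<Delta>) (app \<rho> m)) \<and>
        (\<forall>m \<in> carrier M.
           app (RUnit (SModT S) M) (app (tensor_lin S (Id (SMod S) M) \<epsilon>) (app \<rho> m)) = m)} =
     {(X, h). X \<in> Ob (SModT S) \<and> h \<in> Hom (SModT S) X (FOb (right_tensor (SModT S) B) X) \<and>
        FAr (right_tensor (SModT S) B) h \<cdot>\<^bsub>SModT S\<^esub> h = right_comult (SModT S) B \<Delta> X \<cdot>\<^bsub>SModT S\<^esub> h \<and>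
        right_counit (SModT S) \<epsilon> X \<cdot>\<^bsub>SModT S\<^esub> h = Id (SModT S) X}" (is "?A = ?B")
  proof -
    have "(M, r) \<in> ?A \<longleftrightarrow> (M, r) \<in> ?B" for M r
    proof (cases "sm M \<and> lin r \<and> src r = M \<and> tgt r = ten M B")
      case True
      then have [simp]: "sm M" "lin r" "src r = M" "tgt r = ten M B" by simp_all
      show ?thesis
        by (simp add: Hom_SModT right_tensor_def std.arr_eq_iff[of _ _ M] assoc_eq_iff)
    next
      case False
      then show ?thesis by (auto simp: Hom_SModT right_tensor_def)
    qed
    then show ?thesis by auto
  qed
next
  fix X Y f
  assume "X \<in> {(M, \<rho>). M \<in> Ob (SMod S) \<and> \<rho> \<in> Hom (SMod S) M (tensor S M B) \<and>
        (\<forall>m \<in> carrier M.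
           app (Assoc (SModT S) M B B) (app (tensor_lin S \<rho> (Id (SMod S) B)) (app \<rho> m)) =
           app (tensor_lin S (Id (SMod S) M) \<Delta>) (app \<rho> m)) \<and>
        (\<forall>m \<in> carrier M.
           app (RUnit (SModT S) M) (app (tensor_lin S (Id (SMod S) M) \<epsilon>) (app \<rho> m)) = m)}"
    "Y \<in> {(M, \<rho>). M \<in> Ob (SMod S) \<and> \<rho> \<in> Hom (SMod S) M (tensor S M B) \<and>
        (\<forall>m \<in> carrier M.
           app (Assoc (SModT S) M B B) (app (tensor_lin S \<rho> (Id (SMod S) B)) (app \<rho> m)) =
           app (tensor_lin S (Id (SMod S) M) \<Delta>) (app \<rho> m)) \<and>
        (\<forall>m \<in> carrier M.
           app (RUnit (SModT S) M) (app (tensor_lin S (Id (SMod S) M) \<epsilon>) (app \<rho> m)) = m)}"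
    "f \<in> Hom (SMod S) (fst X) (fst Y)"
  moreover obtain M r N r' where XY: "X = (M, r)" "Y = (N, r')" by (metis prod.exhaust)
  ultimately have [simp]: "sm M" "lin r" "src r = M" "tgt r = ten M B" "sm N" "lin r'" "src r' = N"
    "tgt r' = ten N B" "lin f" "src f = M" "tgt f = N" by simp_all
  show "(case X of (M, \<rho>) \<Rightarrow> \<lambda>(N, \<rho>') f. \<forall>m \<in> carrier M.
        app \<rho>' (app f m) = app (tensor_lin S f (Id (SMod S) B)) (app \<rho> m)) Y f \<longleftrightarrow>
     (case X of (X, h) \<Rightarrow> \<lambda>(Y, k) f. k \<cdot>\<^bsub>SModT S\<^esub> f = FAr (right_tensor (SModT S) B) f \<cdot>\<^bsub>SModT S\<^esub> h) Y f"
    by (simp add: XY right_tensor_def std.arr_eq_iff[of _ _ M])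
qed (simp_all add: Hom_SModT del: Hom_SMod)

section \<open>The functors - \<otimes> B on semimodules and on semicomodules\<close>

context
  fixes B :: "'u smod" and \<mu> \<eta> \<Delta> \<epsilon> :: "'u slin"
  assumes bisemialgebra: "bisemialgebra S (B, \<mu>, \<eta>, \<Delta>, \<epsilon>)"
begin

lemmas typed [simp] = typed_bimonoid[OF disjI2[OF bisemialgebra]]

abbreviation (input) "sq z w \<equiv>
  app (tensor_lin S \<mu> \<mu>) (app (middle (SModT S) B B B B) (pure S (ten B B) (ten B B) z w))"

lemma bisemialgebra_laws:
  shows "a \<in> carrier B \<Longrightarrow> b \<in> carrier B \<Longrightarrow> c \<in> carrier B \<Longrightarrow>
      app \<mu> (pure S B B (app \<mu> (pure S B B a b)) c) = app \<mu> (pure S B B a (app \<mu> (pure S B B b c)))"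
    and "a \<in> carrier B \<Longrightarrow> app \<mu> (pure S B B (app \<eta> \<one>) a) = a"
    and "a \<in> carrier B \<Longrightarrow> app \<mu> (pure S B B a (app \<eta> \<one>)) = a"
    and "b \<in> carrier B \<Longrightarrow> app (Assoc (SModT S) B B B) (app (tensor_lin S \<Delta> (idn B)) (app \<Delta> b)) =
      app (tensor_lin S (idn B) \<Delta>) (app \<Delta> b)"
    and "b \<in> carrier B \<Longrightarrow> app (RUnit (SModT S) B) (app (tensor_lin S (idn B) \<epsilon>) (app \<Delta> b)) = b"
    and "a \<in> carrier B \<Longrightarrow> b \<in> carrier B \<Longrightarrow> app \<Delta> (app \<mu> (pure S B B a b)) = sq (app \<Delta> a) (app \<Delta> b)"
    and "app \<Delta> (app \<eta> \<one>) = pure S B B (app \<eta> \<one>) (app \<eta> \<one>)"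
    and "a \<in> carrier B \<Longrightarrow> b \<in> carrier B \<Longrightarrow> app \<epsilon> (app \<mu> (pure S B B a b)) = app \<epsilon> a \<otimes> app \<epsilon> b"
    and "app \<epsilon> (app \<eta> \<one>) = \<one>"
  using bisemialgebra
  unfolding bisemialgebra_iff std.is_bimonoid_iff[OF typed, unfolded std_V]
    std.is_monoid_iff[OF typed, unfolded std_V] std.is_comonoid_iff[OF typed, unfolded std_V]
  by blast+

abbreviation (input) "SB \<equiv> right_semimodules S B \<mu> \<eta>"
abbreviation (input) "SB' \<equiv> right_semicomodules S B \<Delta> \<epsilon>"
abbreviation (input) "Fm \<equiv> mod_fctr S B \<mu> \<Delta>"
abbreviation (input) "Fc \<equiv> comod_fctr S B \<mu> \<Delta>"

lemma Ob_SB: "(M, r) \<in> Ob SB \<longleftrightarrow> sm M \<and> lin r \<and> src r = ten M B \<and> tgt r = M \<and>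
    (\<forall>m \<in> carrier M. \<forall>b \<in> carrier B. \<forall>c \<in> carrier B.
       app r (pure S M B (app r (pure S M B m b)) c) = app r (pure S M B m (app \<mu> (pure S B B b c)))) \<and>
    (\<forall>m \<in> carrier M. app r (pure S M B m (app \<eta> \<one>)) = m)"
  by (auto simp: right_semimodules_def structured_cat_def)

lemma Ar_SB: "((M, r), f, (N, r')) \<in> Ar SB \<longleftrightarrow> (M, r) \<in> Ob SB \<and> (N, r') \<in> Ob SB \<and>
    lin f \<and> src f = M \<and> tgt f = N \<and>
    (\<forall>m \<in> carrier M. \<forall>b \<in> carrier B. app f (app r (pure S M B m b)) = app r' (pure S N B (app f m) b))"
  by (auto simp: right_semimodules_def structured_cat_def)

lemma Ob_SB': "(M, \<rho>) \<in> Ob SB' \<longleftrightarrow> sm M \<and> lin \<rho> \<and> src \<rho> = M \<and> tgt \<rho> = ten M B \<and>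
    (\<forall>m \<in> carrier M.
       app (Assoc (SModT S) M B B) (app (tensor_lin S \<rho> (idn B)) (app \<rho> m)) =
       app (tensor_lin S (idn M) \<Delta>) (app \<rho> m)) \<and>
    (\<forall>m \<in> carrier M. app (RUnit (SModT S) M) (app (tensor_lin S (idn M) \<epsilon>) (app \<rho> m)) = m)"
  by (auto simp: right_semicomodules_def structured_cat_def)

lemma Ar_SB': "((M, \<rho>), f, (N, \<rho>')) \<in> Ar SB' \<longleftrightarrow> (M, \<rho>) \<in> Ob SB' \<and> (N, \<rho>') \<in> Ob SB' \<and>
    lin f \<and> src f = M \<and> tgt f = N \<and>
    (\<forall>m \<in> carrier M. app \<rho>' (app f m) = app (tensor_lin S f (idn B)) (app \<rho> m))"
  by (auto simp: right_semicomodules_def structured_cat_def)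

lemma SB_ops:
  "Dom SB (X, f, Y) = X" "Cod SB (X, f, Y) = Y" "Id SB X = (X, idn (fst X), X)"
  "(Y, g, Z) \<cdot>\<^bsub>SB\<^esub> (X, f, Y') = (X, g \<Zspot> f, Z)"
  "Dom SB' (X, f, Y) = X" "Cod SB' (X, f, Y) = Y" "Id SB' X = (X, idn (fst X), X)"
  "(Y, g, Z) \<cdot>\<^bsub>SB'\<^esub> (X, f, Y') = (X, g \<Zspot> f, Z)"
  by (simp_all add: right_semimodules_def right_semicomodules_def structured_cat_def)

lemma Hom_SB: "h \<in> Hom SB X Y \<longleftrightarrow> (\<exists>f. h = (X, f, Y) \<and> (X, f, Y) \<in> Ar SB)"
  by (auto simp: Hom_def right_semimodules_def structured_cat_def)

lemma Hom_SB': "h \<in> Hom SB' X Y \<longleftrightarrow> (\<exists>f. h = (X, f, Y) \<and> (X, f, Y) \<in> Ar SB')"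
  by (auto simp: Hom_def right_semicomodules_def structured_cat_def)

lemma category_SB: "category SB"
  unfolding right_semimodules_def
  by (rule category_structured_cat[OF category_SMod]) (auto simp del: arrow_apps)

lemma category_SB': "category SB'"
  unfolding right_semicomodules_def
  by (rule category_structured_cat[OF category_SMod]) (auto simp: tensor_lin_comp_app simp del: arrow_apps)

text \<open>A composite of known maps equal to the description inside \<open>mod_fctr\<close>;
  \<open>tensor_coaction\<close> does the same for \<open>comod_fctr\<close>.\<close>

definition tensor_action :: "'u smod \<Rightarrow> 'u slin \<Rightarrow> 'u slin" where
  "tensor_action N r = act_mult S B \<mu> N r \<Zspot> tensor_lin S (idn (ten N B)) \<Delta>"

definition tensor_coaction :: "'u smod \<Rightarrow> 'u slin \<Rightarrow> 'u slin" where
  "tensor_coaction L \<rho> = coact_mult S B \<mu> L \<Zspot> tensor_lin S \<rho> \<Delta>"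

lemma tensor_action [simp]:
  assumes [simp]: "sm N" "lin r" "src r = ten N B" "tgt r = N"
  shows "lin (tensor_action N r)" "src (tensor_action N r) = ten (ten N B) B"
    "tgt (tensor_action N r) = ten N B"
    "z \<in> carrier (ten N B) \<Longrightarrow> c \<in> carrier B \<Longrightarrow> app (tensor_action N r) (pure S (ten N B) B z c) =
      app (act_mult S B \<mu> N r) (pure S (ten N B) (ten B B) z (app \<Delta> c))"
  by (simp_all add: tensor_action_def)

lemma tensor_coaction [simp]:
  assumes [simp]: "sm L" "lin \<rho>" "src \<rho> = L" "tgt \<rho> = ten L B"
  shows "lin (tensor_coaction L \<rho>)" "src (tensor_coaction L \<rho>) = ten L B"
    "tgt (tensor_coaction L \<rho>) = ten (ten L B) B"
    "l \<in> carrier L \<Longrightarrow> b \<in> carrier B \<Longrightarrow> app (tensor_coaction L \<rho>) (pure S L B l b) =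
      app (coact_mult S B \<mu> L) (pure S (ten L B) (ten B B) (app \<rho> l) (app \<Delta> b))"
  by (simp_all add: tensor_coaction_def)

lemma FOb_mod_fctr [simp]:
  assumes [simp]: "sm N" "lin r" "src r = ten N B" "tgt r = N"
  shows "FOb Fm (N, r) = (ten N B, tensor_action N r)"
proof -
  have "the_lin S (ten (ten N B) B) (ten N B) (\<lambda>h. \<forall>z \<in> carrier (ten N B). \<forall>c \<in> carrier B.
      h (pure S (ten N B) B z c) = app (act_mult S B \<mu> N r) (pure S (ten N B) (ten B B) z (app \<Delta> c))) =
    tensor_action N r"
  proof (rule the_lin_eqI)
    fix g assume "lin g" "src g = ten (ten N B) B" "tgt g = ten N B"
      "\<forall>z \<in> carrier (ten N B). \<forall>c \<in> carrier B. app g (pure S (ten N B) B z c) =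
         app (act_mult S B \<mu> N r) (pure S (ten N B) (ten B B) z (app \<Delta> c))"
    then show "g = tensor_action N r" by (intro std.tens_eqI[of _ _ "ten N B" B]) simp_all
  qed simp_all
  then show ?thesis by (simp add: mod_fctr_def Let_def)
qed

lemma FOb_comod_fctr [simp]:
  assumes [simp]: "sm L" "lin \<rho>" "src \<rho> = L" "tgt \<rho> = ten L B"
  shows "FOb Fc (L, \<rho>) = (ten L B, tensor_coaction L \<rho>)"
proof -
  have "the_lin S (ten L B) (ten (ten L B) B) (\<lambda>h. \<forall>l \<in> carrier L. \<forall>b \<in> carrier B.
      h (pure S L B l b) = app (coact_mult S B \<mu> L) (pure S (ten L B) (ten B B) (app \<rho> l) (app \<Delta> b))) =
    tensor_coaction L \<rho>"
  proof (rule the_lin_eqI)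
    fix g assume "lin g" "src g = ten L B" "tgt g = ten (ten L B) B"
      "\<forall>l \<in> carrier L. \<forall>b \<in> carrier B. app g (pure S L B l b) =
         app (coact_mult S B \<mu> L) (pure S (ten L B) (ten B B) (app \<rho> l) (app \<Delta> b))"
    then show "g = tensor_coaction L \<rho>" by (intro std.tens_eqI[of _ _ L B]) simp_all
  qed simp_all
  then show ?thesis by (simp add: comod_fctr_def Let_def)
qed

lemma FAr_mod_fctr: "FAr Fm (X, f, Y) = (FOb Fm X, tensor_lin S f (idn B), FOb Fm Y)"
  by (simp add: mod_fctr_def Let_def)

lemma FAr_comod_fctr: "FAr Fc (X, f, Y) = (FOb Fc X, tensor_lin S f (idn B), FOb Fc Y)"
  by (simp add: comod_fctr_def Let_def)

text \<open>N \<otimes> B is a right module over the semialgebra B \<otimes> B, whose product is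
  \<open>sq\<close>. With u = \<Delta>(b) and v = \<Delta>(c) this becomes associativity of
  \<open>tensor_action\<close>, because \<Delta> is multiplicative.\<close>

lemma act_mult_assoc:
  assumes N: "(N, r) \<in> Ob SB"
    and z: "z \<in> carrier (ten N B)" and u: "u \<in> carrier (ten B B)" and v: "v \<in> carrier (ten B B)"
  shows "app (act_mult S B \<mu> N r) (pure S (ten N B) (ten B B)
      (app (act_mult S B \<mu> N r) (pure S (ten N B) (ten B B) z u)) v) =
    app (act_mult S B \<mu> N r) (pure S (ten N B) (ten B B) z (sq u v))"
proof -
  from N have N' [simp]: "sm N" "lin r" "src r = ten N B" "tgt r = N"
    and assoc: "\<And>m b c. m \<in> carrier N \<Longrightarrow> b \<in> carrier B \<Longrightarrow> c \<in> carrier B \<Longrightarrow>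
       app r (pure S N B (app r (pure S N B m b)) c) = app r (pure S N B m (app \<mu> (pure S B B b c)))"
    by (simp_all add: Ob_SB)
  from N'(1) typed(1) z show ?thesis
  proof (induction z rule: std.tens_induct)
    case (pure n b)
    note nb [simp] = pure
    from typed(1) typed(1) u show ?case
    proof (induction u rule: std.tens_induct)
      case (pure c d)
      note [simp] = pure
      from typed(1) typed(1) v show ?case
        by (induction v rule: std.tens_induct) (simp_all add: assoc bisemialgebra_laws(1))
    qed (use v in simp_all)
  qed (use u v in simp_all)
qed

lemma act_mult_unit:
  assumes N: "(N, r) \<in> Ob SB" and z: "z \<in> carrier (ten N B)"
  shows "app (act_mult S B \<mu> N r) (pure S (ten N B) (ten B B) z (pure S B B (app \<eta> \<one>) (app \<eta> \<one>))) = z"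
proof -
  from N have N' [simp]: "sm N" "lin r" "src r = ten N B" "tgt r = N"
    and unit: "\<And>m. m \<in> carrier N \<Longrightarrow> app r (pure S N B m (app \<eta> \<one>)) = m"
    by (simp_all add: Ob_SB)
  from N'(1) typed(1) z show ?thesis
    by (induction z rule: std.tens_induct) (simp_all add: unit bisemialgebra_laws(3))
qed

text \<open>f \<otimes> id is linear over B \<otimes> B; the case u = \<Delta>(c) makes - \<otimes>
  B a functor on right semimodules.\<close>

lemma act_mult_natural:
  assumes f: "((N, r), f, (N', r')) \<in> Ar SB"
    and z: "z \<in> carrier (ten N B)" and u: "u \<in> carrier (ten B B)"
  shows "app (tensor_lin S f (idn B)) (app (act_mult S B \<mu> N r) (pure S (ten N B) (ten B B) z u)) =
    app (act_mult S B \<mu> N' r') (pure S (ten N' B) (ten B B) (app (tensor_lin S f (idn B)) z) u)"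
proof -
  from f have f' [simp]: "sm N" "lin r" "src r = ten N B" "tgt r = N" "sm N'" "lin r'" "src r' = ten N' B" "tgt r' = N'"
      "lin f" "src f = N" "tgt f = N'"
    and lin: "\<And>m b. m \<in> carrier N \<Longrightarrow> b \<in> carrier B \<Longrightarrow>
      app f (app r (pure S N B m b)) = app r' (pure S N' B (app f m) b)"
    by (simp_all add: Ar_SB Ob_SB)
  from f'(1) typed(1) z show ?thesis
  proof (induction z rule: std.tens_induct)
    case (pure n b)
    note [simp] = pure
    from typed(1) typed(1) u show ?case
      by (induction u rule: std.tens_induct) (simp_all add: lin)
  qed (use u in simp_all)
qed

lemma mod_fctr_Ob: "(N, r) \<in> Ob SB \<Longrightarrow> FOb Fm (N, r) \<in> Ob SB"
proof -
  assume N: "(N, r) \<in> Ob SB"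
  then have [simp]: "sm N" "lin r" "src r = ten N B" "tgt r = N" by (simp_all add: Ob_SB)
  show ?thesis
    using N by (simp add: Ob_SB[of "ten N B"] act_mult_assoc act_mult_unit bisemialgebra_laws)
qed

lemma is_functor_mod_fctr: "is_functor SB SB Fm"
  unfolding is_functor_def
proof (intro conjI ballI impI)
  fix X assume "X \<in> Ob SB"
  then show "FOb Fm X \<in> Ob SB" by (cases X) (simp only: mod_fctr_Ob)
next
  fix h assume h: "h \<in> Ar SB"
  obtain N r f N' r' where e: "h = ((N, r), f, (N', r'))" by (metis prod.exhaust)
  have [simp]: "sm N" "lin r" "src r = ten N B" "tgt r = N" "sm N'" "lin r'" "src r' = ten N' B" "tgt r' = N'"
      "lin f" "src f = N" "tgt f = N'" and ob: "(N, r) \<in> Ob SB" "(N', r') \<in> Ob SB"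
    using h by (simp_all add: e Ar_SB Ob_SB)
  show "FAr Fm h \<in> Hom SB (FOb Fm (Dom SB h)) (FOb Fm (Cod SB h))"
    using mod_fctr_Ob[OF ob(1)] mod_fctr_Ob[OF ob(2)] act_mult_natural h
    by (simp add: e SB_ops FAr_mod_fctr Hom_SB Ar_SB[of "ten N B"])
next
  fix X assume X: "X \<in> Ob SB"
  obtain N r where e: "X = (N, r)" by (metis prod.exhaust)
  have [simp]: "sm N" "lin r" "src r = ten N B" "tgt r = N" using X by (simp_all add: e Ob_SB)
  show "FAr Fm (Id SB X) = Id SB (FOb Fm X)" by (simp add: e SB_ops FAr_mod_fctr)
next
  fix h k assume h: "h \<in> Ar SB" "k \<in> Ar SB" "Cod SB h = Dom SB k"
  obtain N r f N' r' where e: "h = ((N, r), f, (N', r'))" by (metis prod.exhaust)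
  obtain N1 r1 f1 N1' r1' where e1: "k = ((N1, r1), f1, (N1', r1'))" by (metis prod.exhaust)
  have [simp]: "lin f" "lin f1" "tgt f = src f1"
    using h by (auto simp add: e e1 Ar_SB SB_ops)
  show "FAr Fm (k \<cdot>\<^bsub>SB\<^esub> h) = FAr Fm k \<cdot>\<^bsub>SB\<^esub> FAr Fm h"
    by (simp add: e e1 SB_ops FAr_mod_fctr std.tarr_comp)
qed

text \<open>Both sides of coassociativity of the coaction are the image of \<open>(id \<otimes> \<Delta>)\<rho>(l) \<otimes> (id \<otimes> \<Delta>)\<Delta>(b)\<close>
  under \<open>(l \<otimes> p) \<otimes> (c \<otimes> q) \<mapsto> (l \<otimes> c) \<otimes> pq\<close> with \<open>p, q \<in> B \<otimes> B\<close>.\<close>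

definition double_coact :: "'u smod \<Rightarrow> 'u slin" where
  "double_coact L = tensor_lin S (idn (ten L B)) (tensor_lin S \<mu> \<mu> \<Zspot> middle (SModT S) B B B B) \<Zspot>
     middle (SModT S) L (ten B B) B (ten B B)"

lemma double_coact [simp]:
  assumes [simp]: "sm L"
  shows "lin (double_coact L)" "src (double_coact L) = ten (ten L (ten B B)) (ten B (ten B B))"
    "tgt (double_coact L) = ten (ten L B) (ten B B)"
    "l \<in> carrier L \<Longrightarrow> p \<in> carrier (ten B B) \<Longrightarrow> c \<in> carrier B \<Longrightarrow> q \<in> carrier (ten B B) \<Longrightarrow>
      app (double_coact L) (pure S (ten L (ten B B)) (ten B (ten B B)) (pure S L (ten B B) l p) (pure S B (ten B B) c q)) =
      pure S (ten L B) (ten B B) (pure S L B l c) (sq p q)"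
  by (simp_all add: double_coact_def)

text \<open>On pure elements \<Delta> meets a product ad in the last factor, and multiplicativity
  splits it into the product of \<Delta>(a) and \<Delta>(d).\<close>

lemma coact_mult_right:
  assumes [simp]: "sm L" and z: "z \<in> carrier (ten L B)" and u: "u \<in> carrier (ten B B)"
  shows "app (tensor_lin S (idn (ten L B)) \<Delta>) (app (coact_mult S B \<mu> L) (pure S (ten L B) (ten B B) z u)) =
    app (double_coact L) (pure S (ten L (ten B B)) (ten B (ten B B))
      (app (tensor_lin S (idn L) \<Delta>) z) (app (tensor_lin S (idn B) \<Delta>) u))"
  using assms(1) typed(1) z
proof (induction z rule: std.tens_induct)
  case (pure l a)
  note [simp] = pure
  from typed(1) typed(1) u show ?case
    by (induction u rule: std.tens_induct) (simp_all add: bisemialgebra_laws(6))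
qed (use u in simp_all)

lemma coact_mult_left:
  assumes [simp]: "sm L" "lin \<rho>" "src \<rho> = L" "tgt \<rho> = ten L B"
    and z: "z \<in> carrier (ten L B)" and u: "u \<in> carrier (ten B B)"
  shows "app (Assoc (SModT S) (ten L B) B B) (app (tensor_lin S (tensor_coaction L \<rho>) (idn B))
      (app (coact_mult S B \<mu> L) (pure S (ten L B) (ten B B) z u))) =
    app (double_coact L) (pure S (ten L (ten B B)) (ten B (ten B B))
      (app (Assoc (SModT S) L B B) (app (tensor_lin S \<rho> (idn B)) z))
      (app (Assoc (SModT S) B B B) (app (tensor_lin S \<Delta> (idn B)) u)))"
proof -
  \<comment> \<open>For z = l \<otimes> a and u = c \<otimes> d, the elements z' and u' stand for
    \<rho>(l) and \<Delta>(c).\<close>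
  have gen: "app (Assoc (SModT S) (ten L B) B B) (pure S (ten (ten L B) B) B
      (app (coact_mult S B \<mu> L) (pure S (ten L B) (ten B B) z' u')) (app \<mu> (pure S B B a d))) =
    app (double_coact L) (pure S (ten L (ten B B)) (ten B (ten B B))
      (app (Assoc (SModT S) L B B) (pure S (ten L B) B z' a))
      (app (Assoc (SModT S) B B B) (pure S (ten B B) B u' d)))"
    if z': "z' \<in> carrier (ten L B)" and u': "u' \<in> carrier (ten B B)" and [simp]: "a \<in> carrier B" "d \<in> carrier B"
    for z' u' a d
    using assms(1) typed(1) z'
  proof (induction z' rule: std.tens_induct)
    case (pure l b)
    note [simp] = pure
    from typed(1) typed(1) u' show ?case
      by (induction u' rule: std.tens_induct) simp_all
  qed (use u' in simp_all)
  from assms(1) typed(1) z show ?thesis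
  proof (induction z rule: std.tens_induct)
    case (pure l a)
    note [simp] = pure
    from typed(1) typed(1) u show ?case
      by (induction u rule: std.tens_induct) (simp_all add: gen)
  qed (use u in simp_all)
qed

text \<open>The counit meets a product ad in the last factor, and \<epsilon>(ad) =
  \<epsilon>(a)\<epsilon>(d) separates the contributions of the two arguments.\<close>

lemma coact_mult_counit:
  assumes [simp]: "sm L" and z: "z \<in> carrier (ten L B)" and u: "u \<in> carrier (ten B B)"
  shows "app (RUnit (SModT S) (ten L B)) (app (tensor_lin S (idn (ten L B)) \<epsilon>)
      (app (coact_mult S B \<mu> L) (pure S (ten L B) (ten B B) z u))) =
    pure S L B (app (RUnit (SModT S) L) (app (tensor_lin S (idn L) \<epsilon>) z))
      (app (RUnit (SModT S) B) (app (tensor_lin S (idn B) \<epsilon>) u))"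
  using assms(1) typed(1) z
proof (induction z rule: std.tens_induct)
  case (pure l a)
  note [simp] = pure
  from typed(1) typed(1) u show ?case
    by (induction u rule: std.tens_induct) (simp_all add: bisemialgebra_laws(8) sm_smult_smult m_comm)
qed (use u in simp_all)

text \<open>At z = \<rho>(l) and u = \<Delta>(b), together with colinearity of f, this gives
  colinearity of f \<otimes> id.\<close>

lemma coact_mult_natural:
  assumes [simp]: "lin f" and z: "z \<in> carrier (ten (src f) B)" and u: "u \<in> carrier (ten B B)"
  shows "app (tensor_lin S (tensor_lin S f (idn B)) (idn B))
      (app (coact_mult S B \<mu> (src f)) (pure S (ten (src f) B) (ten B B) z u)) =
    app (coact_mult S B \<mu> (tgt f)) (pure S (ten (tgt f) B) (ten B B) (app (tensor_lin S f (idn B)) z) u)"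
  using lin_semimodule(1)[OF assms(1)] typed(1) z
proof (induction z rule: std.tens_induct)
  case (pure l a)
  note [simp] = pure
  from typed(1) typed(1) u show ?case
    by (induction u rule: std.tens_induct) simp_all
qed (use u in simp_all)

lemma comod_fctr_Ob: "(L, \<rho>) \<in> Ob SB' \<Longrightarrow> FOb Fc (L, \<rho>) \<in> Ob SB'"
proof -
  assume L: "(L, \<rho>) \<in> Ob SB'"
  then have [simp]: "sm L" "lin \<rho>" "src \<rho> = L" "tgt \<rho> = ten L B" by (simp_all add: Ob_SB')
  have "app (Assoc (SModT S) (ten L B) B B) (app (tensor_lin S (tensor_coaction L \<rho>) (idn B)) (app (tensor_coaction L \<rho>) z)) =
       app (tensor_lin S (idn (ten L B)) \<Delta>) (app (tensor_coaction L \<rho>) z)"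
    and "app (RUnit (SModT S) (ten L B)) (app (tensor_lin S (idn (ten L B)) \<epsilon>) (app (tensor_coaction L \<rho>) z)) = z"
    if z: "z \<in> carrier (ten L B)" for z
  proof -
    \<comment> \<open>On l \<otimes> b both sides are values of \<open>double_coact\<close>;
      coassociativity of \<rho> and of \<Delta> identifies their arguments.\<close>
    from \<open>sm L\<close> typed(1) z
    show "app (Assoc (SModT S) (ten L B) B B) (app (tensor_lin S (tensor_coaction L \<rho>) (idn B)) (app (tensor_coaction L \<rho>) z)) =
       app (tensor_lin S (idn (ten L B)) \<Delta>) (app (tensor_coaction L \<rho>) z)"
      by (induction z rule: std.tens_induct)
        (use L in \<open>simp_all add: coact_mult_left coact_mult_right bisemialgebra_laws(4) Ob_SB'\<close>)
    from \<open>sm L\<close> typed(1) z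
    show "app (RUnit (SModT S) (ten L B)) (app (tensor_lin S (idn (ten L B)) \<epsilon>) (app (tensor_coaction L \<rho>) z)) = z"
      by (induction z rule: std.tens_induct)
        (use L in \<open>simp_all add: coact_mult_counit bisemialgebra_laws(5) Ob_SB'\<close>)
  qed
  then show ?thesis by (simp add: Ob_SB'[of "ten L B"])
qed

lemma is_functor_comod_fctr: "is_functor SB' SB' Fc"
  unfolding is_functor_def
proof (intro conjI ballI impI)
  fix X assume "X \<in> Ob SB'"
  then show "FOb Fc X \<in> Ob SB'" by (cases X) (simp only: comod_fctr_Ob)
next
  fix h assume h: "h \<in> Ar SB'"
  obtain L \<rho> f L' \<rho>' where e: "h = ((L, \<rho>), f, (L', \<rho>'))" by (metis prod.exhaust)
  have [simp]: "sm L" "lin \<rho>" "src \<rho> = L" "tgt \<rho> = ten L B" "sm L'" "lin \<rho>'" "src \<rho>' = L'" "tgt \<rho>' = ten L' B"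
      "lin f" "src f = L" "tgt f = L'" and ob: "(L, \<rho>) \<in> Ob SB'" "(L', \<rho>') \<in> Ob SB'"
    and co: "\<And>m. m \<in> carrier L \<Longrightarrow> app \<rho>' (app f m) = app (tensor_lin S f (idn B)) (app \<rho> m)"
    using h by (simp_all add: e Ar_SB' Ob_SB')
  have "app (tensor_coaction L' \<rho>') (app (tensor_lin S f (idn B)) z) =
      app (tensor_lin S (tensor_lin S f (idn B)) (idn B)) (app (tensor_coaction L \<rho>) z)"
    if z: "z \<in> carrier (ten L B)" for z
    using \<open>sm L\<close> typed(1) z
    by (induction z rule: std.tens_induct) (use coact_mult_natural[of f] in \<open>simp_all add: co\<close>)
  then show "FAr Fc h \<in> Hom SB' (FOb Fc (Dom SB' h)) (FOb Fc (Cod SB' h))"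
    using comod_fctr_Ob[OF ob(1)] comod_fctr_Ob[OF ob(2)]
    by (simp add: e SB_ops FAr_comod_fctr Hom_SB' Ar_SB'[of "ten L B"])
next
  fix X assume X: "X \<in> Ob SB'"
  obtain L \<rho> where e: "X = (L, \<rho>)" by (metis prod.exhaust)
  have [simp]: "sm L" "lin \<rho>" "src \<rho> = L" "tgt \<rho> = ten L B" using X by (simp_all add: e Ob_SB')
  show "FAr Fc (Id SB' X) = Id SB' (FOb Fc X)" by (simp add: e SB_ops FAr_comod_fctr)
next
  fix h k assume h: "h \<in> Ar SB'" "k \<in> Ar SB'" "Cod SB' h = Dom SB' k"
  obtain N r f N' r' where e: "h = ((N, r), f, (N', r'))" by (metis prod.exhaust)
  obtain N1 r1 f1 N1' r1' where e1: "k = ((N1, r1), f1, (N1', r1'))" by (metis prod.exhaust)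
  have [simp]: "lin f" "lin f1" "tgt f = src f1"
    using h by (auto simp add: e e1 Ar_SB' SB_ops)
  show "FAr Fc (k \<cdot>\<^bsub>SB'\<^esub> h) = FAr Fc k \<cdot>\<^bsub>SB'\<^esub> FAr Fc h"
    by (simp add: e e1 SB_ops FAr_comod_fctr std.tarr_comp)
qed


section \<open>Hopf semimodules as comodules and as modules\<close>

definition hopf_condition :: "'u smod \<Rightarrow> 'u slin \<Rightarrow> 'u slin \<Rightarrow> bool" where
  "hopf_condition M r \<rho> \<longleftrightarrow> (\<forall>m \<in> carrier M. \<forall>b \<in> carrier B.
     app \<rho> (app r (pure S M B m b)) =
     app (act_mult S B \<mu> M r) (pure S (ten M B) (ten B B) (app \<rho> m) (app \<Delta> b)))"

lemma SB_comp:
  "((M, r), f, (N, r')) \<in> Ar SB \<Longrightarrow> ((N, r'), g, (P, r'')) \<in> Ar SB \<Longrightarrow> ((M, r), g \<Zspot> f, (P, r'')) \<in> Ar SB"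
  using category.Comp_Hom[OF category_SB, of "((M, r), f, (N, r'))" "(M, r)" "(N, r')" "((N, r'), g, (P, r''))" "(P, r'')"]
  by (simp add: Hom_SB SB_ops)

lemma SB'_comp:
  "((M, \<rho>), f, (N, \<rho>')) \<in> Ar SB' \<Longrightarrow> ((N, \<rho>'), g, (P, \<rho>'')) \<in> Ar SB' \<Longrightarrow> ((M, \<rho>), g \<Zspot> f, (P, \<rho>'')) \<in> Ar SB'"
  using category.Comp_Hom[OF category_SB', of "((M, \<rho>), f, (N, \<rho>'))" "(M, \<rho>)" "(N, \<rho>')" "((N, \<rho>'), g, (P, \<rho>''))" "(P, \<rho>'')"]
  by (simp add: Hom_SB' SB_ops)

lemma SB_id: "(M, r) \<in> Ob SB \<Longrightarrow> ((M, r), idn M, (M, r)) \<in> Ar SB"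
  using category.Id_Hom[OF category_SB, of "(M, r)"] by (simp add: Hom_SB SB_ops)

lemma SB'_id: "(M, \<rho>) \<in> Ob SB' \<Longrightarrow> ((M, \<rho>), idn M, (M, \<rho>)) \<in> Ar SB'"
  using category.Id_Hom[OF category_SB', of "(M, \<rho>)"] by (simp add: Hom_SB' SB_ops)

abbreviation (input) "hopf_Ob \<equiv>
  {(M, r, \<rho>). (M, r) \<in> Ob SB \<and> (M, \<rho>) \<in> Ob SB' \<and> hopf_condition M r \<rho>}"

abbreviation (input) "hopf_arr \<equiv> (\<lambda>(M, r, \<rho>) (N, r', \<rho>') f.
        ((M, r), f, (N, r')) \<in> Ar SB \<and> ((M, \<rho>), f, (N, \<rho>')) \<in> Ar SB')"

lemma hopf_semimodules_eq:
  "hopf_semimodules S (B, \<mu>, \<eta>, \<Delta>, \<epsilon>) = structured_cat (SMod S) hopf_Ob fst hopf_arr"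
  by (simp add: hopf_semimodules_def hopf_condition_def)

lemma category_hopf: "category (structured_cat (SMod S) hopf_Ob fst hopf_arr)"
proof (rule category_structured_cat[OF category_SMod], goal_cases)
  case (1 X)
  then show ?case by (auto simp: Ob_SB)
next
  case (2 X)
  then show ?case by (auto simp: SB_id SB'_id)
next
  case (3 X Y Z f g)
  obtain M r \<rho> N r' \<rho>' P r'' \<rho>'' where
    XYZ: "X = (M, r, \<rho>)" "Y = (N, r', \<rho>')" "Z = (P, r'', \<rho>'')"
    by (metis prod.exhaust)
  have "((M, r), f, (N, r')) \<in> Ar SB" "((N, r'), g, (P, r'')) \<in> Ar SB"
    "((M, \<rho>), f, (N, \<rho>')) \<in> Ar SB'" "((N, \<rho>'), g, (P, \<rho>'')) \<in> Ar SB'"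
    using 3(6,7) by (simp_all add: XYZ)
  from SB_comp[OF this(1,2)] SB'_comp[OF this(3,4)] show ?case by (simp add: XYZ)
qed

abbreviation (input) "comod_Ob \<equiv> {(X, h). X \<in> Ob SB \<and> h \<in> Hom SB X (FOb Fm X) \<and>
        FAr Fm h \<cdot>\<^bsub>SB\<^esub> h = mod_comult S SB B \<mu> \<Delta> X \<cdot>\<^bsub>SB\<^esub> h \<and>
        mod_counit S SB B \<mu> \<Delta> \<epsilon> X \<cdot>\<^bsub>SB\<^esub> h = Id SB X}"

text \<open>The Hopf condition is hidden in the requirement that \<rho> be an arrow of semimodules
  into N \<otimes> B with its \<open>tensor_action\<close>. The remaining comonad laws are those of
  a semicomodule, up to the place of the associator.\<close>

lemma comod_Ob_iff:
  "((M, r), ((M, r), \<rho>, FOb Fm (M, r))) \<in> comod_Ob \<longleftrightarrow> (M, r, \<rho>) \<in> hopf_Ob"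
proof (cases "(M, r) \<in> Ob SB \<and> lin \<rho> \<and> src \<rho> = M \<and> tgt \<rho> = ten M B")
  case True
  then have M: "(M, r) \<in> Ob SB" and [simp]: "lin \<rho>" "src \<rho> = M" "tgt \<rho> = ten M B" by auto
  from M have [simp]: "sm M" "lin r" "src r = ten M B" "tgt r = M" by (simp_all add: Ob_SB)
  have "((M, r), \<rho>, FOb Fm (M, r)) \<in> Hom SB (M, r) (FOb Fm (M, r)) \<longleftrightarrow> hopf_condition M r \<rho>"
    using M mod_fctr_Ob[OF M] by (simp add: Hom_SB Ar_SB[of M] hopf_condition_def)
  then show ?thesis
    using M by (simp add: SB_ops FAr_mod_fctr mod_comult_def mod_counit_def Ob_SB'[of M]
        std.arr_eq_iff[of _ _ M] assoc_eq_iff) blast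
next
  case False
  \<comment> \<open>Both sides force the typing of \<rho>, so both fail in this case.\<close>
  have "lin \<rho> \<and> src \<rho> = M \<and> tgt \<rho> = ten M B"
    if M: "(M, r) \<in> Ob SB" and h: "((M, r), \<rho>, FOb Fm (M, r)) \<in> Hom SB (M, r) (FOb Fm (M, r))"
  proof -
    from M have [simp]: "sm M" "lin r" "src r = ten M B" "tgt r = M" by (simp_all add: Ob_SB)
    show ?thesis using h by (simp add: Hom_SB Ar_SB)
  qed
  with False show ?thesis by (auto simp: Ob_SB' simp del: arrow_apps)
qed

lemma hopf_isomorphic_comodules:
  "isomorphic_categories (hopf_semimodules S (B, \<mu>, \<eta>, \<Delta>, \<epsilon>)) (comodules_over S SB (B, \<mu>, \<eta>, \<Delta>, \<epsilon>))"
proof -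
  have cat: "category (comodules_over S SB (B, \<mu>, \<eta>, \<Delta>, \<epsilon>))"
    unfolding comodules_over_def prod.case by (rule category_EM_comodules[OF category_SB is_functor_mod_fctr])
  \<comment> \<open>The structure map of a comodule is an arrow of semimodules and thus carries its
    end objects as labels; \<open>?\<beta>\<close> reads the bare coaction off it.\<close>
  let ?\<alpha> = "\<lambda>(M, r, \<rho>). ((M, r), ((M, r), \<rho>, FOb Fm (M, r)))"
  let ?\<beta> = "\<lambda>(X, h). (fst X, snd X, fst (snd h))"
  show ?thesis
    using cat category_hopf
    unfolding hopf_semimodules_eq comodules_over_def prod.case EM_comodules_def
  proof (intro isomorphic_structured_twice[where \<alpha> = ?\<alpha> and \<beta> = ?\<beta> and ?U0.0 = fst,
        OF right_semimodules_def], goal_cases)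
    case (3 X)
    obtain M r \<rho> where X: "X = (M, r, \<rho>)" by (metis prod.exhaust)
    show ?case using 3 comod_Ob_iff[of M r \<rho>] unfolding X by simp
  next
    case (4 X)
    then show ?case by auto
  next
    case (5 Y)
    obtain M r h where Y: "Y = ((M, r), h)" by (metis prod.exhaust)
    with 5 have "h \<in> Hom SB (M, r) (FOb Fm (M, r))" by simp
    then obtain \<rho> where h: "h = ((M, r), \<rho>, FOb Fm (M, r))" by (auto simp: Hom_SB)
    show ?case using 5 comod_Ob_iff[of M r \<rho>] unfolding Y h by simp
  next
    case (6 Y)
    then show ?case by (auto simp: Hom_SB)
  next
    case (7 X)
    then show ?case by auto
  next
    case (8 X Y f)
    obtain M r \<rho> N r' \<rho>' where XY: "X = (M, r, \<rho>)" "Y = (N, r', \<rho>')" by (metis prod.exhaust)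
    have ob: "(M, r) \<in> Ob SB" "(M, \<rho>) \<in> Ob SB'" "(N, r') \<in> Ob SB" "(N, \<rho>') \<in> Ob SB'"
      using 8 by (auto simp: XY)
    then have [simp]: "sm M" "lin r" "src r = ten M B" "tgt r = M" "lin \<rho>" "src \<rho> = M" "tgt \<rho> = ten M B"
      "sm N" "lin r'" "src r' = ten N B" "tgt r' = N" "lin \<rho>'" "src \<rho>' = N" "tgt \<rho>' = ten N B"
      by (simp_all add: Ob_SB Ob_SB')
    \<comment> \<open>Once inner labels are removed, the condition on comodule morphisms is
      colinearity of f, tested on the elements of M.\<close>
    show ?case
      using ob by (auto simp: XY Ar_SB Ar_SB' SB_ops FAr_mod_fctr std.arr_eq_iff[of _ _ M])
  qed
qed

abbreviation (input) "mod_Ob \<equiv> {(X, h). X \<in> Ob SB' \<and> h \<in> Hom SB' (FOb Fc X) X \<and>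
        h \<cdot>\<^bsub>SB'\<^esub> FAr Fc h = h \<cdot>\<^bsub>SB'\<^esub> comod_mult S SB' B \<mu> \<Delta> X \<and>
        h \<cdot>\<^bsub>SB'\<^esub> comod_unit S SB' B \<mu> \<eta> \<Delta> X = Id SB' X}"

text \<open>Acting on the first leg turns m \<otimes> c into mc, so \<open>coact_mult\<close>
  followed by r \<otimes> id is \<open>act_mult\<close>. This links colinearity of the action with
  the Hopf condition.\<close>

lemma tensor_action_coaction:
  assumes [simp]: "sm M" "lin r" "src r = ten M B" "tgt r = M"
    and z: "z \<in> carrier (ten M B)" and u: "u \<in> carrier (ten B B)"
  shows "app (tensor_lin S r (idn B)) (app (coact_mult S B \<mu> M) (pure S (ten M B) (ten B B) z u)) =
    app (act_mult S B \<mu> M r) (pure S (ten M B) (ten B B) z u)"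
  using \<open>sm M\<close> typed(1) z
proof (induction z rule: std.tens_induct)
  case (pure m b)
  note [simp] = pure
  from typed(1) typed(1) u show ?case by (induction u rule: std.tens_induct) simp_all
qed (use u in simp_all)

lemma mod_Ob_iff:
  "((M, \<rho>), (FOb Fc (M, \<rho>), r, (M, \<rho>))) \<in> mod_Ob \<longleftrightarrow> (M, r, \<rho>) \<in> hopf_Ob"
proof (cases "(M, \<rho>) \<in> Ob SB' \<and> lin r \<and> src r = ten M B \<and> tgt r = M")
  case True
  then have M: "(M, \<rho>) \<in> Ob SB'" and [simp]: "lin r" "src r = ten M B" "tgt r = M" by auto
  from M have [simp]: "sm M" "lin \<rho>" "src \<rho> = M" "tgt \<rho> = ten M B" by (simp_all add: Ob_SB')
  have "(FOb Fc (M, \<rho>), r, (M, \<rho>)) \<in> Hom SB' (FOb Fc (M, \<rho>)) (M, \<rho>) \<longleftrightarrow>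
      (\<forall>z \<in> carrier (ten M B). app \<rho> (app r z) = app (tensor_lin S r (idn B)) (app (tensor_coaction M \<rho>) z))"
    using M comod_fctr_Ob[OF M] by (simp add: Hom_SB' Ar_SB'[of "ten M B"])
  \<comment> \<open>Passing through an equation of arrows reduces the test from all z to pure
    elements m \<otimes> b, on which the Hopf condition is stated.\<close>
  also have "\<dots> \<longleftrightarrow> \<rho> \<Zspot> r = tensor_lin S r (idn B) \<Zspot> tensor_coaction M \<rho>"
    by (simp add: std.arr_eq_iff[of _ _ "ten M B"])
  also have "\<dots> \<longleftrightarrow> hopf_condition M r \<rho>"
    by (simp add: std.tens_eq_iff[of _ _ M B] hopf_condition_def tensor_action_coaction)
  finally show ?thesis
    using M by (simp add: SB_ops FAr_comod_fctr comod_mult_def comod_unit_def Ob_SB[of M]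
        std.arr_eq_iff[of _ _ M] std.tens_eq_iff_left[of _ _ M B B]) blast
next
  case False
  have "lin r \<and> src r = ten M B \<and> tgt r = M"
    if M: "(M, \<rho>) \<in> Ob SB'" and h: "(FOb Fc (M, \<rho>), r, (M, \<rho>)) \<in> Hom SB' (FOb Fc (M, \<rho>)) (M, \<rho>)"
  proof -
    from M have [simp]: "sm M" "lin \<rho>" "src \<rho> = M" "tgt \<rho> = ten M B" by (simp_all add: Ob_SB')
    show ?thesis using h by (simp add: Hom_SB' Ar_SB')
  qed
  with False show ?thesis by (auto simp: Ob_SB simp del: arrow_apps)
qed

lemma hopf_isomorphic_modules:
  "isomorphic_categories (hopf_semimodules S (B, \<mu>, \<eta>, \<Delta>, \<epsilon>)) (modules_over S SB' (B, \<mu>, \<eta>, \<Delta>, \<epsilon>))"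
proof -
  have cat: "category (modules_over S SB' (B, \<mu>, \<eta>, \<Delta>, \<epsilon>))"
    unfolding modules_over_def prod.case by (rule category_EM_modules[OF category_SB' is_functor_comod_fctr])
  let ?\<alpha> = "\<lambda>(M, r, \<rho>). ((M, \<rho>), (FOb Fc (M, \<rho>), r, (M, \<rho>)))"
  let ?\<beta> = "\<lambda>(X, h). (fst X, fst (snd h), snd X)"
  show ?thesis
    using cat category_hopf
    unfolding hopf_semimodules_eq modules_over_def prod.case EM_modules_def
  proof (intro isomorphic_structured_twice[where \<alpha> = ?\<alpha> and \<beta> = ?\<beta> and ?U0.0 = fst,
        OF right_semicomodules_def], goal_cases)
    case (3 X)
    obtain M r \<rho> where X: "X = (M, r, \<rho>)" by (metis prod.exhaust)
    show ?case using 3 mod_Ob_iff[of M \<rho> r] unfolding X by simp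
  next
    case (4 X)
    then show ?case by auto
  next
    case (5 Y)
    obtain M \<rho> h where Y: "Y = ((M, \<rho>), h)" by (metis prod.exhaust)
    with 5 have "h \<in> Hom SB' (FOb Fc (M, \<rho>)) (M, \<rho>)" by simp
    then obtain r where h: "h = (FOb Fc (M, \<rho>), r, (M, \<rho>))" by (auto simp: Hom_SB')
    show ?case using 5 mod_Ob_iff[of M \<rho> r] unfolding Y h by simp
  next
    case (6 Y)
    then show ?case by (auto simp: Hom_SB')
  next
    case (7 X)
    then show ?case by auto
  next
    case (8 X Y f)
    obtain M r \<rho> N r' \<rho>' where XY: "X = (M, r, \<rho>)" "Y = (N, r', \<rho>')" by (metis prod.exhaust)
    have ob: "(M, r) \<in> Ob SB" "(M, \<rho>) \<in> Ob SB'" "(N, r') \<in> Ob SB" "(N, \<rho>') \<in> Ob SB'"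
      using 8 by (auto simp: XY)
    then have [simp]: "sm M" "lin r" "src r = ten M B" "tgt r = M" "lin \<rho>" "src \<rho> = M" "tgt \<rho> = ten M B"
      "sm N" "lin r'" "src r' = ten N B" "tgt r' = N" "lin \<rho>'" "src \<rho>' = N" "tgt \<rho>' = ten N B"
      by (simp_all add: Ob_SB Ob_SB')
    \<comment> \<open>Tested on m \<otimes> b, the condition on module morphisms is B-linearity of
      f.\<close>
    show ?case
      using ob by (auto simp: XY Ar_SB Ar_SB' SB_ops FAr_comod_fctr std.tens_eq_iff[of _ _ M B])
  qed
qed

lemma comodules_over_EM:
  "isomorphic_categories (comodules_over S SB (B, \<mu>, \<eta>, \<Delta>, \<epsilon>))
     (comodules_over S (EM_modules (SModT S) (right_tensor (SModT S) B) (right_mult (SModT S) B \<mu>)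
        (right_unit (SModT S) \<eta>)) (B, \<mu>, \<eta>, \<Delta>, \<epsilon>))"
proof -
  have "category (comodules_over S SB (B, \<mu>, \<eta>, \<Delta>, \<epsilon>))"
    unfolding comodules_over_def prod.case by (rule category_EM_comodules[OF category_SB is_functor_mod_fctr])
  from isomorphic_categories_refl[OF this] show ?thesis
    by (simp only: right_semimodules_eq_EM typed)
qed

lemma modules_over_EM:
  "isomorphic_categories (modules_over S SB' (B, \<mu>, \<eta>, \<Delta>, \<epsilon>))
     (modules_over S (EM_comodules (SModT S) (right_tensor (SModT S) B) (right_comult (SModT S) B \<Delta>)
        (right_counit (SModT S) \<epsilon>)) (B, \<mu>, \<eta>, \<Delta>, \<epsilon>))"
proof -
  have "category (modules_over S SB' (B, \<mu>, \<eta>, \<Delta>, \<epsilon>))"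
    unfolding modules_over_def prod.case by (rule category_EM_modules[OF category_SB' is_functor_comod_fctr])
  from isomorphic_categories_refl[OF this] show ?thesis
    by (simp only: right_semicomodules_eq_EM typed)
qed

end

end

theorem theorem2p32:
  fixes S :: "'u::infinite ring"
  assumes "comm_semiring S"
    and "\<one>\<^bsub>S\<^esub> \<noteq> \<zero>\<^bsub>S\<^esub>"
  shows "isomorphic_categories (SBialg S) (Bimonoid_cat (SModT S)) \<and>
    (\<forall>B. semimodule S B \<longrightarrow>
       bij_betw
         (\<lambda>(\<mu>, \<eta>, \<Delta>, \<epsilon>).
           (left_mult (SModT S) B \<mu>, left_unit (SModT S) \<eta>,
            left_comult (SModT S) B \<Delta>, left_counit (SModT S) \<epsilon>))
         (bisemialgebra_structures S B)
         (bimonad_structures (SModT S) (left_tensor (SModT S) B) (left_twist (SModT S) B)) \<and>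
       bij_betw
         (\<lambda>(\<mu>, \<eta>, \<Delta>, \<epsilon>).
           (right_mult (SModT S) B \<mu>, right_unit (SModT S) \<eta>,
            right_comult (SModT S) B \<Delta>, right_counit (SModT S) \<epsilon>))
         (bisemialgebra_structures S B)
         (bimonad_structures (SModT S) (right_tensor (SModT S) B) (right_twist (SModT S) B))) \<and>
    (\<forall>B \<mu> \<eta> \<Delta> \<epsilon>. bisemialgebra S (B, \<mu>, \<eta>, \<Delta>, \<epsilon>) \<longrightarrow>
       (let H = (B, \<mu>, \<eta>, \<Delta>, \<epsilon>);
            F = right_tensor (SModT S) B;
            SB = right_semimodules S B \<mu> \<eta>;
            EM = EM_modules (SModT S) F (right_mult (SModT S) B \<mu>) (right_unit (SModT S) \<eta>);
            SB' = right_semicomodules S B \<Delta> \<epsilon>;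
            EM' = EM_comodules (SModT S) F (right_comult (SModT S) B \<Delta>) (right_counit (SModT S) \<epsilon>)
        in isomorphic_categories (hopf_semimodules S H) (comodules_over S SB H) \<and>
           isomorphic_categories (comodules_over S SB H) (comodules_over S EM H) \<and>
           isomorphic_categories (hopf_semimodules S H) (modules_over S SB' H) \<and>
           isomorphic_categories (modules_over S SB' H) (modules_over S EM' H)))"
proof -
  interpret comm_semiring S by (rule assms(1))
  interpret semimod_cat S by unfold_locales
  show ?thesis
    unfolding Let_def
    by (intro conjI allI impI SBialg_isomorphic left_bimonads right_bimonads hopf_isomorphic_comodules
        comodules_over_EM hopf_isomorphic_modules modules_over_EM)
qed

end
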